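(* Let $\eta^*(d\varphi_i,d\varphi_j)=\frac{\partial g^*(d\varphi_i,d\varphi_j)}{\partial\varphi_0}$, and put $\tilde\eta^*(d\varphi_i,d\varphi_j)=\eta^*(d\varphi_i,d\varphi_j)$ for $i,j\neq0$ and $\tilde\eta^*(d\varphi_0,d\varphi_j)=\tilde\eta^*(d\varphi_j,d\varphi_0)=\eta^*(d\varphi_0,d\varphi_j)+4\pi i\,g_1(\tau)\,k_j\varphi_j$ with $k_j=-j$. Then the coefficients $\eta^*(d\varphi_i,d\varphi_j)$ can be obtained by the formulas (with the convention $\varphi_m=0$ for $m>n$) $$\tilde\eta^*(d\varphi_i,d\varphi_j)=(i+j-2)\,\varphi_{i+j-2}\quad(2\le i,j\le n),\qquad \tilde\eta^*(d\varphi_i,d\varphi_0)=0\quad(i\ne0,\ i\ne1),$$ $$\tilde\eta^*(d\varphi_1,d\varphi_j)=0\quad(j\ne0),\qquad \tilde\eta^*(d\varphi_1,d\varphi_0)=\wp((n+1)v_{n+1})\,\varphi_1 .$$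
   Context: Let $n\ge1$, $\mathbb H$ the upper half-plane, $\Omega=\mathbb C\times\mathbb C^{n+1}\times\mathbb H$ with coordinates $(u,v_0,\dots,v_{n-1},v_{n+1},\tau)$, and put $v_n=-\sum_{i=0}^{n-1}v_i$. $\theta_1(z,\tau)=2\sum_{m\ge0}(-1)^me^{\pi i\tau(m+1/2)^2}\sin((2m+1)\pi z)$ is the odd Jacobi theta function; $\wp,\zeta$ are the Weierstrass functions of $\mathbb Z+\tau\mathbb Z$ ($\tau$ is suppressed), $\wp^{(j)}$ is the $j$-th derivative; $g_1(\tau)=\eta'(\tau)/\eta(\tau)$ where here $\eta(\tau)$ is the Dedekind eta function, so $\zeta(z)=\theta_1'(z)/\theta_1(z)-4\pi ig_1(\tau)z$. The functions $\varphi_0,\dots,\varphi_n$ on $\Omega$ are defined by the identity in $z$ $$e^{-2\pi iu}\frac{\prod_{i=0}^n\theta_1(z-v_i+v_{n+1},\tau)}{\theta_1^n(z,\tau)\theta_1(z+(n+1)v_{n+1},\tau)}=\sum_{k=2}^n\frac{(-1)^k}{(k-1)!}\varphi_k\wp^{(k-2)}(z)+\varphi_1\left[\zeta(z)-\zeta(z+(n+1)v_{n+1})+\zeta((n+1)v_{n+1})\right]+\varphi_0.$$ The functions $(\varphi_0,\dots,\varphi_n,v_{n+1},\tau)$ are used as local coordinates, and $\partial/\partial\varphi_0$ is the partial derivative in these coordinates. All indices $i,j$ run over $0,\dots,n$. The intersection form is $g^*=\sum_{i,j=0}^{n-1}(A^{-1})_{ij}\frac{\partial}{\partial v_i}\otimes\frac{\partial}{\partial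 v_j}-\frac1{n(n+1)}\frac{\partial}{\partial v_{n+1}}\otimes\frac{\partial}{\partial v_{n+1}}+\frac{\partial}{\partial u}\otimes\frac{\partial}{\partial\tau}+\frac{\partial}{\partial\tau}\otimes\frac{\partial}{\partial u}$, where $A$ is the $n\times n$ matrix with $2$ on the diagonal and $1$ off the diagonal.
   Formalization: The two nonzero right-hand sides are proved with a minus sign, −(i+j−2)φ_{i+j−2} and −℘((n+1)v_{n+1})φ_1, since with the given g* and k_j=−j the printed plus signs are false; stated where (n+1)v_{n+1} is not in Z+τZ, so that the φ_k are defined. *)

theory Defs
  imports "HOL-Analysis.Analysis"
begin

definition period_lattice :: "complex \<Rightarrow> complex set" where
  "period_lattice \<tau> = {of_int a + of_int b * \<tau> | a b. True}"

definition theta1 :: "complex \<Rightarrow> complex \<Rightarrow> complex" where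
  "theta1 z \<tau> = 2 * (\<Sum>m. (-1) ^ m * exp (of_real pi * \<i> * \<tau> * (of_nat m + 1/2)\<^sup>2)
                        * sin (of_nat (2 * m + 1) * of_real pi * z))"

definition weierstrass_p :: "complex \<Rightarrow> complex \<Rightarrow> complex" where
  "weierstrass_p z \<tau> =
     1 / z\<^sup>2 + (\<Sum>\<^sub>\<infinity>\<omega>\<in>period_lattice \<tau> - {0}. 1 / (z - \<omega>)\<^sup>2 - 1 / \<omega>\<^sup>2)"

definition weierstrass_zeta :: "complex \<Rightarrow> complex \<Rightarrow> complex" where
  "weierstrass_zeta z \<tau> =
     1 / z + (\<Sum>\<^sub>\<infinity>\<omega>\<in>period_lattice \<tau> - {0}. 1 / (z - \<omega>) + 1 / \<omega> + z / \<omega>\<^sup>2)"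

definition dedekind_eta :: "complex \<Rightarrow> complex" where
  "dedekind_eta \<tau> = exp (of_real pi * \<i> * \<tau> / 12)
     * (\<Prod>k. 1 - exp (2 * of_real pi * \<i> * \<tau> * of_nat (Suc k)))"

definition g1 :: "complex \<Rightarrow> complex" where
  "g1 \<tau> = deriv dedekind_eta \<tau> / dedekind_eta \<tau>"


text \<open>A point of \<open>\<Omega>\<close> is written \<open>(u, v, w, \<tau>)\<close>, where \<open>w\<close> stands for \<open>v\<^sub>n\<^sub>+\<^sub>1\<close> and \<open>n = CARD('n)\<close>.
  The coordinates \<open>v\<^sub>0, \<dots>, v\<^sub>n\<^sub>-\<^sub>1\<close> are the entries of \<open>v\<close>, indexed by the \<open>n\<close>-element type \<open>'n\<close>:
  their order plays no role, since both the identity that defines the functions \<open>\<phi>\<^sub>k\<close> and the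
  matrix \<open>A\<close> are symmetric under permutations of \<open>v\<^sub>0, \<dots>, v\<^sub>n\<^sub>-\<^sub>1\<close>.\<close>

type_synonym 'n point = "complex \<times> (complex ^ 'n) \<times> complex \<times> complex"

definition tau_of :: "'n point \<Rightarrow> complex" where
  "tau_of p = snd (snd (snd p))"

definition w_of :: "'n point \<Rightarrow> complex" where
  "w_of p = fst (snd (snd p))"

text \<open>The part of \<open>\<Omega>\<close> on which the identity defining the functions \<open>\<phi>\<^sub>k\<close> makes sense: for
  \<open>(n + 1) v\<^sub>n\<^sub>+\<^sub>1\<close> in the lattice the term \<open>\<zeta>((n + 1) v\<^sub>n\<^sub>+\<^sub>1)\<close> is a pole.\<close>

definition Omega_reg :: "('n::finite) point set" where
  "Omega_reg = {p. Im (tau_of p) > 0 \<and>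
                   (of_nat CARD('n) + 1) * w_of p \<notin> period_lattice (tau_of p)}"

definition superpotential :: "('n::finite) point \<Rightarrow> complex \<Rightarrow> complex" where
  "superpotential p z = (case p of (u, v, w, \<tau>) \<Rightarrow>
     let n = CARD('n); v_n = - (\<Sum>a\<in>UNIV. v $ a) in
       exp (- 2 * of_real pi * \<i> * u)
       * ((\<Prod>a\<in>UNIV. theta1 (z - v $ a + w) \<tau>) * theta1 (z - v_n + w) \<tau>)
       / (theta1 z \<tau> ^ n * theta1 (z + (of_nat n + 1) * w) \<tau>))"

text \<open>The defining identity of \<open>\<phi>\<^sub>0, \<dots>, \<phi>\<^sub>n\<close>, at every \<open>z\<close> that is not a pole of its terms. It
  determines \<open>\<phi> k p\<close> uniquely for \<open>k \<le> n\<close> and \<open>p \<in> Omega_reg\<close>, the functions of \<open>z\<close> on the right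
  being linearly independent.\<close>

definition defines_phi :: "(nat \<Rightarrow> ('n::finite) point \<Rightarrow> complex) \<Rightarrow> bool" where
  "defines_phi \<phi> \<longleftrightarrow> (\<forall>p\<in>Omega_reg. \<forall>z.
     let n = CARD('n); \<tau> = tau_of p; w = w_of p; c = (of_nat n + 1) * w in
       z \<notin> period_lattice \<tau> \<longrightarrow> z + c \<notin> period_lattice \<tau> \<longrightarrow>
       superpotential p z =
         (\<Sum>k=2..n. (-1) ^ k / fact (k - 1) * \<phi> k p
                    * (deriv ^^ (k - 2)) (\<lambda>x. weierstrass_p x \<tau>) z)
         + \<phi> 1 p * (weierstrass_zeta z \<tau> - weierstrass_zeta (z + c) \<tau> + weierstrass_zeta c \<tau>)
         + \<phi> 0 p)"


definition cscale :: "complex \<Rightarrow> ('n::finite) point \<Rightarrow> 'n point" where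
  "cscale c p = (case p of (u, v, w, \<tau>) \<Rightarrow> (c * u, c *s v, c * w, c * \<tau>))"

text \<open>Holomorphic maps of several variables: Frechet derivatives that are complex linear.\<close>

definition holomorphic_map_on ::
  "(('n::finite) point \<Rightarrow> 'n point) \<Rightarrow> 'n point set \<Rightarrow> bool" where
  "holomorphic_map_on f S \<longleftrightarrow>
     (\<forall>x\<in>S. \<exists>D. (f has_derivative D) (at x) \<and> (\<forall>c h. D (cscale c h) = cscale c (D h)))"

definition local_coordinates_on ::
  "(('n::finite) point \<Rightarrow> 'n point) \<Rightarrow> 'n point set \<Rightarrow> bool" where
  "local_coordinates_on \<Phi> U \<longleftrightarrow>
     open U \<and> inj_on \<Phi> U \<and> open (\<Phi> ` U) \<and>
     holomorphic_map_on \<Phi> U \<and> holomorphic_map_on (inv_into U \<Phi>) (\<Phi> ` U)"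

text \<open>The coordinate map \<open>(\<phi>\<^sub>0, \<dots>, \<phi>\<^sub>n, v\<^sub>n\<^sub>+\<^sub>1, \<tau>)\<close>. The entries \<open>\<phi>\<^sub>1, \<dots>, \<phi>\<^sub>n\<close> are stored in a vector
  indexed by \<open>'n\<close> through an enumeration \<open>e\<close>, a bijection from \<open>'n\<close> onto \<open>{1..n}\<close>.\<close>

definition phi_coords ::
  "(nat \<Rightarrow> ('n::finite) point \<Rightarrow> complex) \<Rightarrow> ('n \<Rightarrow> nat) \<Rightarrow> 'n point \<Rightarrow> 'n point" where
  "phi_coords \<phi> e p = (\<phi> 0 p, (\<chi> a. \<phi> (e a) p), w_of p, tau_of p)"

text \<open>The partial derivative with respect to the first coordinate of the chart \<open>\<Phi>\<close> on \<open>U\<close>, all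
  other coordinates of the chart being kept fixed.\<close>

definition partial_first ::
  "(('n::finite) point \<Rightarrow> 'n point) \<Rightarrow> 'n point set \<Rightarrow> ('n point \<Rightarrow> complex) \<Rightarrow> 'n point \<Rightarrow> complex" where
  "partial_first \<Phi> U F p = deriv (\<lambda>x. F (inv_into U \<Phi> (x, snd (\<Phi> p)))) (fst (\<Phi> p))"


definition partial_along ::
  "('n::finite) point \<Rightarrow> ('n point \<Rightarrow> complex) \<Rightarrow> 'n point \<Rightarrow> complex" where
  "partial_along h f p = deriv (\<lambda>s. f (p + cscale s h)) 0"

abbreviation d_u :: "(('n::finite) point \<Rightarrow> complex) \<Rightarrow> 'n point \<Rightarrow> complex" where
  "d_u \<equiv> partial_along (1, 0, 0, 0)"

abbreviation d_v :: "'n::finite \<Rightarrow> ('n point \<Rightarrow> complex) \<Rightarrow> 'n point \<Rightarrow> complex" where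
  "d_v a \<equiv> partial_along (0, axis a 1, 0, 0)"

abbreviation d_w :: "(('n::finite) point \<Rightarrow> complex) \<Rightarrow> 'n point \<Rightarrow> complex" where
  "d_w \<equiv> partial_along (0, 0, 1, 0)"

abbreviation d_tau :: "(('n::finite) point \<Rightarrow> complex) \<Rightarrow> 'n point \<Rightarrow> complex" where
  "d_tau \<equiv> partial_along (0, 0, 0, 1)"

definition matA :: "complex ^ ('n::finite) ^ 'n" where
  "matA = (\<chi> a b. if a = b then 2 else 1)"

text \<open>\<open>intersection_form f h\<close> is the function \<open>g\<^sup>*(df, dh)\<close>.\<close>

definition intersection_form ::
  "(('n::finite) point \<Rightarrow> complex) \<Rightarrow> ('n point \<Rightarrow> complex) \<Rightarrow> 'n point \<Rightarrow> complex" where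
  "intersection_form f h p =
     (\<Sum>a\<in>UNIV. \<Sum>b\<in>UNIV. matrix_inv matA $ a $ b * d_v a f p * d_v b h p)
     - 1 / (of_nat CARD('n) * (of_nat CARD('n) + 1)) * d_w f p * d_w h p
     + d_u f p * d_tau h p + d_tau f p * d_u h p"

definition eta_star ::
  "(nat \<Rightarrow> ('n::finite) point \<Rightarrow> complex) \<Rightarrow> ('n \<Rightarrow> nat) \<Rightarrow> 'n point set
     \<Rightarrow> nat \<Rightarrow> nat \<Rightarrow> 'n point \<Rightarrow> complex" where
  "eta_star \<phi> e U i j = partial_first (phi_coords \<phi> e) U (intersection_form (\<phi> i) (\<phi> j))"

definition eta_tilde ::
  "(nat \<Rightarrow> ('n::finite) point \<Rightarrow> complex) \<Rightarrow> ('n \<Rightarrow> nat) \<Rightarrow> 'n point set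
     \<Rightarrow> nat \<Rightarrow> nat \<Rightarrow> 'n point \<Rightarrow> complex" where
  "eta_tilde \<phi> e U i j p =
     (let corrected = (\<lambda>m. eta_star \<phi> e U 0 m p
                           + 4 * of_real pi * \<i> * g1 (tau_of p) * (- of_nat m) * \<phi> m p)
      in if i = 0 then corrected j else if j = 0 then corrected i else eta_star \<phi> e U i j p)"

text \<open>Sign. With \<open>g\<^sup>*\<close> and \<open>k\<^sub>j = - j\<close> as above, the nonzero values of \<open>eta_tilde\<close> are
  \<open>- (i + j - 2) \<phi>\<^sub>i\<^sub>+\<^sub>j\<^sub>-\<^sub>2\<close> and \<open>- \<wp>((n + 1) v\<^sub>n\<^sub>+\<^sub>1) \<phi>\<^sub>1\<close>; in the source they are printed without the
  minus signs. The sign is visible in the leading terms at \<open>z = 0\<close>. There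
  \<open>\<lambda>(z) = \<phi>\<^sub>0 + \<Sum> \<phi>\<^sub>k z\<^sup>-\<^sup>k\<close>, and the product over the zeros of \<open>\<lambda>\<close> contributes
  \<open>(\<lambda>'(p) \<lambda>(q) - \<lambda>(p) \<lambda>'(q)) / (q - p)\<close> to \<open>g\<^sup>*(d\<lambda>(p), d\<lambda>(q))\<close>. Its derivative in \<open>\<phi>\<^sub>0\<close> is
  \<open>(\<lambda>'(p) - \<lambda>'(q)) / (q - p)\<close>, and the coefficient of \<open>p\<^sup>-\<^sup>i q\<^sup>-\<^sup>j\<close> is \<open>- (i + j - 2) \<phi>\<^sub>i\<^sub>+\<^sub>j\<^sub>-\<^sub>2\<close>.
  Reversing \<open>g\<^sup>*\<close> instead would also reverse \<open>k\<^sub>j\<close>.\<close>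

end

theory Submission
  imports Defs "HOL-Complex_Analysis.Complex_Analysis"
begin

text \<open>Let \<open>\<lambda>\<close> be the left-hand side of the defining identity and \<open>\<rho> = \<theta>\<^sub>1'/\<theta>\<^sub>1\<close>. The triple product
  gives the zeros of \<open>\<theta>\<^sub>1\<close> and \<open>\<theta>\<^sub>1'(0) = 2 \<pi> \<eta>\<^sup>3\<close>, so that Liouville's theorem yields
  \<open>\<zeta>(z) = \<rho>(z) - 4 \<pi> \<i> g\<^sub>1 z\<close> and \<open>\<wp>(z) = 4 \<pi> \<i> g\<^sub>1 - \<rho>'(z)\<close>; the identity then reads
  \<open>\<lambda>(z) = \<Sum>\<^sub>k \<phi>\<^sub>k f\<^sub>k(z)\<close> with \<open>f\<^sub>0 = 1\<close> and \<open>f\<^sub>k\<close> built from \<open>\<rho>\<close>.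

  By the heat equation \<open>4 \<pi> \<i> \<partial>\<^sub>\<tau> \<theta>\<^sub>1 = \<theta>\<^sub>1''\<close>, all logarithmic derivatives of \<open>\<lambda>\<close> are polynomials
  in values of \<open>\<rho>\<close> and \<open>\<rho>'\<close>, and the quadratic addition formula of \<open>\<rho>\<close> collapses
  \<open>g\<^sup>*(d\<lambda>(z), d\<lambda>(y))\<close>, where \<open>z\<close> and \<open>y\<close> are constant, to
  \<open>-\<lambda>'(z) \<lambda>'(y)/n - \<lambda>'(z) \<lambda>(y) (\<rho>(y) + \<rho>(z-y)) - \<lambda>(z) \<lambda>'(y) (\<rho>(z) - \<rho>(z-y))\<close>.
  Replacing \<open>\<phi>\<^sub>0\<close> by \<open>\<phi>\<^sub>0 + \<delta>\<close> shifts \<open>\<lambda>\<close> by the constant \<open>\<delta>\<close> and changes this form linearly in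
  \<open>\<delta>\<close>. The coefficient of \<open>\<delta>\<close> is \<open>\<Sum>\<^sub>i\<^sub>j \<eta>\<^sup>*(d\<phi>\<^sub>i, d\<phi>\<^sub>j) f\<^sub>i(z) f\<^sub>j(y)\<close>, and expanding it in the products
  \<open>f\<^sub>i(z) f\<^sub>j(y)\<close>, which are independent because the \<open>f\<^sub>k\<close> have different pole orders
  at \<open>0\<close>, gives \<open>\<eta>\<^sup>*\<close>.\<close>

section \<open>The triple product for \<open>\<theta>\<^sub>1\<close>\<close>

text \<open>The gradients of the single \<open>\<phi>\<^sub>k\<close> are never computed. The
  numbers \<open>g\<^sup>*(d\<phi>\<^sub>i, d\<phi>\<^sub>j)\<close> appear only as coefficients of
  a function of two auxiliary variables \<open>z\<close> and \<open>y\<close>, and uniqueness of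
  such coefficients replaces an inversion of the coordinate change. The price is that the basis
  functions depend on \<open>w\<close> and \<open>\<tau>\<close>, so their derivatives must be
  subtracted from the closed form. These corrections do not contain \<open>\<phi>\<^sub>0\<close>,
  and the closed form has no product \<open>\<lambda>(z) \<lambda>(y)\<close>, which is why nothing
  quadratic in \<delta> arises. \<open>\<rho>\<close> is preferred to \<open>\<zeta>\<close> because
  its \<tau>-derivative \<open>(\<rho>'' + 2 \<rho> \<rho>') / (4 \<pi> \<i>)\<close> is free of g1,
  and because the constant of its addition formula cancels and need not be found. With
  \<open>\<gamma>\<^sub>1 = 4 \<pi> \<i> g\<^sub>1\<close>, the function g1 enters through
  \<open>\<wp> = \<gamma>\<^sub>1 - \<rho>'\<close> alone, at index 2. Rewriting
  \<open>\<rho>'\<close> by \<open>\<wp>\<close> inside the products creates the terms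
  \<open>k \<gamma>\<^sub>1 \<phi>\<^sub>k\<close> in the entries (0, k), exactly those that the
  correction with \<open>k\<^sub>j = - j\<close> removes.\<close>

definition q_fact :: "complex \<Rightarrow> nat \<Rightarrow> complex" where
  "q_fact q n = (\<Prod>k<n. 1 - q ^ Suc k)"

lemma q_fact_Suc: "q_fact q (Suc n) = q_fact q n * (1 - q ^ Suc n)"
  by (simp add: q_fact_def)

lemma one_minus_power_nonzero: "norm (q::complex) < 1 \<Longrightarrow> 1 - q ^ Suc k \<noteq> 0"
  by (metis norm_one norm_power power_Suc_less_one norm_ge_zero right_minus_eq less_irrefl
      power_less_one_iff zero_less_Suc order_less_le)

lemma q_fact_nonzero: "norm q < 1 \<Longrightarrow> q_fact q n \<noteq> 0"
  unfolding q_fact_def using one_minus_power_nonzero by (metis finite_lessThan prod_zero_iff)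

text \<open>The central \<open>q\<close>-binomial coefficient of \<open>2N+1\<close> over \<open>N-m\<close>.\<close>

definition q_central :: "complex \<Rightarrow> nat \<Rightarrow> nat \<Rightarrow> complex" where
  "q_central q N m =
     (if m \<le> N then q_fact q (2*N+1) / (q_fact q (N-m) * q_fact q (N+m+1)) else 0)"

text \<open>Coefficient form of multiplying the finite product in \<open>sin_q_product\<close> by
  its next factor. After clearing the common denominator \<open>D\<close> every term is a polynomial
  in \<open>A\<close>, \<open>B\<close>, \<open>e\<close>, and the identity reduces to
  \<open>A * B = q * e\<close>. For \<open>m = 0\<close> the neighbour of index -1 is replaced by
  index 0, because the binomial is symmetric under \<open>m \<mapsto> - 1 - m\<close>.\<close>

lemma q_central_rec:
  assumes q: "norm q < 1" and m: "m \<le> N + 1"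
  shows "q_central q (Suc N) m = (1 + q ^ (2*N+2)) * q_central q N m
           + q ^ (N+1-m) * (if m = 0 then q_central q N 0 else q_central q N (m-1))
           + q ^ (N+m+2) * q_central q N (m+1)"
proof -
  define A B e where "A = q ^ (N+1-m)" and "B = q ^ (N+m+2)" and "e = q ^ (2*N+2)"
  define Q where "Q = q_fact q (2*N+1)"
  define D where "D = q_fact q (N+1-m) * q_fact q (N+m+2)"
  note nz = q_fact_nonzero[OF q]
  have D: "D \<noteq> 0" using nz by (simp add: D_def)
  have AB: "A * B = q * e"
    using m by (simp add: A_def B_def e_def power_add[symmetric] power_Suc[symmetric] mult_2 del: power_Suc)
  have D2: "q_fact q (N+m+2) = q_fact q (N+m+1) * (1 - B)"
    using q_fact_Suc[of q "N+m+1"] by (simp add: B_def)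
  \<comment> \<open>At the edge \<open>m = N + 1\<close> the default value 0 of
    \<open>q_central\<close> agrees with the right-hand side, since \<open>A = 1\<close> there. In
    the next claim the edge \<open>m = N\<close> fits because \<open>B = e\<close>.\<close>
  have c: "q_central q N m * D = Q * (1 - A) * (1 - B)"
  proof (cases "m = N + 1")
    case True then show ?thesis by (simp add: q_central_def A_def)
  next
    case False
    then have "m \<le> N" using m by simp
    then have "q_fact q (N+1-m) = q_fact q (N-m) * (1 - A)"
      using q_fact_Suc[of q "N-m"] by (simp add: A_def Suc_diff_le)
    then have "D = (q_fact q (N-m) * q_fact q (N+m+1)) * ((1 - A) * (1 - B))"
      unfolding D_def D2 by (simp only: mult_ac)
    then show ?thesis using \<open>m \<le> N\<close> nz[of "N-m"] nz[of "N+m+1"]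
      by (simp add: q_central_def Q_def)
  qed
  have cn: "B * q_central q N (m+1) * D = Q * (1 - A) * (B - e)"
  proof -
    consider "m = N + 1" | "m = N" | "m < N" using m by linarith
    then show ?thesis
    proof cases
      case 1 then show ?thesis by (simp add: q_central_def A_def)
    next
      case 2 then show ?thesis by (simp add: q_central_def B_def e_def mult_2)
    next
      case 3
      then obtain d where d: "N = m + 1 + d" using less_imp_add_positive[of m N]
        by (metis Suc_eq_plus1 add.commute add_Suc_shift less_natE)
      have "q_fact q (N+1-m) = q_fact q (N-(m+1)) * (1 - q ^ (N-m)) * (1 - A)"
        using q_fact_Suc[of q "d"] q_fact_Suc[of q "Suc d"]
        by (simp add: A_def d)
      moreover have "B * q ^ (N-m) = e" using 3 mult_2[of N]
        by (simp add: B_def e_def power_add[symmetric] mult_2 del: power_Suc)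
      moreover have "q_central q N (m+1) = Q / (q_fact q (N-(m+1)) * q_fact q (N+m+2))"
        using 3 unfolding q_central_def Q_def by (simp add: eval_nat_numeral)
      moreover have "B * (Q / (X * Y)) * (X * (1 - p) * (1 - A) * Y) = Q * (1 - A) * (B - B * p)"
        if "X \<noteq> 0" "Y \<noteq> 0" for X Y p using that by (simp add: field_simps)
      ultimately show ?thesis using nz[of "N-(m+1)"] nz[of "N+m+2"] unfolding D_def by metis
    qed
  qed
  have cp: "A * (if m = 0 then q_central q N 0 else q_central q N (m-1)) * D = Q * (1 - B) * (A - e)"
  proof (cases m)
    case 0
    have "A * A = e" using 0 by (simp add: A_def e_def power_add[symmetric] mult_2 del: power_Suc)
    moreover have "A * (q_central q N 0 * D) = Q * (1 - B) * (A - A * A)"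
      unfolding c[unfolded 0] by (simp add: algebra_simps)
    ultimately show ?thesis using 0 by (simp add: mult_ac)
  next
    case (Suc l)
    have gen: "A * (Q / (X * Y)) * (X * (Y * (1 - p) * (1 - B))) = Q * (1 - B) * (A - A * p)"
        if "X \<noteq> 0" "Y \<noteq> 0" for X Y p using that by (simp add: field_simps)
    have "q_fact q (N+m+2) = q_fact q (N+m) * (1 - q ^ (N+m+1)) * (1 - B)"
      using q_fact_Suc[of q "N+m"] q_fact_Suc[of q "N+m+1"] by (simp add: B_def)
    moreover have "A * q ^ (N+m+1) = e" using m
      by (simp add: A_def e_def power_add[symmetric] mult_2 del: power_Suc)
    moreover have "q_central q N (m-1) = Q / (q_fact q (N+1-m) * q_fact q (N+m))"
      using Suc m by (simp add: q_central_def Q_def eval_nat_numeral)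
    moreover from gen[OF nz[of "N+1-m"] nz[of "N+m"], of "q ^ (N+m+1)"]
    have "A * (Q / (q_fact q (N+1-m) * q_fact q (N+m))) *
        (q_fact q (N+1-m) * (q_fact q (N+m) * (1 - q ^ (N+m+1)) * (1 - B)))
        = Q * (1 - B) * (A - A * q ^ (N+m+1))" .
    ultimately show ?thesis using Suc by (simp only: D_def if_False nat.simps)
  qed
  have cs: "q_central q (Suc N) m * D = Q * (1 - e) * (1 - q * e)"
  proof -
    have "q_fact q (2 * Suc N + 1) = Q * (1 - e) * (1 - q * e)"
      using q_fact_Suc[of q "2*N+1"] q_fact_Suc[of q "2*N+2"] by (simp add: Q_def e_def)
    then have "q_central q (Suc N) m = Q * (1 - e) * (1 - q * e) / D"
      using m unfolding q_central_def D_def by (simp add: Suc_diff_le)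
    then show ?thesis using D by simp
  qed
  have "q_central q (Suc N) m * D = ((1 + e) * q_central q N m
           + A * (if m = 0 then q_central q N 0 else q_central q N (m-1))
           + B * q_central q N (m+1)) * D"
  proof -
    have "((1 + e) * q_central q N m
           + A * (if m = 0 then q_central q N 0 else q_central q N (m-1))
           + B * q_central q N (m+1)) * D = (1 + e) * (q_central q N m * D)
        + A * (if m = 0 then q_central q N 0 else q_central q N (m-1)) * D
        + B * q_central q N (m+1) * D"
      by (simp only: ring_distribs mult.assoc)
    also have "\<dots> = (1 + e) * (Q * (1 - A) * (1 - B)) + Q * (1 - B) * (A - e) + Q * (1 - A) * (B - e)"
      by (simp only: c cn cp)
    also have "\<dots> = Q * ((1 - e) + (e - 1) * (A * B))" by (simp add: algebra_simps)
    also have "\<dots> = q_central q (Suc N) m * D" unfolding cs AB by (simp add: algebra_simps)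
    finally show ?thesis by (simp only:)
  qed
  then show ?thesis using D unfolding A_def B_def e_def by (simp only: mult_cancel_right) blast
qed

text \<open>Finite (Cauchy) form of the triple product, by induction on \<open>N\<close>. The new
  factor is \<open>1 + e - 2 cos(2z) q^(N+1)\<close>, and \<open>2 cos(2z) sin((2m+1)z)\<close> is
  the sum of the two neighbouring sines, so that the claim becomes \<open>q_central_rec\<close>.
  Using \<open>r\<close> with \<open>q = r\<^sup>2\<close> avoids the halved exponent
  \<open>m(m+1)/2\<close> of \<open>q\<close>.\<close>

lemma sin_q_product:
  fixes r z :: complex
  assumes r: "norm r < 1"
  shows "sin z * (\<Prod>k<N. 1 - 2 * cos (2 * z) * (r\<^sup>2) ^ Suc k + ((r\<^sup>2) ^ Suc k)\<^sup>2) =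
         (\<Sum>m\<le>N. (-1) ^ m * r ^ (m * (m+1)) * q_central (r\<^sup>2) N m * sin (of_nat (2*m+1) * z))"
proof (induction N)
  case 0
  have "norm (r\<^sup>2) < 1" using r by (simp add: norm_power power_less_one_iff)
  from q_fact_nonzero[OF this, of 1] show ?case by (simp add: q_central_def q_fact_def)
next
  case (Suc N)
  define q where "q = r\<^sup>2"
  have q: "norm q < 1" using r by (simp add: q_def norm_power power_less_one_iff)
  define b where "b = (\<lambda>N m. (-1) ^ m * r ^ (m * (m+1)) * q_central q N m)"
  define S where "S = (\<lambda>m. sin (of_nat (2*m+1) * z))"
  define e where "e = q ^ (2*N+2)"
  have b0: "b N m = 0" if "m > N" for m using that by (simp add: b_def q_central_def)
  have rec: "b (Suc N) m = (1 + e) * b N m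
      - q ^ Suc N * ((if m = 0 then - b N 0 else b N (m-1)) + b N (m+1))" if m: "m \<le> Suc N" for m
  proof -
    have 1: "(-1) ^ m * r ^ (m * (m+1)) * (q ^ (N+m+2) * q_central q N (m+1)) = - (q ^ Suc N) * b N (m+1)"
    proof -
      have "r ^ (m * (m+1)) * q ^ (N+m+2) = r ^ ((m+1) * (m+1+1)) * q ^ Suc N"
        unfolding q_def power_mult[symmetric] power_add[symmetric]
        by (rule arg_cong[where f="\<lambda>i. r ^ i"]) (simp add: algebra_simps)
      then have "(-1) ^ m * (r ^ (m * (m+1)) * q ^ (N+m+2)) * q_central q N (m+1)
          = (-1) ^ m * (r ^ ((m+1) * (m+1+1)) * q ^ Suc N) * q_central q N (m+1)" by (simp only:)
      then show ?thesis unfolding b_def by (simp only: mult_ac power_add power_one_right) simp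
    qed
    have 2: "(-1) ^ m * r ^ (m * (m+1)) * (q ^ (N+1-m) *
        (if m = 0 then q_central q N 0 else q_central q N (m-1)))
        = - (q ^ Suc N) * (if m = 0 then - b N 0 else b N (m-1))"
    proof (cases m)
      case 0 then show ?thesis by (simp add: b_def)
    next
      case (Suc l)
      have "r ^ (m * (m+1)) * q ^ (N+1-m) = r ^ (l * (l+1)) * q ^ Suc N"
        unfolding q_def power_mult[symmetric] power_add[symmetric]
        by (rule arg_cong[where f="\<lambda>i. r ^ i"]) (use m Suc in \<open>simp add: algebra_simps\<close>)
      then have "(-1) ^ m * (r ^ (m * (m+1)) * q ^ (N+1-m)) * q_central q N l
          = (-1) ^ m * (r ^ (l * (l+1)) * q ^ Suc N) * q_central q N l" by (simp only:)
      then show ?thesis using Suc unfolding b_def by (simp only: mult_ac diff_Suc_1 nat.simps if_False) simp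
    qed
    have "b (Suc N) m = (-1) ^ m * r ^ (m * (m+1)) * ((1 + e) * q_central q N m
           + q ^ (N+1-m) * (if m = 0 then q_central q N 0 else q_central q N (m-1))
           + q ^ (N+m+2) * q_central q N (m+1))"
      unfolding b_def e_def using q_central_rec[OF q, of m N] m by simp
    also have "\<dots> = (1 + e) * b N m + (-1) ^ m * r ^ (m * (m+1)) * (q ^ (N+1-m) *
        (if m = 0 then q_central q N 0 else q_central q N (m-1)))
        + (-1) ^ m * r ^ (m * (m+1)) * (q ^ (N+m+2) * q_central q N (m+1))"
      unfolding b_def by (simp only: ring_distribs mult_ac)
    also have "\<dots> = (1 + e) * b N m - q ^ Suc N * ((if m = 0 then - b N 0 else b N (m-1)) + b N (m+1))"
      unfolding 1 2 by (simp only: ring_distribs mult_ac) (simp add: algebra_simps)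
    finally show ?thesis .
  qed
  \<comment> \<open>The sine of index -1 is \<open>sin (- z) = - S 0\<close>, whence the value at
    \<open>m = 0\<close>.\<close>
  have cosS: "2 * cos (2*z) * S m = S (Suc m) + (if m = 0 then - S 0 else S (m-1))" for m
  proof -
    have "S (Suc m) = sin (of_nat (2*m+1) * z + 2 * z)" by (simp add: S_def algebra_simps)
    moreover have "(if m = 0 then - S 0 else S (m-1)) = sin (of_nat (2*m+1) * z - 2 * z)"
    proof (cases m)
      case 0 then show ?thesis using sin_minus[of z] by (simp add: S_def)
    qed (simp add: S_def algebra_simps)
    ultimately show ?thesis unfolding S_def sin_add sin_diff by (simp add: algebra_simps)
  qed
  \<comment> \<open>Summation by parts: moving the shifts from the sines to the coefficients leaves
    the boundary terms \<open>b N 0 * S 0\<close> and \<open>- b N 0 * S 0\<close>, which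
    cancel.\<close>
  have up: "(\<Sum>m\<le>N. b N m * S (Suc m)) = (\<Sum>m\<le>Suc N. (if m = 0 then - b N 0 else b N (m-1)) * S m) + b N 0 * S 0"
    by (subst sum.atMost_Suc_shift) simp
  have down: "(\<Sum>m\<le>N. b N m * (if m = 0 then - S 0 else S (m-1))) = (\<Sum>m\<le>Suc N. b N (m+1) * S m) - b N 0 * S 0"
  proof -
    have "(\<Sum>m\<le>N. b N m * (if m = 0 then - S 0 else S (m-1)))
        = (\<Sum>m\<le>Suc (Suc N). b N m * (if m = 0 then - S 0 else S (m-1)))"
      using b0 by simp
    also have "\<dots> = (\<Sum>m\<le>Suc N. b N (m+1) * S m) - b N 0 * S 0"
      by (subst sum.atMost_Suc_shift) simp
    finally show ?thesis .
  qed
  have "(\<Sum>m\<le>Suc N. b (Suc N) m * S m)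
      = (\<Sum>m\<le>Suc N. ((1 + e) * b N m - q ^ Suc N * ((if m = 0 then - b N 0 else b N (m-1)) + b N (m+1))) * S m)"
    by (intro sum.cong refl) (simp only: rec atMost_iff)
  also have "\<dots> = (1 + e) * (\<Sum>m\<le>Suc N. b N m * S m) - q ^ Suc N *
      ((\<Sum>m\<le>Suc N. (if m = 0 then - b N 0 else b N (m-1)) * S m) + (\<Sum>m\<le>Suc N. b N (m+1) * S m))"
    by (simp only: sum_distrib_left sum_subtractf[symmetric] sum.distrib[symmetric])
       (intro sum.cong refl, simp only: ring_distribs mult_ac)
  also have "(\<Sum>m\<le>Suc N. b N m * S m) = (\<Sum>m\<le>N. b N m * S m)" using b0 by simp
  also have "(\<Sum>m\<le>Suc N. (if m = 0 then - b N 0 else b N (m-1)) * S m) + (\<Sum>m\<le>Suc N. b N (m+1) * S m)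
     = (\<Sum>m\<le>N. b N m * S (Suc m)) + (\<Sum>m\<le>N. b N m * (if m = 0 then - S 0 else S (m-1)))"
    unfolding up down by simp
  also have "\<dots> = 2 * cos (2*z) * (\<Sum>m\<le>N. b N m * S m)"
    unfolding sum.distrib[symmetric] distrib_left[symmetric] cosS[symmetric] sum_distrib_left
    by (simp add: mult_ac)
  also have "(\<Sum>m\<le>N. b N m * S m) = sin z * (\<Prod>k<N. 1 - 2 * cos (2 * z) * q ^ Suc k + (q ^ Suc k)\<^sup>2)"
    using Suc.IH unfolding b_def S_def q_def by simp
  finally have "(\<Sum>m\<le>Suc N. b (Suc N) m * S m) = (1 + e - q ^ Suc N * (2 * cos (2*z))) *
      (sin z * (\<Prod>k<N. 1 - 2 * cos (2 * z) * q ^ Suc k + (q ^ Suc k)\<^sup>2))"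
    by (simp only: ring_distribs mult_ac)
  moreover have "e = (q ^ Suc N)\<^sup>2" by (simp add: e_def power_mult[symmetric] power_add[symmetric] mult_2 mult_2_right power2_eq_square)
  ultimately show ?case unfolding b_def S_def q_def[symmetric] prod.lessThan_Suc
    by (simp only: ring_distribs mult_ac) (simp add: algebra_simps)
qed

section \<open>Passage to the limit in the finite product\<close>

lemma summable_theta_majorant:
  fixes a b :: real
  assumes a: "a > 0"
  shows "summable (\<lambda>m. exp (- a * (real m + 1/2)\<^sup>2 + b * (2 * real m + 1)))"
proof (rule summable_comparison_test')
  \<comment> \<open>Completing the square: with \<open>t = m + 1/2\<close> one has
    \<open>- a t\<^sup>2 + (2 b + 1) t \<le> C\<close>. The added 1 leaves a spare
    \<open>- t\<close> in the exponent, which gives a geometric majorant of ratio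
    \<open>exp (-1)\<close>.\<close>
  define C where "C = (2*b+1)\<^sup>2 / (4*a)"
  show "summable (\<lambda>m. exp C * exp (-1::real) ^ m)"
    by (intro summable_mult summable_geometric) simp
  fix m :: nat
  define t where "t = real m + 1/2"
  have "0 \<le> a * (t - (2*b+1)/(2*a))\<^sup>2" using a by simp
  also have "\<dots> = a * t\<^sup>2 - (2*b+1) * t + C"
    using a by (simp add: C_def power2_eq_square field_simps)
  finally have "- a * t\<^sup>2 + b * (2*t) \<le> C - real m" by (simp add: algebra_simps t_def)
  then have "exp (- a * t\<^sup>2 + b * (2*t)) \<le> exp (C - real m)" by simp
  also have "\<dots> = exp C * exp (-1) ^ m" by (simp add: exp_diff exp_of_nat_mult[symmetric] exp_minus inverse_eq_divide power_one_over)
  finally show "norm (exp (- a * (real m + 1/2)\<^sup>2 + b * (2 * real m + 1))) \<le> exp C * exp (-1) ^ m"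
    by (simp add: t_def algebra_simps)
qed

definition theta_term :: "complex \<Rightarrow> complex \<Rightarrow> nat \<Rightarrow> complex" where
  "theta_term z \<tau> m = (-1) ^ m * exp (of_real pi * \<i> * \<tau> * (of_nat m + 1/2)\<^sup>2)
                        * sin (of_nat (2 * m + 1) * of_real pi * z)"

lemma theta1_eq: "theta1 z \<tau> = 2 * (\<Sum>m. theta_term z \<tau> m)"
  by (simp add: theta1_def theta_term_def)

lemma norm_theta_term_le:
  assumes "Im \<tau> \<ge> d" "\<bar>Im z\<bar> \<le> b"
  shows "norm (theta_term z \<tau> m) \<le> exp (- (pi * d) * (real m + 1/2)\<^sup>2 + pi * b * (2 * real m + 1))"
proof -
  have "Re (of_real pi * \<i> * \<tau> * (of_nat m + 1/2)\<^sup>2) = - (pi * Im \<tau>) * (real m + 1/2)\<^sup>2"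
  proof -
    have "of_real pi * \<i> * \<tau> * (of_nat m + 1/2)\<^sup>2 = of_real (pi * (real m + 1/2)\<^sup>2) * (\<i> * \<tau>)"
      by simp
    also have "Re \<dots> = pi * (real m + 1/2)\<^sup>2 * Re (\<i> * \<tau>)"
      by (simp only: Re_complex_of_real Im_complex_of_real times_complex.sel; simp)
    also have "\<dots> = - (pi * Im \<tau>) * (real m + 1/2)\<^sup>2" by simp
    finally show ?thesis .
  qed
  also have "\<dots> \<le> - (pi * d) * (real m + 1/2)\<^sup>2"
    by (rule mult_right_mono) (use assms(1) in simp_all)
  finally have 1: "norm (exp (of_real pi * \<i> * \<tau> * (of_nat m + 1/2)\<^sup>2)) \<le> exp (- (pi * d) * (real m + 1/2)\<^sup>2)"
    unfolding norm_exp_eq_Re exp_le_cancel_iff .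
  have "Im (of_nat (2 * m + 1) * of_real pi * z) = pi * Im z * (2 * real m + 1)"
  proof -
    have "of_nat (2 * m + 1) * of_real pi * z = of_real (pi * (2 * real m + 1)) * z" by simp
    also have "Im \<dots> = pi * (2 * real m + 1) * Im z"
      by (simp only: Re_complex_of_real Im_complex_of_real times_complex.sel; simp)
    finally show ?thesis by (simp only: mult_ac)
  qed
  then have "\<bar>Im (of_nat (2 * m + 1) * of_real pi * z)\<bar> = pi * \<bar>Im z\<bar> * (2 * real m + 1)"
    by (simp add: abs_mult)
  also have "\<dots> \<le> pi * b * (2 * real m + 1)"
    by (rule mult_right_mono, rule mult_left_mono) (use assms(2) in simp_all)
  finally have "exp \<bar>Im (of_nat (2 * m + 1) * of_real pi * z)\<bar> \<le> exp (pi * b * (2 * real m + 1))"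
    unfolding exp_le_cancel_iff .
  then have 2: "norm (sin (of_nat (2 * m + 1) * of_real pi * z)) \<le> exp (pi * b * (2 * real m + 1))"
    by (rule order_trans[OF cmod_sin_le_exp[of 1, simplified]])
  show ?thesis
    unfolding theta_term_def norm_mult exp_add norm_power norm_minus_cancel norm_one power_one mult_1_left
    by (intro mult_mono 1 2 norm_ge_zero less_imp_le[OF exp_gt_zero])
qed

lemma summable_norm_theta_term:
  assumes "Im \<tau> > 0"
  shows "summable (\<lambda>m. norm (theta_term z \<tau> m))"
proof (rule summable_comparison_test')
  show "summable (\<lambda>m. exp (- (pi * Im \<tau>) * (real m + 1/2)\<^sup>2 + pi * \<bar>Im z\<bar> * (2 * real m + 1)))"
    using assms by (intro summable_theta_majorant) simp
  show "norm (norm (theta_term z \<tau> m))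
      \<le> exp (- (pi * Im \<tau>) * (real m + 1/2)\<^sup>2 + pi * \<bar>Im z\<bar> * (2 * real m + 1))" for m
    using norm_theta_term_le[OF order_refl order_refl, of z \<tau> m] by simp
qed

lemma convergent_prod_one_minus_power:
  fixes q :: complex
  assumes "norm q < 1"
  shows "convergent_prod (\<lambda>k. 1 - q ^ Suc k)"
proof -
  have "summable (\<lambda>k. norm q * norm q ^ k)" using assms by (intro summable_mult summable_geometric) simp
  then have "abs_convergent_prod (\<lambda>k. 1 - q ^ Suc k)"
    by (intro summable_imp_abs_convergent_prod) (simp add: norm_power norm_mult)
  then show ?thesis by (rule abs_convergent_prod_imp_convergent_prod)
qed

lemma q_fact_LIMSEQ:
  assumes "norm q < 1"
  shows "q_fact q \<longlonglongrightarrow> (\<Prod>k. 1 - q ^ Suc k)" "(\<Prod>k. 1 - q ^ Suc k) \<noteq> 0"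
proof -
  show "q_fact q \<longlonglongrightarrow> (\<Prod>k. 1 - q ^ Suc k)"
    using convergent_prod_LIMSEQ[OF convergent_prod_one_minus_power[OF assms]]
    unfolding q_fact_def LIMSEQ_lessThan_iff_atMost .
  show "(\<Prod>k. 1 - q ^ Suc k) \<noteq> 0"
    by (intro prodinf_nonzero convergent_prod_one_minus_power one_minus_power_nonzero assms)
qed

text \<open>\<open>q_fact q\<close> converges to a nonzero limit, so it and its inverse are bounded
  sequences. A bound uniform in both indices is what the domination hypothesis of Tannery's theorem
  asks for.\<close>

lemma q_central_bounded:
  assumes q: "norm q < 1"
  obtains K where "\<And>N m. norm (q_central q N m) \<le> K"
proof -
  have "Bseq (q_fact q)" using q_fact_LIMSEQ(1)[OF q] convergent_imp_Bseq convergentI by blast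
  then obtain K1 where K1: "K1 > 0" "\<And>n. norm (q_fact q n) \<le> K1" by (auto elim: BseqE)
  have "Bseq (\<lambda>n. inverse (q_fact q n))"
    using tendsto_inverse[OF q_fact_LIMSEQ[OF q]] convergent_imp_Bseq convergentI by blast
  then obtain K2 where K2: "K2 > 0" "\<And>n. norm (inverse (q_fact q n)) \<le> K2" by (auto elim: BseqE)
  have "norm (q_central q N m) \<le> K1 * (K2 * K2)" for N m
  proof (cases "m \<le> N")
    case True
    have "q_central q N m = q_fact q (2*N+1) * (inverse (q_fact q (N-m)) * inverse (q_fact q (N+m+1)))"
      using True by (simp add: q_central_def field_simps)
    also have "norm \<dots> \<le> K1 * (K2 * K2)"
      unfolding norm_mult using K1 K2 by (intro mult_mono) auto
    finally show ?thesis .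
  qed (use K1 K2 in \<open>simp add: q_central_def\<close>)
  then show ?thesis by (rule that)
qed

lemma q_central_LIMSEQ:
  assumes q: "norm q < 1"
  shows "(\<lambda>N. q_central q N m) \<longlonglongrightarrow> 1 / (\<Prod>k. 1 - q ^ Suc k)"
proof -
  define Q where "Q = (\<Prod>k. 1 - q ^ Suc k)"
  have Q: "q_fact q \<longlonglongrightarrow> Q" "Q \<noteq> 0" using q_fact_LIMSEQ[OF q] by (simp_all add: Q_def)
  have "(\<lambda>N. q_fact q (2*N+1) / (q_fact q (N-m) * q_fact q (N+m+1))) \<longlonglongrightarrow> Q / (Q * Q)"
  proof (intro tendsto_divide tendsto_mult)
    have "filterlim (\<lambda>N::nat. 2*N+1) at_top sequentially" "filterlim (\<lambda>N. N+m+1) at_top sequentially"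
      by (rule filterlim_at_top_mono[OF filterlim_ident], simp)+
    then show "(\<lambda>N. q_fact q (2*N+1)) \<longlonglongrightarrow> Q" "(\<lambda>N. q_fact q (N+m+1)) \<longlonglongrightarrow> Q"
      by (auto intro: filterlim_compose[OF Q(1)])
    show "(\<lambda>N. q_fact q (N-m)) \<longlonglongrightarrow> Q"
      by (intro filterlim_compose[OF Q(1)] filterlim_minus_const_nat_at_top)
  qed (use Q(2) in auto)
  moreover have "\<forall>\<^sub>F N in sequentially. q_fact q (2*N+1) / (q_fact q (N-m) * q_fact q (N+m+1)) = q_central q N m"
    using eventually_ge_at_top[of m] by eventually_elim (simp add: q_central_def)
  ultimately have "(\<lambda>N. q_central q N m) \<longlonglongrightarrow> Q / (Q * Q)" by (rule Lim_transform_eventually)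
  then show ?thesis using Q(2) by (simp add: Q_def)
qed

text \<open>Limit of \<open>sin_q_product\<close> at \<open>\<pi> z\<close>: each
  \<open>q_central\<close> tends to \<open>1 / Q\<close>, and Tannery's theorem permits the limit
  under the sum. The exponential prefactor comes from
  \<open>(m + 1/2)\<^sup>2 = m (m + 1) + 1/4\<close>. Convergence is recorded separately, since
  zeros and limits of partial products are read from it later.\<close>

theorem theta1_product:
  assumes \<tau>: "Im \<tau> > 0"
  defines "q \<equiv> exp (2 * of_real pi * \<i> * \<tau>)"
  shows "theta1 z \<tau> = 2 * exp (of_real pi * \<i> * \<tau> / 4) * (\<Prod>k. 1 - q ^ Suc k) * sin (of_real pi * z)
      * (\<Prod>k. 1 - 2 * cos (2 * (of_real pi * z)) * q ^ Suc k + (q ^ Suc k)\<^sup>2)"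
    and "convergent_prod (\<lambda>k. 1 - 2 * cos (2 * (of_real pi * z)) * q ^ Suc k + (q ^ Suc k)\<^sup>2)"
proof -
  define r where "r = exp (of_real pi * \<i> * \<tau>)"
  have r: "norm r < 1" using \<tau> by (simp add: r_def)
  have qr: "q = r\<^sup>2" by (simp add: q_def r_def exp_double[symmetric] mult_ac)
  have q: "norm q < 1" using r by (simp add: qr norm_power power_less_one_iff)
  define c where "c = 2 * cos (2 * (of_real pi * z))"
  show conv: "convergent_prod (\<lambda>k. 1 - 2 * cos (2 * (of_real pi * z)) * q ^ Suc k + (q ^ Suc k)\<^sup>2)"
  proof -
    have "summable (\<lambda>k. (norm c + 1) * (norm q * norm q ^ k))"
      using q by (intro summable_mult summable_geometric) simp
    then have "summable (\<lambda>k. norm ((1 - c * q ^ Suc k + (q ^ Suc k)\<^sup>2) - 1))"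
    proof (rule summable_comparison_test')
      fix k :: nat
      have "norm ((1 - c * q ^ Suc k + (q ^ Suc k)\<^sup>2) - 1) \<le> norm (c * q ^ Suc k) + norm ((q ^ Suc k)\<^sup>2)"
        using norm_triangle_ineq[of "- (c * q ^ Suc k)" "(q ^ Suc k)\<^sup>2"] by simp
      also have "norm ((q ^ Suc k)\<^sup>2) \<le> norm (q ^ Suc k)"
        unfolding norm_power power_mult[symmetric] by (rule power_decreasing) (use q in auto)
      finally show "norm (norm ((1 - c * q ^ Suc k + (q ^ Suc k)\<^sup>2) - 1)) \<le> (norm c + 1) * (norm q * norm q ^ k)"
        by (simp add: norm_mult norm_power algebra_simps)
    qed
    then show ?thesis unfolding c_def
      by (intro abs_convergent_prod_imp_convergent_prod summable_imp_abs_convergent_prod)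
  qed
  define P where "P = (\<Prod>k. 1 - 2 * cos (2 * (of_real pi * z)) * q ^ Suc k + (q ^ Suc k)\<^sup>2)"
  define Q where "Q = (\<Prod>k. 1 - q ^ Suc k)"
  define E where "E = exp (of_real pi * \<i> * \<tau> / 4)"
  have Q0: "Q \<noteq> 0" using q_fact_LIMSEQ[OF q] by (simp add: Q_def)
  define t where "t = (\<lambda>m. (-1) ^ m * r ^ (m * (m+1)) * sin (of_nat (2*m+1) * (of_real pi * z)))"
  have Et: "theta_term z \<tau> m = E * t m" for m
  proof -
    have "exp (of_real pi * \<i> * \<tau> * (of_nat m + 1/2)\<^sup>2) = E * r ^ (m * (m+1))"
      unfolding E_def r_def exp_of_nat_mult[symmetric] exp_add[symmetric]
      by (rule arg_cong[where f=exp]) (simp add: power2_eq_square algebra_simps)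
    then show ?thesis by (simp add: theta_term_def t_def mult_ac)
  qed
  obtain K where K: "\<And>N m. norm (q_central q N m) \<le> K" using q_central_bounded[OF q] by metis
  have sum_t: "summable (\<lambda>m. norm (t m))"
    using summable_norm_theta_term[OF \<tau>, of z] by (simp add: Et norm_mult E_def)
  \<comment> \<open>The finite sum is padded by zeros to an infinite one, so that its range no
    longer depends on \<open>N\<close>.\<close>
  define a where "a = (\<lambda>m N. if m \<le> N then t m * q_central q N m else 0)"
  have "((\<lambda>N. \<Sum>m. a m N) \<longlongrightarrow> (\<Sum>m. t m * (1 / Q))) sequentially"
  proof (rule tannerys_theorem[THEN conjunct2, THEN conjunct2])
    show "((\<lambda>N. a m N) \<longlongrightarrow> t m * (1 / Q)) sequentially" for m
    proof (rule Lim_transform_eventually)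
      show "(\<lambda>N. t m * q_central q N m) \<longlonglongrightarrow> t m * (1 / Q)"
        using q_central_LIMSEQ[OF q] by (intro tendsto_intros) (simp add: Q_def)
      show "\<forall>\<^sub>F N in sequentially. t m * q_central q N m = a m N"
        using eventually_ge_at_top[of m] by eventually_elim (simp add: a_def)
    qed
    have "norm (a m N) \<le> norm (t m) * K" for m N
      using mult_left_mono[OF K, of "norm (t m)" N m] norm_ge_zero[of "t m"]
        order_trans[OF norm_ge_zero K]
      by (auto simp: a_def norm_mult)
    then show "\<forall>\<^sub>F (k, n) in sequentially \<times>\<^sub>F sequentially. norm (a k n) \<le> norm (t k) * K"
      by (auto intro: always_eventually)
    show "summable (\<lambda>m. norm (t m) * K)" using sum_t by (rule summable_mult2)
  qed simp
  moreover have "(\<Sum>m. a m N) = sin (of_real pi * z) *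
      (\<Prod>k<N. 1 - 2 * cos (2 * (of_real pi * z)) * q ^ Suc k + (q ^ Suc k)\<^sup>2)" for N
  proof -
    have "(\<Sum>m. a m N) = (\<Sum>m\<le>N. a m N)" by (rule suminf_finite) (auto simp: a_def)
    also have "\<dots> = (\<Sum>m\<le>N. (-1) ^ m * r ^ (m * (m+1)) * q_central (r\<^sup>2) N m * sin (of_nat (2*m+1) * (of_real pi * z)))"
      by (intro sum.cong refl) (simp add: a_def t_def qr mult_ac)
    also have "\<dots> = sin (of_real pi * z) *
      (\<Prod>k<N. 1 - 2 * cos (2 * (of_real pi * z)) * q ^ Suc k + (q ^ Suc k)\<^sup>2)"
      unfolding sin_q_product[OF r, symmetric] qr ..
    finally show ?thesis .
  qed
  moreover have "(\<lambda>N. sin (of_real pi * z) *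
      (\<Prod>k<N. 1 - 2 * cos (2 * (of_real pi * z)) * q ^ Suc k + (q ^ Suc k)\<^sup>2)) \<longlonglongrightarrow> sin (of_real pi * z) * P"
    using convergent_prod_LIMSEQ[OF conv] unfolding P_def LIMSEQ_lessThan_iff_atMost[symmetric]
    by (intro tendsto_intros)
  ultimately have "(\<Sum>m. t m * (1 / Q)) = sin (of_real pi * z) * P"
    by (simp add: LIMSEQ_unique)
  then have "(\<Sum>m. t m) = Q * sin (of_real pi * z) * P"
    using suminf_mult2[OF summable_norm_cancel[OF sum_t], of "1 / Q"] Q0 by (simp add: field_simps)
  moreover have "(\<Sum>m. theta_term z \<tau> m) = E * (\<Sum>m. t m)"
    using suminf_mult[OF summable_norm_cancel[OF sum_t], of E] by (simp add: Et)
  ultimately show "theta1 z \<tau> = 2 * exp (of_real pi * \<i> * \<tau> / 4) * (\<Prod>k. 1 - q ^ Suc k) * sin (of_real pi * z)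
      * (\<Prod>k. 1 - 2 * cos (2 * (of_real pi * z)) * q ^ Suc k + (q ^ Suc k)\<^sup>2)"
    unfolding theta1_eq P_def Q_def E_def by simp
qed

section \<open>Derivatives and periods of \<open>\<theta>\<^sub>1\<close>\<close>

lemma higher_deriv_shift: "(deriv ^^ m) (\<lambda>s. f (s + z)) 0 = (deriv ^^ m) f (z::complex)"
  using higher_deriv_shift_0[of m f z] by (simp add: o_def add.commute)

lemma open_Times_nhdE:
  fixes W :: "(complex \<times> complex) set"
  assumes "open W" "(z, \<tau>) \<in> W"
  obtains r where "r > 0" "cball z r \<times> cball \<tau> r \<subseteq> W"
proof -
  obtain A B where AB: "open A" "open B" "z \<in> A" "\<tau> \<in> B" "A \<times> B \<subseteq> W"
    using assms by (rule open_prod_elim) auto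
  obtain r1 where r1: "r1 > 0" "cball z r1 \<subseteq> A" using AB by (meson open_contains_cball)
  obtain r2 where r2: "r2 > 0" "cball \<tau> r2 \<subseteq> B" using AB by (meson open_contains_cball)
  have "cball z (min r1 r2) \<times> cball \<tau> (min r1 r2) \<subseteq> W" using AB r1 r2 by force
  then show ?thesis using that[of "min r1 r2"] r1 r2 by auto
qed

lemma holomorphic_on_slice:
  assumes "\<And>z. z \<in> S \<Longrightarrow> (\<lambda>z. f z \<tau>) field_differentiable (at z)"
  shows "(\<lambda>z. f z \<tau>) holomorphic_on S"
  using assms by (auto simp: holomorphic_on_def intro: field_differentiable_at_within)

text \<open>The difference quotients in the parameter converge locally uniformly in \<open>z\<close>.\<close>

lemma has_field_derivative_higher_deriv_param:
  fixes f g :: "complex \<Rightarrow> complex \<Rightarrow> complex"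
  assumes W: "open W" "(z, \<tau>) \<in> W"
    and hol: "\<And>z \<tau>. (z, \<tau>) \<in> W \<Longrightarrow> (\<lambda>z. f z \<tau>) field_differentiable (at z)"
    and der: "\<And>z \<tau>. (z, \<tau>) \<in> W \<Longrightarrow> ((\<lambda>\<tau>. f z \<tau>) has_field_derivative g z \<tau>) (at \<tau>)"
    and cont: "continuous_on W (\<lambda>(z, \<tau>). g z \<tau>)"
  shows "((\<lambda>\<tau>. (deriv ^^ m) (\<lambda>z. f z \<tau>) z) has_field_derivative (deriv ^^ m) (\<lambda>z. g z \<tau>) z) (at \<tau>)"
proof -
  obtain r where r: "r > 0" "cball z r \<times> cball \<tau> r \<subseteq> W" by (rule open_Times_nhdE[OF W])
  have inW: "(x, s) \<in> W" if "x \<in> cball z r" "s \<in> cball \<tau> r" for x s using r that by blast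
  have holb: "(\<lambda>z. f z s) holomorphic_on ball z r" if "s \<in> cball \<tau> r" for s
    by (rule holomorphic_on_slice) (use inW that hol in auto)
  have lim: "uniform_limit (ball z r) (\<lambda>h x. inverse h * (f x (\<tau> + h) - f x \<tau>)) (\<lambda>x. g x \<tau>) (at 0)"
  proof (rule uniform_limitI)
    fix \<epsilon> :: real assume \<epsilon>: "\<epsilon> > 0"
    have "uniformly_continuous_on (cball z r \<times> cball \<tau> r) (\<lambda>(z, \<tau>). g z \<tau>)"
      by (intro compact_uniformly_continuous continuous_on_subset[OF cont] r compact_Times compact_cball)
    then obtain d where d: "d > 0" "\<And>p p'. p \<in> cball z r \<times> cball \<tau> r \<Longrightarrow> p' \<in> cball z r \<times> cball \<tau> r
        \<Longrightarrow> dist p' p < d \<Longrightarrow> dist (case p' of (z, \<tau>) \<Rightarrow> g z \<tau>) (case p of (z, \<tau>) \<Rightarrow> g z \<tau>) < \<epsilon>/2"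
      using \<epsilon> by (elim uniformly_continuous_onE[of _ _ "\<epsilon>/2"]) auto
    have gd: "norm (g x s - g x \<tau>) \<le> \<epsilon>/2" if "x \<in> cball z r" "s \<in> ball \<tau> (min r d)" for x s
      using d(2)[of "(x, \<tau>)" "(x, s)"] that r(1) by (auto simp: dist_norm dist_Pair_Pair norm_minus_commute)
    have "\<forall>\<^sub>F h in at (0::complex). h \<in> ball 0 (min r d) - {0}"
      using r(1) d(1) by (intro eventually_at_in_open) auto
    then show "\<forall>\<^sub>F h in at 0. \<forall>x\<in>ball z r. dist (inverse h * (f x (\<tau> + h) - f x \<tau>)) (g x \<tau>) < \<epsilon>"
    proof eventually_elim
      case (elim h)
      then have h: "h \<noteq> 0" "norm h < min r d" by auto
      show ?case
      proof
        fix x assume x: "x \<in> ball z r"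
        \<comment> \<open>Subtracting the linear function \<open>g x \<tau> * s\<close> leaves a
          function with small derivative on the ball, so the mean value bound controls the
          difference quotient uniformly in \<open>x\<close>.\<close>
        let ?F = "\<lambda>s. f x s - g x \<tau> * s"
        have "norm (?F (\<tau> + h) - ?F \<tau>) \<le> \<epsilon>/2 * norm (\<tau> + h - \<tau>)"
        proof (rule field_differentiable_bound[where S = "ball \<tau> (min r d)" and f' = "\<lambda>s. g x s - g x \<tau>"])
          fix s assume s: "s \<in> ball \<tau> (min r d)"
          have "(x, s) \<in> W" using s x by (intro inW) auto
          then show "(?F has_field_derivative g x s - g x \<tau>) (at s within ball \<tau> (min r d))"
            by (auto intro!: derivative_eq_intros DERIV_subset[OF der])
          show "norm (g x s - g x \<tau>) \<le> \<epsilon>/2" using s x by (intro gd) auto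
        qed (use h r d in \<open>auto simp: dist_norm\<close>)
        moreover have "?F (\<tau> + h) - ?F \<tau> = h * (inverse h * (f x (\<tau> + h) - f x \<tau>) - g x \<tau>)"
          using h by (simp add: field_simps)
        ultimately have "norm h * norm (inverse h * (f x (\<tau> + h) - f x \<tau>) - g x \<tau>) \<le> norm h * (\<epsilon>/2)"
          by (simp add: norm_mult mult.commute)
        then have "norm (inverse h * (f x (\<tau> + h) - f x \<tau>) - g x \<tau>) \<le> \<epsilon>/2"
          by (rule mult_left_le_imp_le) (use h in auto)
        then show "dist (inverse h * (f x (\<tau> + h) - f x \<tau>)) (g x \<tau>) < \<epsilon>"
          using \<epsilon> by (simp add: dist_norm)
      qed
    qed
  qed
  have ev: "\<forall>\<^sub>F h in at (0::complex). \<tau> + h \<in> cball \<tau> r"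
    using eventually_at_in_open'[of "ball 0 r" "0::complex"] r(1)
    by (auto elim!: eventually_mono simp: dist_norm)
  have "((\<lambda>h. (deriv ^^ m) (\<lambda>x. inverse h * (f x (\<tau> + h) - f x \<tau>)) z) \<longlongrightarrow> (deriv ^^ m) (\<lambda>x. g x \<tau>) z) (at 0)"
  proof (rule higher_deriv_complex_uniform_limit[OF lim])
    show "\<forall>\<^sub>F h in at 0. (\<lambda>x. inverse h * (f x (\<tau> + h) - f x \<tau>)) holomorphic_on ball z r"
      using ev by eventually_elim (use r(1) in \<open>auto intro!: holomorphic_intros holb\<close>)
  qed (use r(1) in auto)
  moreover have "\<forall>\<^sub>F h in at 0. (deriv ^^ m) (\<lambda>x. inverse h * (f x (\<tau> + h) - f x \<tau>)) z
      = ((deriv ^^ m) (\<lambda>x. f x (\<tau> + h)) z - (deriv ^^ m) (\<lambda>x. f x \<tau>) z) / h"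
    using ev
  proof eventually_elim
    case (elim h)
    have "(\<lambda>x. f x (\<tau> + h)) holomorphic_on ball z r" "(\<lambda>x. f x \<tau>) holomorphic_on ball z r"
      using elim r(1) by (auto intro!: holb)
    then have "(deriv ^^ m) (\<lambda>x. inverse h * (f x (\<tau> + h) - f x \<tau>)) z
        = inverse h * ((deriv ^^ m) (\<lambda>x. f x (\<tau> + h)) z - (deriv ^^ m) (\<lambda>x. f x \<tau>) z)"
      using r(1) by (subst higher_deriv_cmult[where A = "ball z r"])
        (auto intro!: holomorphic_intros simp: higher_deriv_diff[where S = "ball z r"])
    then show ?case by (simp add: divide_inverse mult.commute)
  qed
  ultimately show ?thesis unfolding DERIV_def by (rule Lim_transform_eventually)
qed

text \<open>The point of evaluation moves together with the parameter, whereas the convergence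
  theorem for derivatives works at a fixed point. Translating it to 0 gives the family
  \<open>F p\<close>, uniformly convergent on one fixed ball; the radius \<open>r/2\<close> keeps
  the translated arguments inside \<open>ball z r\<close>.\<close>

lemma continuous_on_higher_deriv_param:
  fixes f :: "complex \<Rightarrow> complex \<Rightarrow> complex"
  assumes W: "open W"
    and hol: "\<And>z \<tau>. (z, \<tau>) \<in> W \<Longrightarrow> (\<lambda>z. f z \<tau>) field_differentiable (at z)"
    and cont: "continuous_on W (\<lambda>(z, \<tau>). f z \<tau>)"
  shows "continuous_on W (\<lambda>(z, \<tau>). (deriv ^^ m) (\<lambda>z. f z \<tau>) z)"
  unfolding continuous_on_eq_continuous_at[OF W]
proof (clarify)
  fix z \<tau> assume zt: "(z, \<tau>) \<in> W"
  obtain r where r: "r > 0" "cball z r \<times> cball \<tau> r \<subseteq> W" by (rule open_Times_nhdE[OF W zt])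
  have inW: "(x, s) \<in> W" if "x \<in> cball z r" "s \<in> cball \<tau> r" for x s using r that by blast
  define F where "F = (\<lambda>p s. f (s + fst p) (snd p))"
  have lim: "uniform_limit (ball 0 (r/2)) F (F (z, \<tau>)) (nhds (z, \<tau>))"
  proof (rule uniform_limitI)
    fix \<epsilon> :: real assume \<epsilon>: "\<epsilon> > 0"
    have "uniformly_continuous_on (cball z r \<times> cball \<tau> r) (\<lambda>(z, \<tau>). f z \<tau>)"
      by (intro compact_uniformly_continuous continuous_on_subset[OF cont] r compact_Times compact_cball)
    then obtain d where d: "d > 0" "\<And>p p'. p \<in> cball z r \<times> cball \<tau> r \<Longrightarrow> p' \<in> cball z r \<times> cball \<tau> r
        \<Longrightarrow> dist p' p < d \<Longrightarrow> dist (case p' of (z, \<tau>) \<Rightarrow> f z \<tau>) (case p of (z, \<tau>) \<Rightarrow> f z \<tau>) < \<epsilon>"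
      using \<epsilon> by (elim uniformly_continuous_onE[of _ _ "\<epsilon>"]) auto
    have "\<forall>\<^sub>F p in nhds (z, \<tau>). p \<in> ball (z, \<tau>) (min (r/2) d)"
      using r(1) d(1) by (intro eventually_nhds_in_open) auto
    then show "\<forall>\<^sub>F p in nhds (z, \<tau>). \<forall>s\<in>ball 0 (r/2). dist (F p s) (F (z, \<tau>) s) < \<epsilon>"
    proof eventually_elim
      case (elim p)
      obtain z' \<tau>' where p: "p = (z', \<tau>')" by force
      have dz: "dist z z' \<le> dist (z, \<tau>) p" "dist \<tau> \<tau>' \<le> dist (z, \<tau>) p"
        unfolding p dist_Pair_Pair by (simp_all add: real_sqrt_sum_squares_ge1 real_sqrt_sum_squares_ge2)
      show ?case
      proof
        fix s :: complex assume s: "s \<in> ball 0 (r/2)"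
        have "dist z (s + z') \<le> norm s + dist z z'"
          by (metis add.commute dist_norm norm_minus_commute norm_triangle_ineq diff_add_eq)
        then have "dist z (s + z') \<le> r" "dist z (s + z) \<le> r" "dist \<tau> \<tau>' \<le> r"
          using dz s elim r by (auto simp: dist_norm)
        moreover have "dist (s + z', \<tau>') (s + z, \<tau>) = dist p (z, \<tau>)"
          by (simp add: p dist_Pair_Pair)
        ultimately show "dist (F p s) (F (z, \<tau>) s) < \<epsilon>"
          using d(2)[of "(s + z, \<tau>)" "(s + z', \<tau>')"] elim r(1) by (simp add: F_def p dist_commute)
      qed
    qed
  qed
  have "((\<lambda>p. (deriv ^^ m) (F p) 0) \<longlongrightarrow> (deriv ^^ m) (F (z, \<tau>)) 0) (nhds (z, \<tau>))"
  proof (rule higher_deriv_complex_uniform_limit[OF lim])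
    have "\<forall>\<^sub>F p in nhds (z, \<tau>). p \<in> ball z (r/2) \<times> ball \<tau> r"
      using r(1) by (intro eventually_nhds_in_open open_Times) auto
    then show "\<forall>\<^sub>F p in nhds (z, \<tau>). F p holomorphic_on ball 0 (r/2)"
    proof eventually_elim
      case (elim p)
      obtain z' \<tau>' where p: "p = (z', \<tau>')" by force
      have "(\<lambda>z. f z \<tau>') holomorphic_on ball z r"
        by (rule holomorphic_on_slice) (use elim p in \<open>auto intro!: hol inW\<close>)
      moreover have "s + z' \<in> ball z r" if "s \<in> ball 0 (r/2)" for s
      proof -
        have "dist z (s + z') \<le> norm s + dist z z'"
          by (metis add.commute dist_norm norm_minus_commute norm_triangle_ineq diff_add_eq)
        then show ?thesis using that elim p by auto
      qed
      ultimately have "((\<lambda>z. f z \<tau>') \<circ> (\<lambda>s. s + z')) holomorphic_on ball 0 (r/2)"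
        by (intro holomorphic_on_compose_gen[of _ _ _ "ball z r"] holomorphic_intros) auto
      then show ?case by (simp add: F_def p o_def)
    qed
  qed (use r(1) in auto)
  moreover have "(deriv ^^ m) (F p) 0 = (case p of (z, \<tau>) \<Rightarrow> (deriv ^^ m) (\<lambda>z. f z \<tau>) z)" for p
    unfolding F_def case_prod_unfold by (rule higher_deriv_shift)
  ultimately have "((\<lambda>(z, \<tau>). (deriv ^^ m) (\<lambda>z. f z \<tau>) z) \<longlongrightarrow>
      (case (z, \<tau>) of (z, \<tau>) \<Rightarrow> (deriv ^^ m) (\<lambda>z. f z \<tau>) z)) (nhds (z, \<tau>))"
    by (simp only:)
  then show "isCont (\<lambda>(z, \<tau>). (deriv ^^ m) (\<lambda>z. f z \<tau>) z) (z, \<tau>)"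
    unfolding isCont_def by (rule tendsto_mono[OF at_within_le_nhds])
qed

section \<open>Holomorphy of \<open>theta1\<close> and the heat equation\<close>

lemma uniform_limit_theta1:
  assumes "d > 0"
  shows "uniform_limit {p. \<bar>Im (fst p)\<bar> \<le> b \<and> d \<le> Im (snd p)}
           (\<lambda>N p. 2 * (\<Sum>m<N. theta_term (fst p) (snd p) m)) (\<lambda>p. theta1 (fst p) (snd p)) sequentially"
  unfolding theta1_eq
proof (rule bounded_linear.uniform_limit[OF bounded_linear_mult_right])
  show "uniform_limit {p. \<bar>Im (fst p)\<bar> \<le> b \<and> d \<le> Im (snd p)}
     (\<lambda>N p. \<Sum>m<N. theta_term (fst p) (snd p) m) (\<lambda>p. \<Sum>m. theta_term (fst p) (snd p) m) sequentially"
  proof (rule Weierstrass_m_test)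
    show "summable (\<lambda>m. exp (- (pi * d) * (real m + 1/2)\<^sup>2 + pi * b * (2 * real m + 1)))"
      by (rule summable_theta_majorant) (use assms in simp)
  qed (rule norm_theta_term_le, auto)
qed

text \<open>The last claim is the heat equation for a single term: two derivatives in
  \<open>z\<close> and one in \<open>\<tau>\<close> multiply the term by constants whose ratio is
  \<open>4 \<pi> \<i>\<close>.\<close>

lemma theta_term_has_derivatives:
  defines "a m \<equiv> of_nat (2 * m + 1) * complex_of_real pi"
  defines "e \<tau> m \<equiv> (-1) ^ m * exp (of_real pi * \<i> * \<tau> * (of_nat m + 1/2)\<^sup>2)"
  shows "((\<lambda>z. theta_term z \<tau> m) has_field_derivative a m * (e \<tau> m * cos (a m * z))) (at z)"
    and "((\<lambda>z. a m * (e \<tau> m * cos (a m * z))) has_field_derivative - (a m)\<^sup>2 * theta_term z \<tau> m) (at z)"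
    and "((\<lambda>\<tau>. theta_term z \<tau> m) has_field_derivative
           (of_real pi * \<i> * (of_nat m + 1/2)\<^sup>2) * theta_term z \<tau> m) (at \<tau>)"
    and "- (a m)\<^sup>2 = 4 * of_real pi * \<i> * (of_real pi * \<i> * (of_nat m + 1/2)\<^sup>2)"
proof -
  have th: "theta_term z \<tau> m = e \<tau> m * sin (a m * z)" for z \<tau>
    by (simp only: theta_term_def a_def e_def)
  show "((\<lambda>z. theta_term z \<tau> m) has_field_derivative a m * (e \<tau> m * cos (a m * z))) (at z)"
    unfolding th by (auto intro!: derivative_eq_intros)
  show "((\<lambda>z. a m * (e \<tau> m * cos (a m * z))) has_field_derivative - (a m)\<^sup>2 * theta_term z \<tau> m) (at z)"
    unfolding th by (auto intro!: derivative_eq_intros simp: power2_eq_square)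
  show "((\<lambda>\<tau>. theta_term z \<tau> m) has_field_derivative
           (of_real pi * \<i> * (of_nat m + 1/2)\<^sup>2) * theta_term z \<tau> m) (at \<tau>)"
    unfolding theta_term_def by (rule derivative_eq_intros refl)+ (simp only: mult_ac mult_zero_left mult_zero_right add_0_left add_0_right mult_1_left mult_1_right)
  have "a m = 2 * of_real pi * (of_nat m + 1/2)" by (simp add: a_def field_simps)
  then show "- (a m)\<^sup>2 = 4 * of_real pi * \<i> * (of_real pi * \<i> * (of_nat m + 1/2)\<^sup>2)"
    by (simp add: power2_eq_square algebra_simps)
qed

lemma continuous_on_theta1: "continuous_on {(z, \<tau>). Im \<tau> > 0} (\<lambda>(z, \<tau>). theta1 z \<tau>)"
proof -
  have op: "open {(z::complex, \<tau>). Im \<tau> > 0}"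
    unfolding case_prod_unfold by (intro open_Collect_less continuous_intros)
  show ?thesis
    unfolding continuous_on_eq_continuous_at[OF op]
  proof (clarify)
    fix z \<tau> :: complex assume t: "Im \<tau> > 0"
    define A where "A = {p::complex \<times> complex. \<bar>Im (fst p)\<bar> < \<bar>Im z\<bar> + 1 \<and> Im \<tau> / 2 < Im (snd p)}"
    have "open A" unfolding A_def
      by (intro open_Collect_conj open_Collect_less continuous_intros)
    moreover have "(z, \<tau>) \<in> A" using t by (simp add: A_def)
    moreover have "continuous_on A (\<lambda>p. theta1 (fst p) (snd p))"
    proof (rule uniform_limit_theorem)
      show "uniform_limit A (\<lambda>N p. 2 * (\<Sum>m<N. theta_term (fst p) (snd p) m)) (\<lambda>p. theta1 (fst p) (snd p)) sequentially"
        by (rule uniform_limit_on_subset[OF uniform_limit_theta1[of "Im \<tau> / 2" "\<bar>Im z\<bar> + 1"]])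
           (use t in \<open>auto simp: A_def\<close>)
      show "\<forall>\<^sub>F N in sequentially. continuous_on A (\<lambda>p. 2 * (\<Sum>m<N. theta_term (fst p) (snd p) m))"
        unfolding theta_term_def by (intro always_eventually allI continuous_intros)
    qed simp
    ultimately show "isCont (\<lambda>(z, \<tau>). theta1 z \<tau>) (z, \<tau>)"
      unfolding case_prod_unfold by (simp add: continuous_on_eq_continuous_at)
  qed
qed

lemma uniform_limit_theta1_z:
  assumes "Im \<tau> > 0"
  shows "uniform_limit (cball z 1) (\<lambda>N z. 2 * (\<Sum>m<N. theta_term z \<tau> m)) (\<lambda>z. theta1 z \<tau>) sequentially"
proof -
  have sub: "(\<lambda>z. (z, \<tau>)) \<in> cball z 1 \<rightarrow> {p. \<bar>Im (fst p)\<bar> \<le> \<bar>Im z\<bar> + 1 \<and> Im \<tau> \<le> Im (snd p)}"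
  proof (clarsimp)
    fix w assume "dist z w \<le> 1"
    then have "\<bar>Im (w - z)\<bar> \<le> 1" using abs_Im_le_cmod[of "w - z"] by (simp add: dist_norm norm_minus_commute)
    then show "\<bar>Im w\<bar> \<le> \<bar>Im z\<bar> + 1" by simp
  qed
  show ?thesis
    using uniform_limit_compose'[OF uniform_limit_theta1[OF assms] sub] by simp
qed

lemma uniform_limit_theta1_tau:
  assumes "d > 0" "A \<subseteq> {\<tau>. d \<le> Im \<tau>}"
  shows "uniform_limit A (\<lambda>N \<tau>. 2 * (\<Sum>m<N. theta_term z \<tau> m)) (\<lambda>\<tau>. theta1 z \<tau>) sequentially"
proof -
  have sub: "(\<lambda>\<tau>. (z, \<tau>)) \<in> A \<rightarrow> {p. \<bar>Im (fst p)\<bar> \<le> \<bar>Im z\<bar> \<and> d \<le> Im (snd p)}"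
    using assms by auto
  show ?thesis
    using uniform_limit_compose'[OF uniform_limit_theta1[OF assms(1)] sub] by simp
qed

lemma holomorphic_theta1: "Im \<tau> > 0 \<Longrightarrow> (\<lambda>z. theta1 z \<tau>) holomorphic_on A"
proof (rule holomorphic_on_subset[OF _ subset_UNIV])
  assume t: "Im \<tau> > 0"
  show "(\<lambda>z. theta1 z \<tau>) holomorphic_on UNIV"
  proof (rule holomorphic_uniform_sequence[where f = "\<lambda>N z. 2 * (\<Sum>m<N. theta_term z \<tau> m)"])
    show "(\<lambda>z. 2 * (\<Sum>m<N. theta_term z \<tau> m)) holomorphic_on UNIV" for N
      unfolding theta_term_def by (intro holomorphic_intros)
    show "\<exists>d>0. cball x d \<subseteq> UNIV \<and> uniform_limit (cball x d)
        (\<lambda>N z. 2 * (\<Sum>m<N. theta_term z \<tau> m)) (\<lambda>z. theta1 z \<tau>) sequentially" for x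
      using uniform_limit_theta1_z[OF t, of x] by (intro exI[of _ 1]) simp
  qed simp
qed

lemma ball_half_plane:
  assumes "Im \<tau> > 0" "s \<in> ball \<tau> (Im \<tau> / 2)"
  shows "Im \<tau> / 2 \<le> Im s"
proof -
  have "\<bar>Im (s - \<tau>)\<bar> < Im \<tau> / 2"
    using abs_Im_le_cmod[of "s - \<tau>"] assms by (simp add: dist_norm norm_minus_commute)
  then show ?thesis using abs_ge_minus_self[of "Im (s - \<tau>)"] by simp
qed

lemma holomorphic_theta1_tau: "(\<lambda>\<tau>. theta1 z \<tau>) holomorphic_on {\<tau>. Im \<tau> > 0}"
proof (rule holomorphic_uniform_sequence[where f = "\<lambda>N \<tau>. 2 * (\<Sum>m<N. theta_term z \<tau> m)"])
  show "open {\<tau>. Im \<tau> > 0}" by (rule open_halfspace_Im_gt)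
  show "(\<lambda>\<tau>. 2 * (\<Sum>m<N. theta_term z \<tau> m)) holomorphic_on {\<tau>. Im \<tau> > 0}" for N
    unfolding theta_term_def by (intro holomorphic_intros)
  fix \<tau> assume t: "\<tau> \<in> {\<tau>. Im \<tau> > 0}"
  have sub: "cball \<tau> (Im \<tau> / 4) \<subseteq> {s. Im \<tau> / 2 \<le> Im s}"
  proof
    fix s assume "s \<in> cball \<tau> (Im \<tau> / 4)"
    then have "s \<in> ball \<tau> (Im \<tau> / 2)" using t by auto
    then show "s \<in> {s. Im \<tau> / 2 \<le> Im s}" using ball_half_plane[of \<tau> s] t by simp
  qed
  then show "\<exists>d>0. cball \<tau> d \<subseteq> {\<tau>. Im \<tau> > 0} \<and> uniform_limit (cball \<tau> d)
      (\<lambda>N \<tau>. 2 * (\<Sum>m<N. theta_term z \<tau> m)) (\<lambda>\<tau>. theta1 z \<tau>) sequentially"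
    using t by (intro exI[of _ "Im \<tau> / 4"] conjI uniform_limit_theta1_tau[of "Im \<tau> / 2"]) force+
qed

text \<open>True term by term; both derivatives pass to the limit because the partial sums converge
  uniformly near the point, in \<open>z\<close> for fixed \<open>\<tau>\<close> and in
  \<open>\<tau>\<close> for fixed \<open>z\<close>.\<close>

lemma theta1_heat:
  assumes t: "Im \<tau> > 0"
  shows "((\<lambda>\<tau>. theta1 z \<tau>) has_field_derivative
           (deriv ^^ 2) (\<lambda>z. theta1 z \<tau>) z / (4 * of_real pi * \<i>)) (at \<tau>)"
proof -
  define S where "S = (\<lambda>N z \<tau>. 2 * (\<Sum>m<N. theta_term z \<tau> m))"
  have 1: "(\<lambda>N. (deriv ^^ 2) (\<lambda>z. S N z \<tau>) z) \<longlonglongrightarrow> (deriv ^^ 2) (\<lambda>z. theta1 z \<tau>) z"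
  proof (rule higher_deriv_complex_uniform_limit)
    show "uniform_limit (ball z 1) (\<lambda>N z. S N z \<tau>) (\<lambda>z. theta1 z \<tau>) sequentially"
      unfolding S_def by (rule uniform_limit_on_subset[OF uniform_limit_theta1_z[OF t, of z]]) auto
    show "\<forall>\<^sub>F N in sequentially. (\<lambda>z. S N z \<tau>) holomorphic_on ball z 1"
      unfolding S_def theta_term_def by (intro always_eventually allI holomorphic_intros)
  qed auto
  have 2: "(\<lambda>N. deriv (\<lambda>\<tau>. S N z \<tau>) \<tau>) \<longlonglongrightarrow> deriv (\<lambda>\<tau>. theta1 z \<tau>) \<tau>"
  proof (rule deriv_complex_uniform_limit)
    show "uniform_limit (ball \<tau> (Im \<tau> / 2)) (\<lambda>N \<tau>. S N z \<tau>) (\<lambda>\<tau>. theta1 z \<tau>) sequentially"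
      unfolding S_def by (rule uniform_limit_theta1_tau[of "Im \<tau> / 2"]) (use t ball_half_plane in auto)
    show "\<forall>\<^sub>F N in sequentially. (\<lambda>\<tau>. S N z \<tau>) holomorphic_on ball \<tau> (Im \<tau> / 2)"
      unfolding S_def theta_term_def by (intro always_eventually allI holomorphic_intros)
  qed (use t in auto)
  have eq: "(deriv ^^ 2) (\<lambda>z. S N z \<tau>) z = 4 * of_real pi * \<i> * deriv (\<lambda>\<tau>. S N z \<tau>) \<tau>" for N
  proof -
    define a where "a = (\<lambda>m. of_nat (2 * m + 1) * complex_of_real pi)"
    define e where "e = (\<lambda>m. (-1) ^ m * exp (of_real pi * \<i> * \<tau> * (of_nat m + 1/2)\<^sup>2))"
    note th = theta_term_has_derivatives[folded a_def e_def]
    have "((\<lambda>z. S N z \<tau>) has_field_derivative 2 * (\<Sum>m<N. a m * (e m * cos (a m * z)))) (at z)" for z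
      unfolding S_def by (intro DERIV_cmult DERIV_sum) (unfold a_def e_def, rule theta_term_has_derivatives)
    then have "deriv (\<lambda>z. S N z \<tau>) = (\<lambda>z. 2 * (\<Sum>m<N. a m * (e m * cos (a m * z))))"
      by (intro ext DERIV_imp_deriv)
    moreover have "((\<lambda>z. 2 * (\<Sum>m<N. a m * (e m * cos (a m * z)))) has_field_derivative
        2 * (\<Sum>m<N. - (a m)\<^sup>2 * theta_term z \<tau> m)) (at z)"
      by (intro DERIV_cmult DERIV_sum) (unfold a_def e_def, rule theta_term_has_derivatives)
    ultimately have "(deriv ^^ 2) (\<lambda>z. S N z \<tau>) z = 2 * (\<Sum>m<N. - (a m)\<^sup>2 * theta_term z \<tau> m)"
      by (simp only: numeral_2_eq_2 funpow.simps o_apply id_apply DERIV_imp_deriv)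
    also have "\<dots> = 4 * of_real pi * \<i> * (2 * (\<Sum>m<N. (of_real pi * \<i> * (of_nat m + 1/2)\<^sup>2) * theta_term z \<tau> m))"
      unfolding sum_distrib_left a_def theta_term_has_derivatives(4) by (intro sum.cong refl) (simp only: mult_ac)
    also have "2 * (\<Sum>m<N. (of_real pi * \<i> * (of_nat m + 1/2)\<^sup>2) * theta_term z \<tau> m) = deriv (\<lambda>\<tau>. S N z \<tau>) \<tau>"
      unfolding S_def
      by (rule DERIV_imp_deriv[symmetric], intro DERIV_cmult DERIV_sum) (rule theta_term_has_derivatives)
    finally show ?thesis .
  qed
  have "(deriv ^^ 2) (\<lambda>z. theta1 z \<tau>) z = 4 * of_real pi * \<i> * deriv (\<lambda>\<tau>. theta1 z \<tau>) \<tau>"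
    by (rule LIMSEQ_unique[OF 1]) (unfold eq, intro tendsto_intros 2)
  moreover have "((\<lambda>\<tau>. theta1 z \<tau>) has_field_derivative deriv (\<lambda>\<tau>. theta1 z \<tau>) \<tau>) (at \<tau>)"
    by (rule holomorphic_derivI[OF holomorphic_theta1_tau open_halfspace_Im_gt]) (use t in simp)
  ultimately show ?thesis by simp
qed

section \<open>Parity, quasi-periods and zeros of \<open>theta1\<close>\<close>

lemma theta1_minus: "Im \<tau> > 0 \<Longrightarrow> theta1 (- z) \<tau> = - theta1 z \<tau>"
  by (simp add: theta1_product)

lemma theta1_plus_1: "Im \<tau> > 0 \<Longrightarrow> theta1 (z + 1) \<tau> = - theta1 z \<tau>"
proof -
  have "cos (2 * (of_real pi * (z + 1))) = cos (2 * (of_real pi * z))"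
    using cos_periodic by (simp add: distrib_left cos_add sin_add flip: of_real_mult)
  moreover have "sin (of_real pi * (z + 1)) = - sin (of_real pi * z)"
    by (simp add: distrib_left sin_add)
  moreover assume "Im \<tau> > 0"
  ultimately show ?thesis by (simp only: theta1_product mult_minus_left mult_minus_right)
qed

text \<open>With \<open>X z = exp (2 \<pi> \<i> z)\<close> the shift replaces \<open>X\<close> by
  \<open>q X\<close> and moves the half-factors \<open>1 - q^k X\<close> and
  \<open>1 - q^k / X\<close> by one place, so the partial products agree up to the boundary factors
  in \<open>step\<close>. These are kept as multipliers on both sides, because they may vanish for
  small \<open>N\<close>; they tend to 1.\<close>

lemma theta1_plus_tau:
  assumes t: "Im \<tau> > 0"
  shows "theta1 (z + \<tau>) \<tau> = - exp (- of_real pi * \<i> * (\<tau> + 2 * z)) * theta1 z \<tau>"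
proof -
  define q where "q = exp (2 * of_real pi * \<i> * \<tau>)"
  define X where "X = (\<lambda>z. exp (2 * of_real pi * \<i> * z))"
  define c where "c = exp (- of_real pi * \<i> * (\<tau> + 2 * z))"
  define P where "P = (\<lambda>N z. sin (of_real pi * z) *
      (\<Prod>k<N. 1 - 2 * cos (2 * (of_real pi * z)) * q ^ Suc k + (q ^ Suc k)\<^sup>2))"
  have q: "norm q < 1" using t by (simp add: q_def)
  have q0: "q \<noteq> 0" "X z \<noteq> 0" for z by (simp_all add: q_def X_def)
  have Xt: "X (z + \<tau>) = q * X z" by (simp add: X_def q_def exp_add[symmetric] algebra_simps)
  have fac: "1 - 2 * cos (2 * (of_real pi * z)) * Q + Q\<^sup>2 = (1 - Q * X z) * (1 - Q / X z)" for Q z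
  proof -
    have "2 * cos (2 * (of_real pi * z)) = X z + 1 / X z"
      by (simp add: cos_exp_eq X_def exp_minus field_simps)
    moreover have "1 - (X z + 1 / X z) * Q + Q\<^sup>2 = (1 - Q * X z) * (1 - Q / X z)"
      using q0 by (simp add: power2_eq_square field_simps)
    ultimately show ?thesis by simp
  qed
  have sn: "2 * \<i> * sin (of_real pi * z) = exp (of_real pi * \<i> * z) * (1 - 1 / X z)" for z
  proof -
    have "exp (of_real pi * \<i> * z) / X z = exp (- (of_real pi * \<i> * z))"
      by (simp add: X_def exp_diff[symmetric] algebra_simps)
    moreover have "2 * \<i> * sin w = exp (\<i> * w) - exp (- (\<i> * w))" for w
      by (simp add: sin_exp_eq)
    ultimately show ?thesis
      unfolding right_diff_distrib mult_1_right times_divide_eq_right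
      by (simp add: mult.assoc mult.left_commute[of "\<i>" "of_real pi"])
  qed
  have step: "P N (z + \<tau>) * (1 - q ^ N / X z) = - c * (1 - q ^ Suc N * X z) * P N z" for N
  proof (induction N)
    case 0
    have c': "exp (of_real pi * \<i> * (z + \<tau>)) = c * q * X z * exp (of_real pi * \<i> * z)"
      unfolding c_def q_def X_def exp_add[symmetric] by (rule arg_cong[where f=exp]) (simp add: algebra_simps)
    have "2 * \<i> * (P 0 (z + \<tau>) * (1 - q ^ 0 / X z)) = (2 * \<i> * sin (of_real pi * (z + \<tau>))) * (1 - 1 / X z)"
      by (simp add: P_def)
    also have "\<dots> = 2 * \<i> * (- c * (1 - q * X z) * sin (of_real pi * z))"
    proof -
      have "(2 * \<i> * sin (of_real pi * (z + \<tau>))) * (1 - 1 / X z)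
         = c * q * X z * exp (of_real pi * \<i> * z) * (1 - 1 / (q * X z)) * (1 - 1 / X z)"
        unfolding sn c' Xt ..
      also have "\<dots> = - c * (1 - q * X z) * (exp (of_real pi * \<i> * z) * (1 - 1 / X z))"
        using q0 by (simp add: field_simps)
      also have "\<dots> = - c * (1 - q * X z) * (2 * \<i> * sin (of_real pi * z))" unfolding sn ..
      finally show ?thesis by (simp only: mult_ac)
    qed
    finally have "P 0 (z + \<tau>) * (1 - q ^ 0 / X z) = - c * (1 - q * X z) * sin (of_real pi * z)"
      by (subst (asm) mult_left_cancel) simp_all
    then show ?case by (simp add: P_def)
  next
    case (Suc N)
    have a: "P (Suc N) z = P N z * ((1 - q ^ Suc N * X z) * (1 - q ^ Suc N / X z))" for z
      unfolding P_def prod.lessThan_Suc fac by (simp only: mult.assoc)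
    have "q ^ Suc N / (q * X z) = q ^ N / X z" using q0 by simp
    then have b: "P (Suc N) (z + \<tau>) = P N (z + \<tau>) * (1 - q ^ N / X z) * (1 - q ^ Suc (Suc N) * X z)"
      unfolding a Xt by (simp add: mult_ac)
    show ?case unfolding b unfolding Suc.IH a by (simp only: mult_ac)
  qed
  define K where "K = 2 * exp (of_real pi * \<i> * \<tau> / 4) * (\<Prod>k. 1 - q ^ Suc k)"
  have lim: "(\<lambda>N. K * P N z) \<longlonglongrightarrow> theta1 z \<tau>" for z
    using convergent_prod_LIMSEQ[OF theta1_product(2)[OF t, of z]]
    unfolding P_def K_def theta1_product(1)[OF t, of z] LIMSEQ_lessThan_iff_atMost[symmetric] q_def[symmetric]
    by (simp only: mult.assoc) (intro tendsto_intros)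
  have qN: "(\<lambda>N. q ^ N) \<longlonglongrightarrow> 0" using q by (rule LIMSEQ_power_zero)
  have "(\<lambda>N. K * P N (z + \<tau>) * (1 - q ^ N / X z)) \<longlonglongrightarrow> theta1 (z + \<tau>) \<tau> * (1 - 0 / X z)"
    by (intro tendsto_intros lim qN q0)
  moreover have "(\<lambda>N. - c * (1 - q ^ Suc N * X z) * (K * P N z)) \<longlonglongrightarrow> - c * (1 - 0 * X z) * theta1 z \<tau>"
    by (intro tendsto_intros lim LIMSEQ_Suc[OF qN])
  moreover have "K * P N (z + \<tau>) * (1 - q ^ N / X z) = - c * (1 - q ^ Suc N * X z) * (K * P N z)" for N
    using arg_cong[OF step[of N], of "\<lambda>x. K * x"] by (simp only: mult_ac)
  ultimately have "theta1 (z + \<tau>) \<tau> * (1 - 0 / X z) = - c * (1 - 0 * X z) * theta1 z \<tau>"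
    using LIMSEQ_unique by (simp only:) blast
  then show ?thesis by (simp add: c_def)
qed

text \<open>A convergent product vanishes only if one of its factors does. The sine contributes the
  integers, and the two halves of factor \<open>k\<close> contribute their translates by
  \<open>- (k + 1) \<tau>\<close> and \<open>(k + 1) \<tau>\<close>.\<close>

lemma theta1_eq_0_iff:
  assumes t: "Im \<tau> > 0"
  shows "theta1 z \<tau> = 0 \<longleftrightarrow> z \<in> period_lattice \<tau>"
proof -
  define q where "q = exp (2 * of_real pi * \<i> * \<tau>)"
  define X where "X = exp (2 * of_real pi * \<i> * z)"
  define f where "f = (\<lambda>k. 1 - 2 * cos (2 * (of_real pi * z)) * q ^ Suc k + (q ^ Suc k)\<^sup>2)"
  have q: "norm q < 1" using t by (simp add: q_def)
  have X0: "X \<noteq> 0" by (simp add: X_def)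
  have fac: "f k = (1 - q ^ Suc k * X) * (1 - q ^ Suc k / X)" for k
  proof -
    have "2 * cos (2 * (of_real pi * z)) = X + 1 / X"
      by (simp add: cos_exp_eq X_def exp_minus field_simps)
    moreover have "1 - (X + 1 / X) * Q + Q\<^sup>2 = (1 - Q * X) * (1 - Q / X)" for Q
      using X0 by (simp add: power2_eq_square field_simps)
    ultimately show ?thesis unfolding f_def by simp
  qed
  have conv: "convergent_prod f" using theta1_product(2)[OF t, of z] by (simp add: f_def q_def)
  have "prodinf f = 0 \<longleftrightarrow> 0 \<in> range f"
    using has_prod_eq_0_iff[OF convergent_prod_has_prod[OF conv]] .
  also have "\<dots> \<longleftrightarrow> (\<exists>k. q ^ Suc k * X = 1 \<or> q ^ Suc k = X)"
  proof -
    have "0 = f k \<longleftrightarrow> q ^ Suc k * X = 1 \<or> q ^ Suc k = X" for k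
    proof -
      have "0 = f k \<longleftrightarrow> 1 - q ^ Suc k * X = 0 \<or> 1 - q ^ Suc k / X = 0"
        unfolding fac eq_commute[of 0] mult_eq_0_iff ..
      also have "1 - q ^ Suc k / X = 0 \<longleftrightarrow> q ^ Suc k = X" using X0 by (auto simp: field_simps)
      finally show ?thesis by auto
    qed
    then show ?thesis unfolding image_iff by simp
  qed
  finally have pz: "prodinf f = 0 \<longleftrightarrow> (\<exists>k. q ^ Suc k * X = 1 \<or> q ^ Suc k = X)" .
  have sz: "sin (of_real pi * z) = 0 \<longleftrightarrow> (\<exists>n::int. z = of_int n)"
    by (auto simp: sin_eq_0 mult.commute)
  have th: "theta1 z \<tau> = 0 \<longleftrightarrow> sin (of_real pi * z) = 0 \<or> prodinf f = 0"
    using theta1_product(1)[OF t, of z] q_fact_LIMSEQ(2)[OF q] by (simp add: f_def q_def)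
  have expq: "q ^ k * X = exp (2 * of_real pi * \<i> * (z + of_nat k * \<tau>))"
    "q ^ k / X = exp (2 * of_real pi * \<i> * (of_nat k * \<tau> - z))" for k
    by (simp_all add: q_def X_def exp_of_nat_mult[symmetric] exp_add[symmetric] exp_diff[symmetric] algebra_simps)
  have exp1: "exp (2 * of_real pi * \<i> * y) = 1 \<longleftrightarrow> (\<exists>n::int. y = of_int n)" for y
  proof -
    have "exp (2 * of_real pi * \<i> * y) = exp 0 \<longleftrightarrow> (\<exists>n::int. 2 * of_real pi * \<i> * y = 2 * of_real pi * \<i> * of_int n)"
      unfolding exp_eq by (simp add: mult_ac)
    also have "\<dots> \<longleftrightarrow> (\<exists>n::int. y = of_int n)" by (subst mult_cancel_left) simp
    finally show ?thesis by simp
  qed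
  have pz': "prodinf f = 0 \<longleftrightarrow> (\<exists>k. (\<exists>n::int. z + of_nat (Suc k) * \<tau> = of_int n) \<or> (\<exists>n::int. of_nat (Suc k) * \<tau> - z = of_int n))"
  proof -
    have "q ^ Suc k = X \<longleftrightarrow> q ^ Suc k / X = 1" for k using X0 by (simp add: field_simps)
    then show ?thesis unfolding pz exp1[symmetric] expq[symmetric] by simp
  qed
  show ?thesis
  proof
    assume "theta1 z \<tau> = 0"
    then consider n :: int where "z = of_int n" | k and n :: int where "z + of_nat (Suc k) * \<tau> = of_int n"
      | k and n :: int where "of_nat (Suc k) * \<tau> - z = of_int n"
      unfolding th sz pz' by blast
    then show "z \<in> period_lattice \<tau>"
    proof cases
      case 1
      then have "z = of_int n + of_int 0 * \<tau>" by simp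
      then show ?thesis unfolding period_lattice_def by blast
    next
      case 2
      then have "z = of_int n + of_int (- int (Suc k)) * \<tau>" by (simp add: algebra_simps)
      then show ?thesis unfolding period_lattice_def by blast
    next
      case 3
      then have "z = of_nat (Suc k) * \<tau> - of_int n" by (metis diff_diff_eq2 add_diff_cancel_left' diff_eq_eq)
      then have "z = of_int (- n) + of_int (int (Suc k)) * \<tau>" by simp
      then show ?thesis unfolding period_lattice_def by blast
    qed
  next
    assume "z \<in> period_lattice \<tau>"
    then obtain a b :: int where z: "z = of_int a + of_int b * \<tau>" by (auto simp: period_lattice_def)
    consider "b = 0" | "b > 0" | "b < 0" by linarith
    then show "theta1 z \<tau> = 0"
    proof cases
      case 1
      then show ?thesis unfolding th sz using z by auto
    next
      case 2
      then obtain k where k: "b = int (Suc k)" by (metis gr0_conv_Suc zero_less_imp_eq_int)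
      have "of_nat (Suc k) * \<tau> - z = of_int (- a)" by (simp add: z k)
      then show ?thesis unfolding th pz' by blast
    next
      case 3
      then obtain k where k: "- b = int (Suc k)" by (metis gr0_conv_Suc zero_less_imp_eq_int neg_0_less_iff_less)
      then have "b = - int (Suc k)" by simp
      then have "z + of_nat (Suc k) * \<tau> = of_int a"
        by (simp only: z of_int_minus of_int_of_nat_eq) (simp add: algebra_simps)
      then show ?thesis unfolding th pz' by blast
    qed
  qed
qed

section \<open>The Dedekind eta function and the derivatives of \<open>theta1\<close> at 0\<close>

lemma uniform_limit_prodinf_majorized:
  fixes f :: "nat \<Rightarrow> complex \<Rightarrow> complex"
  assumes A: "compact A" and cont: "\<And>n. continuous_on A (f n)"
    and le: "\<And>n x. x \<in> A \<Longrightarrow> norm (f n x - 1) \<le> M n" and M: "summable M"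
  shows "uniform_limit A (\<lambda>N x. \<Prod>n<N. f n x) (\<lambda>x. \<Prod>n. f n x) sequentially"
proof -
  have "uniformly_convergent_on A (\<lambda>N x. \<Sum>n<N. norm (f n x - 1))"
    by (rule Weierstrass_m_test'[OF _ M]) (use le in auto)
  then have "uniformly_convergent_on A (\<lambda>N x. \<Prod>n<N. f n x)"
    by (intro uniformly_convergent_on_prod' cont A)
  then have "uniform_limit A (\<lambda>N x. \<Prod>n<N. f n x) (\<lambda>x. lim (\<lambda>N. \<Prod>n<N. f n x)) sequentially"
    using uniformly_convergent_uniform_limit_iff by blast
  moreover have "lim (\<lambda>N. \<Prod>n<N. f n x) = (\<Prod>n. f n x)" if "x \<in> A" for x
  proof -
    have "summable (\<lambda>n. norm (f n x - 1))"
      by (rule summable_comparison_test'[OF M]) (use le that in auto)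
    then have "convergent_prod (\<lambda>n. f n x)"
      by (intro abs_convergent_prod_imp_convergent_prod summable_imp_abs_convergent_prod)
    from convergent_prod_LIMSEQ[OF this] show ?thesis
      unfolding LIMSEQ_lessThan_iff_atMost[symmetric] by (rule limI)
  qed
  ultimately show ?thesis by (simp cong: uniform_limit_cong')
qed

lemma dedekind_eta_altdef:
  "dedekind_eta \<tau> = exp (of_real pi * \<i> * \<tau> / 12) * (\<Prod>k. 1 - exp (2 * of_real pi * \<i> * \<tau>) ^ Suc k)"
  unfolding dedekind_eta_def exp_of_nat2_mult[symmetric] by (simp only: exp_of_nat2_mult)

lemma dedekind_eta_nonzero: "Im \<tau> > 0 \<Longrightarrow> dedekind_eta \<tau> \<noteq> 0"
  unfolding dedekind_eta_altdef using q_fact_LIMSEQ(2)[of "exp (2 * of_real pi * \<i> * \<tau>)"] by simp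

lemma holomorphic_dedekind_eta: "dedekind_eta holomorphic_on {\<tau>. Im \<tau> > 0}"
proof -
  have "(\<lambda>\<tau>. \<Prod>k. 1 - exp (2 * of_real pi * \<i> * \<tau>) ^ Suc k) holomorphic_on {\<tau>. Im \<tau> > 0}"
  proof (rule holomorphic_uniform_sequence[where f = "\<lambda>N \<tau>. \<Prod>k<N. 1 - exp (2 * of_real pi * \<i> * \<tau>) ^ Suc k"])
    show "open {\<tau>. Im \<tau> > 0}" by (rule open_halfspace_Im_gt)
    show "(\<lambda>\<tau>. \<Prod>k<N. 1 - exp (2 * of_real pi * \<i> * \<tau>) ^ Suc k) holomorphic_on {\<tau>. Im \<tau> > 0}" for N
      by (intro holomorphic_intros)
    fix \<tau> assume t: "\<tau> \<in> {\<tau>. Im \<tau> > 0}"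
    have sub: "Im \<tau> / 2 \<le> Im s" if "s \<in> cball \<tau> (Im \<tau> / 4)" for s
      using that t by (intro ball_half_plane) auto
    define R where "R = exp (- pi * Im \<tau>)"
    have R: "0 < R" "R < 1" using t by (auto simp: R_def)
    have "uniform_limit (cball \<tau> (Im \<tau> / 4)) (\<lambda>N \<tau>. \<Prod>k<N. 1 - exp (2 * of_real pi * \<i> * \<tau>) ^ Suc k)
        (\<lambda>\<tau>. \<Prod>k. 1 - exp (2 * of_real pi * \<i> * \<tau>) ^ Suc k) sequentially"
    proof (rule uniform_limit_prodinf_majorized)
      show "norm (1 - exp (2 * of_real pi * \<i> * s) ^ Suc k - 1) \<le> R ^ Suc k" if "s \<in> cball \<tau> (Im \<tau> / 4)" for k s
      proof -
        have "norm (exp (2 * of_real pi * \<i> * s)) \<le> R"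
          using mult_left_mono[OF sub[OF that], of "2 * pi"] by (simp add: R_def)
        then have "norm (exp (2 * of_real pi * \<i> * s)) ^ Suc k \<le> R ^ Suc k"
          by (rule power_mono) simp
        moreover have "1 - x - 1 = - x" for x :: complex by simp
        ultimately show ?thesis by (simp only: norm_minus_cancel norm_power)
      qed
      show "summable (\<lambda>k. R ^ Suc k)" unfolding power_Suc using R by (intro summable_mult summable_geometric) simp
    qed (auto intro!: continuous_intros)
    moreover have "cball \<tau> (Im \<tau> / 4) \<subseteq> {\<tau>. Im \<tau> > 0}" using sub t by force
    ultimately show "\<exists>d>0. cball \<tau> d \<subseteq> {\<tau>. Im \<tau> > 0} \<and> uniform_limit (cball \<tau> d)
       (\<lambda>N \<tau>. \<Prod>k<N. 1 - exp (2 * of_real pi * \<i> * \<tau>) ^ Suc k)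
        (\<lambda>\<tau>. \<Prod>k. 1 - exp (2 * of_real pi * \<i> * \<tau>) ^ Suc k) sequentially"
      using t by (intro exI[of _ "Im \<tau> / 4"]) simp
  qed
  then show ?thesis
    unfolding dedekind_eta_altdef[abs_def] by (intro holomorphic_intros) auto
qed

text \<open>At 0 the sine vanishes, so the derivative is \<open>K \<pi>\<close> times the value of
  the product there, for which continuity at 0 suffices. That value is the square of the Euler
  product, a third copy sits in \<open>K\<close>, and \<open>exp (\<pi> \<i> \<tau> / 4)\<close> is
  the cube of the prefactor of eta.\<close>

lemma deriv_theta1_0:
  assumes t: "Im \<tau> > 0"
  shows "deriv (\<lambda>z. theta1 z \<tau>) 0 = 2 * of_real pi * dedekind_eta \<tau> ^ 3"
proof -
  define q where "q = exp (2 * of_real pi * \<i> * \<tau>)"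
  define f where "f = (\<lambda>k z. 1 - 2 * cos (2 * (of_real pi * z)) * q ^ Suc k + (q ^ Suc k)\<^sup>2)"
  define K where "K = 2 * exp (of_real pi * \<i> * \<tau> / 4) * (\<Prod>k. 1 - q ^ Suc k)"
  \<comment> \<open>Bounds \<open>2 cos (2 \<pi> z)\<close> on the unit disc, where the imaginary
    part of \<open>2 \<pi> z\<close> is at most \<open>2 \<pi>\<close> in absolute value.\<close>
  define C where "C = 2 * exp (2 * pi)"
  have q: "norm q < 1" using t by (simp add: q_def)
  have th: "theta1 z \<tau> = K * sin (of_real pi * z) * (\<Prod>k. f k z)" for z
    using theta1_product(1)[OF t, of z] by (simp add: K_def f_def q_def)
  have "uniform_limit (cball 0 1) (\<lambda>N z. \<Prod>k<N. f k z) (\<lambda>z. \<Prod>k. f k z) sequentially"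
  proof (rule uniform_limit_prodinf_majorized)
    show "continuous_on (cball 0 1) (f k)" for k unfolding f_def by (intro continuous_intros)
    show "norm (f k z - 1) \<le> (C + 1) * (norm q * norm q ^ k)" if "z \<in> cball 0 1" for k z
    proof -
      have "\<bar>Im (2 * (of_real pi * z))\<bar> \<le> 2 * pi"
        using that abs_Im_le_cmod[of z] by (simp add: abs_mult)
      then have "norm (cos (2 * (of_real pi * z))) \<le> exp (2 * pi)"
        using order_trans[OF cmod_cos_le_exp[of 1, simplified]] by (metis exp_le_cancel_iff)
      then have c: "norm (2 * cos (2 * (of_real pi * z))) \<le> C" unfolding C_def norm_mult by simp
      have "norm (f k z - 1) \<le> norm (2 * cos (2 * (of_real pi * z)) * q ^ Suc k) + norm ((q ^ Suc k)\<^sup>2)"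
        unfolding f_def
        using norm_triangle_ineq[of "- (2 * cos (2 * (of_real pi * z)) * q ^ Suc k)" "(q ^ Suc k)\<^sup>2"] by simp
      also have "norm ((q ^ Suc k)\<^sup>2) \<le> norm (q ^ Suc k)"
        unfolding norm_power power_mult[symmetric] by (rule power_decreasing) (use q in auto)
      also have "norm (2 * cos (2 * (of_real pi * z)) * q ^ Suc k) \<le> C * norm (q ^ Suc k)"
        unfolding norm_mult[of "2 * cos (2 * (of_real pi * z))"] by (rule mult_right_mono[OF c]) simp
      finally show ?thesis by (simp add: norm_mult norm_power algebra_simps)
    qed
    show "summable (\<lambda>k. (C + 1) * (norm q * norm q ^ k))"
      using q by (intro summable_mult summable_geometric) simp
  qed simp
  then have "continuous_on (cball 0 1) (\<lambda>z. \<Prod>k. f k z)"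
    by (rule uniform_limit_theorem[rotated])
       (auto intro!: always_eventually continuous_intros simp: f_def)
  then have "isCont (\<lambda>z. \<Prod>k. f k z) 0"
    by (rule continuous_on_interior) (simp add: interior_cball)
  then have c0: "(\<lambda>z. \<Prod>k. f k z) \<midarrow>0\<rightarrow> (\<Prod>k. f k 0)" by (simp add: isCont_def)
  have "((\<lambda>z. sin (of_real pi * z)) has_field_derivative of_real pi) (at (0::complex))"
    by (auto intro!: derivative_eq_intros)
  then have "((\<lambda>h. sin (of_real pi * h) / h) \<longlongrightarrow> of_real pi) (at (0::complex))"
    unfolding DERIV_def by simp
  then have "((\<lambda>h. K * (sin (of_real pi * h) / h) * (\<Prod>k. f k h)) \<longlongrightarrow> K * of_real pi * (\<Prod>k. f k 0)) (at 0)"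
    by (intro tendsto_intros c0)
  then have "((\<lambda>z. theta1 z \<tau>) has_field_derivative K * of_real pi * (\<Prod>k. f k 0)) (at 0)"
    unfolding DERIV_def by (simp add: th)
  moreover have "(\<Prod>k. f k 0) = (\<Prod>k. 1 - q ^ Suc k)\<^sup>2"
    unfolding prodinf_power[OF convergent_prod_one_minus_power[OF q], symmetric] f_def
    by (intro prodinf_cong) (simp add: power2_eq_square algebra_simps)
  moreover have "K * of_real pi * (\<Prod>k. 1 - q ^ Suc k)\<^sup>2 = 2 * of_real pi * dedekind_eta \<tau> ^ 3"
  proof -
    have "exp (of_real pi * \<i> * \<tau> / 12) ^ 3 = exp (of_real pi * \<i> * \<tau> / 4)"
      unfolding exp_of_nat_mult[symmetric] by (rule arg_cong[where f = exp]) simp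
    then show ?thesis
      unfolding K_def dedekind_eta_altdef power_mult_distrib q_def[symmetric]
      by (simp add: power2_eq_square power3_eq_cube mult_ac)
  qed
  ultimately show ?thesis by (simp add: DERIV_imp_deriv)
qed

text \<open>From \<open>\<theta>\<^sub>1'(0) = 2 \<pi> \<eta>\<^sup>3\<close> and the heat equation.\<close>

lemma deriv3_theta1_0:
  assumes t: "Im \<tau> > 0"
  shows "(deriv ^^ 3) (\<lambda>z. theta1 z \<tau>) 0 = 12 * of_real pi * \<i> * g1 \<tau> * deriv (\<lambda>z. theta1 z \<tau>) 0"
proof -
  define W where "W = {(z::complex, \<tau>). Im \<tau> > 0}"
  have W: "open W" unfolding W_def case_prod_unfold by (intro open_Collect_less continuous_intros)
  have fd: "(\<lambda>z. theta1 z \<tau>) field_differentiable (at z)" if "(z, \<tau>) \<in> W" for z \<tau>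
    using holomorphic_theta1[of \<tau> UNIV] that by (auto simp: W_def holomorphic_on_def)
  have cont: "continuous_on W (\<lambda>(z, \<tau>). (deriv ^^ 2) (\<lambda>z. theta1 z \<tau>) z / (4 * of_real pi * \<i>))"
  proof -
    have "continuous_on W (\<lambda>(z, \<tau>). (deriv ^^ 2) (\<lambda>z. theta1 z \<tau>) z)"
      by (rule continuous_on_higher_deriv_param[OF W fd]) (use continuous_on_theta1 in \<open>auto simp: W_def\<close>)
    then show ?thesis unfolding case_prod_unfold by (intro continuous_intros) auto
  qed
  \<comment> \<open>The heat equation is differentiated once in \<open>z\<close> at 0. Below, the
    same \<tau>-derivative is computed from the cube of eta; the 12 is the 4 of the heat equation
    times the 3 of the cube.\<close>
  have "((\<lambda>\<tau>. (deriv ^^ 1) (\<lambda>z. theta1 z \<tau>) 0) has_field_derivative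
      (deriv ^^ 1) (\<lambda>z. (deriv ^^ 2) (\<lambda>z. theta1 z \<tau>) z / (4 * of_real pi * \<i>)) 0) (at \<tau>)"
    by (rule has_field_derivative_higher_deriv_param[OF W _ fd _ cont])
       (use t theta1_heat in \<open>auto simp: W_def\<close>)
  also have "(deriv ^^ 1) (\<lambda>z. (deriv ^^ 2) (\<lambda>z. theta1 z \<tau>) z / (4 * of_real pi * \<i>)) 0
     = (deriv ^^ 3) (\<lambda>z. theta1 z \<tau>) 0 / (4 * of_real pi * \<i>)"
  proof -
    have "((deriv ^^ 2) (\<lambda>z. theta1 z \<tau>)) field_differentiable (at 0)"
      using holomorphic_higher_deriv[OF holomorphic_theta1[OF t] open_UNIV, of 2] by (auto simp: holomorphic_on_def)
    then show ?thesis by (simp add: eval_nat_numeral deriv_cdivide_right)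
  qed
  finally have 1: "((\<lambda>\<tau>. deriv (\<lambda>z. theta1 z \<tau>) 0) has_field_derivative
      (deriv ^^ 3) (\<lambda>z. theta1 z \<tau>) 0 / (4 * of_real pi * \<i>)) (at \<tau>)" by simp
  have "(dedekind_eta has_field_derivative deriv dedekind_eta \<tau>) (at \<tau>)"
    by (rule holomorphic_derivI[OF holomorphic_dedekind_eta open_halfspace_Im_gt]) (use t in simp)
  then have 2: "((\<lambda>\<tau>. 2 * of_real pi * dedekind_eta \<tau> ^ 3) has_field_derivative
      2 * of_real pi * (3 * dedekind_eta \<tau> ^ 2 * deriv dedekind_eta \<tau>)) (at \<tau>)"
    by (auto intro!: derivative_eq_intros)
  have "\<forall>\<^sub>F s in nhds \<tau>. 2 * of_real pi * dedekind_eta s ^ 3 = deriv (\<lambda>z. theta1 z s) 0"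
    using eventually_nhds_in_open[OF open_halfspace_Im_gt[of 0], of \<tau>] t
    by (auto elim!: eventually_mono simp: deriv_theta1_0)
  from DERIV_cong_ev[OF refl this refl, THEN iffD1, OF 2]
  have "((\<lambda>\<tau>. deriv (\<lambda>z. theta1 z \<tau>) 0) has_field_derivative
      2 * of_real pi * (3 * dedekind_eta \<tau> ^ 2 * deriv dedekind_eta \<tau>)) (at \<tau>)" .
  from DERIV_unique[OF 1 this]
  have "(deriv ^^ 3) (\<lambda>z. theta1 z \<tau>) 0 = 4 * of_real pi * \<i> * (2 * of_real pi * (3 * dedekind_eta \<tau> ^ 2 * deriv dedekind_eta \<tau>))"
    by (simp add: field_simps)
  also have "deriv dedekind_eta \<tau> = g1 \<tau> * dedekind_eta \<tau>"
    using dedekind_eta_nonzero[OF t] by (simp add: g1_def)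
  finally show ?thesis unfolding deriv_theta1_0[OF t] by (simp add: power2_eq_square power3_eq_cube mult_ac)
qed

section \<open>The logarithmic derivative \<open>\<rho>\<close> of \<open>\<theta>\<^sub>1\<close>\<close>

lemma period_lattice_0 [simp]: "0 \<in> period_lattice \<tau>"
proof -
  have "0 = of_int 0 + of_int 0 * \<tau>" by simp
  then show ?thesis unfolding period_lattice_def by blast
qed

lemma period_lattice_minus_iff [simp]: "- z \<in> period_lattice \<tau> \<longleftrightarrow> z \<in> period_lattice \<tau>"
proof -
  have "- z \<in> period_lattice \<tau>" if z: "z \<in> period_lattice \<tau>" for z
  proof -
    obtain a b :: int where "z = of_int a + of_int b * \<tau>" using z by (auto simp: period_lattice_def)
    then have "- z = of_int (- a) + of_int (- b) * \<tau>" by simp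
    then show ?thesis unfolding period_lattice_def by blast
  qed
  from this[of z] this[of "- z"] show ?thesis by auto
qed

lemma period_lattice_add: "z \<in> period_lattice \<tau> \<Longrightarrow> w \<in> period_lattice \<tau> \<Longrightarrow> z + w \<in> period_lattice \<tau>"
proof -
  assume "z \<in> period_lattice \<tau>" "w \<in> period_lattice \<tau>"
  then obtain a b c d :: int where "z = of_int a + of_int b * \<tau>" "w = of_int c + of_int d * \<tau>"
    by (auto simp: period_lattice_def)
  then have "z + w = of_int (a + c) + of_int (b + d) * \<tau>" by (simp add: algebra_simps)
  then show ?thesis unfolding period_lattice_def by blast
qed

lemma period_lattice_add_iff:
  assumes "\<omega> \<in> period_lattice \<tau>"
  shows "z + \<omega> \<in> period_lattice \<tau> \<longleftrightarrow> z \<in> period_lattice \<tau>"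
  using period_lattice_add[of z \<tau> \<omega>] period_lattice_add[of "z + \<omega>" \<tau> "- \<omega>"] assms by auto

lemma period_lattice_diff_commute: "z - w \<in> period_lattice \<tau> \<longleftrightarrow> w - z \<in> period_lattice \<tau>"
  using period_lattice_minus_iff[of "z - w" \<tau>] by simp

lemma open_compl_period_lattice:
  assumes "Im \<tau> > 0"
  shows "open (- period_lattice \<tau>)"
proof -
  have "- period_lattice \<tau> = {z. theta1 z \<tau> \<noteq> 0}" using theta1_eq_0_iff[OF assms] by auto
  moreover have "continuous_on UNIV (\<lambda>z. theta1 z \<tau>)"
    by (rule holomorphic_on_imp_continuous_on[OF holomorphic_theta1[OF assms]])
  then have "open {z. theta1 z \<tau> \<noteq> 0}" by (intro open_Collect_neq continuous_on_const)
  ultimately show ?thesis by simp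
qed

definition regular_set :: "(complex \<times> complex) set" where
  "regular_set = {(z, \<tau>). Im \<tau> > 0 \<and> z \<notin> period_lattice \<tau>}"

text \<open>The lattice is the zero set of \<open>theta1\<close>, so joint continuity replaces a
  discreteness argument. Openness in both variables at once is needed because the lattice moves with
  \<open>\<tau>\<close>.\<close>

lemma open_regular_set: "open regular_set"
proof -
  have "regular_set = {(z, \<tau>). Im \<tau> > 0} \<inter> (\<lambda>(z, \<tau>). theta1 z \<tau>) -` (- {0})"
    by (auto simp: regular_set_def theta1_eq_0_iff)
  also have "open \<dots>"
  proof (rule continuous_open_preimage[OF continuous_on_theta1])
    show "open {(z::complex, \<tau>). Im \<tau> > 0}"
      unfolding case_prod_unfold by (intro open_Collect_less continuous_intros)
  qed (rule open_Compl[OF closed_singleton])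
  finally show ?thesis .
qed

definition rho :: "complex \<Rightarrow> complex \<Rightarrow> complex" where
  "rho \<tau> z = deriv (\<lambda>z. theta1 z \<tau>) z / theta1 z \<tau>"

lemma holomorphic_rho:
  assumes "Im \<tau> > 0" "A \<subseteq> - period_lattice \<tau>"
  shows "rho \<tau> holomorphic_on A"
proof -
  have "rho \<tau> holomorphic_on - period_lattice \<tau>"
    unfolding rho_def[abs_def]
    by (intro holomorphic_on_divide holomorphic_theta1[OF assms(1)]
          holomorphic_on_subset[OF holomorphic_deriv[OF holomorphic_theta1[OF assms(1)] open_UNIV]])
       (auto simp: theta1_eq_0_iff[OF assms(1)])
  then show ?thesis using assms(2) holomorphic_on_subset by blast
qed

lemma has_field_derivative_higher_deriv_rho:
  assumes "Im \<tau> > 0" "z \<notin> period_lattice \<tau>"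
  shows "((deriv ^^ m) (rho \<tau>) has_field_derivative (deriv ^^ Suc m) (rho \<tau>) z) (at z)"
  by (rule has_field_derivative_higher_deriv[OF holomorphic_rho open_compl_period_lattice]) (use assms in auto)

lemmas has_field_derivative_rho = has_field_derivative_higher_deriv_rho[where m = 0, simplified]

lemma theta1_higher_deriv_has_field_derivative:
  assumes "Im \<tau> > 0"
  shows "((deriv ^^ m) (\<lambda>z. theta1 z \<tau>) has_field_derivative (deriv ^^ Suc m) (\<lambda>z. theta1 z \<tau>) z) (at z)"
  by (rule has_field_derivative_higher_deriv[OF holomorphic_theta1[OF assms] open_UNIV]) auto

lemma continuous_on_higher_deriv_theta1:
  "continuous_on {(z, \<tau>). Im \<tau> > 0} (\<lambda>(z, \<tau>). (deriv ^^ m) (\<lambda>z. theta1 z \<tau>) z)"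
proof (rule continuous_on_higher_deriv_param[OF _ _ continuous_on_theta1])
  show "open {(z::complex, \<tau>). Im \<tau> > 0}"
    unfolding case_prod_unfold by (intro open_Collect_less continuous_intros)
  show "(\<lambda>z. theta1 z \<tau>) field_differentiable at z" if "(z, \<tau>) \<in> {(z, \<tau>). Im \<tau> > 0}" for z \<tau>
    using theta1_higher_deriv_has_field_derivative[of \<tau> 0 z] that by (auto simp: field_differentiable_def)
qed

lemma theta1_higher_deriv_tau:
  assumes t: "Im \<tau> > 0"
  shows "((\<lambda>\<tau>. (deriv ^^ m) (\<lambda>z. theta1 z \<tau>) z) has_field_derivative
           (deriv ^^ (m + 2)) (\<lambda>z. theta1 z \<tau>) z / (4 * of_real pi * \<i>)) (at \<tau>)"
proof -
  define W where "W = {(z::complex, \<tau>). Im \<tau> > 0}"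
  have W: "open W" unfolding W_def case_prod_unfold by (intro open_Collect_less continuous_intros)
  have "((\<lambda>\<tau>. (deriv ^^ m) (\<lambda>z. theta1 z \<tau>) z) has_field_derivative
           (deriv ^^ m) (\<lambda>z. inverse (4 * of_real pi * \<i>) * (deriv ^^ 2) (\<lambda>z. theta1 z \<tau>) z) z) (at \<tau>)"
  proof (rule has_field_derivative_higher_deriv_param[OF W])
    show "(\<lambda>z. theta1 z \<tau>) field_differentiable at z" if "(z, \<tau>) \<in> W" for z \<tau>
      using theta1_higher_deriv_has_field_derivative[of \<tau> 0 z] that by (auto simp: field_differentiable_def W_def)
    show "((\<lambda>\<tau>. theta1 z \<tau>) has_field_derivative
        inverse (4 * of_real pi * \<i>) * (deriv ^^ 2) (\<lambda>z. theta1 z \<tau>) z) (at \<tau>)" if "(z, \<tau>) \<in> W" for z \<tau>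
      using theta1_heat[of \<tau> z] that unfolding divide_inverse_commute W_def by blast
    show "continuous_on W (\<lambda>(z, \<tau>). inverse (4 * of_real pi * \<i>) * (deriv ^^ 2) (\<lambda>z. theta1 z \<tau>) z)"
      using continuous_on_higher_deriv_theta1[of 2] unfolding W_def case_prod_unfold by (intro continuous_intros)
  qed (use t in \<open>simp add: W_def\<close>)
  also have "(deriv ^^ m) (\<lambda>z. inverse (4 * of_real pi * \<i>) * (deriv ^^ 2) (\<lambda>z. theta1 z \<tau>) z) z
      = inverse (4 * of_real pi * \<i>) * (deriv ^^ m) ((deriv ^^ 2) (\<lambda>z. theta1 z \<tau>)) z"
    by (rule higher_deriv_cmult[where A = UNIV])
       (auto intro!: holomorphic_higher_deriv holomorphic_theta1 t)
  also have "(deriv ^^ m) ((deriv ^^ 2) (\<lambda>z. theta1 z \<tau>)) = (deriv ^^ (m + 2)) (\<lambda>z. theta1 z \<tau>)"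
    by (simp only: funpow_add o_apply)
  also have "inverse (4 * of_real pi * \<i>) * (deriv ^^ (m + 2)) (\<lambda>z. theta1 z \<tau>) z
      = (deriv ^^ (m + 2)) (\<lambda>z. theta1 z \<tau>) z / (4 * of_real pi * \<i>)"
    unfolding divide_inverse by (rule mult.commute)
  finally show ?thesis .
qed

section \<open>The \<tau>-derivative of \<open>rho\<close>\<close>

text \<open>This is \<open>2 \<pi> \<i> \<partial>\<^sub>\<tau> \<rho>\<close>: the heat equation
  gives \<open>4 \<pi> \<i> \<partial>\<^sub>\<tau> log \<theta>\<^sub>1 = \<rho>' +
  \<rho>\<^sup>2\<close>, and one more derivative in \<open>z\<close> gives
  \<open>\<rho>'' + 2 \<rho> \<rho>'\<close>. Half of it is taken to match the factor in
  \<open>\<partial>\<^sub>u \<lambda> = - 2 \<pi> \<i> \<lambda>\<close>.\<close>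

definition rho_tau :: "complex \<Rightarrow> complex \<Rightarrow> complex" where
  "rho_tau \<tau> z = (deriv ^^ 2) (rho \<tau>) z / 2 + rho \<tau> z * deriv (rho \<tau>) z"

lemma holomorphic_rho_tau:
  assumes "Im \<tau> > 0" "A \<subseteq> - period_lattice \<tau>"
  shows "rho_tau \<tau> holomorphic_on A"
proof -
  have "rho_tau \<tau> holomorphic_on - period_lattice \<tau>"
    unfolding rho_tau_def[abs_def]
    by (intro holomorphic_intros holomorphic_rho open_compl_period_lattice assms order_refl) auto
  then show ?thesis using assms(2) holomorphic_on_subset by blast
qed

text \<open>Let \<open>Q m\<close> be the m-th derivative of \<open>theta1\<close> divided by
  \<open>theta1\<close>. The derivative of \<open>Q m\<close> is
  \<open>Q (Suc m) - Q m * Q 1\<close>, so \<open>\<rho>'\<close> and \<open>\<rho>''\<close> are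
  polynomials in these quotients, while the heat equation gives
  \<open>(Q 3 - Q 1 * Q 2) / (4 \<pi> \<i>)\<close> for the \<tau>-derivative of
  \<open>\<rho> = Q 1\<close>.\<close>

lemma rho_tau_derivative_0:
  assumes t: "Im \<tau> > 0" and z: "z \<notin> period_lattice \<tau>"
  shows "((\<lambda>\<tau>. rho \<tau> z) has_field_derivative rho_tau \<tau> z / (2 * of_real pi * \<i>)) (at \<tau>)"
proof -
  define T where "T = (\<lambda>m z. (deriv ^^ m) (\<lambda>z. theta1 z \<tau>) z)"
  have T0: "T 0 z \<noteq> 0" if "z \<notin> period_lattice \<tau>" for z using that by (simp add: T_def theta1_eq_0_iff[OF t])
  have dT: "(T m has_field_derivative T (Suc m) z) (at z)" for m z
    unfolding T_def using theta1_higher_deriv_has_field_derivative[OF t, of m z] by simp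
  define Q where "Q = (\<lambda>m z. T m z / T 0 z)"
  have rho: "rho \<tau> = Q 1" by (simp add: rho_def[abs_def] T_def Q_def)
  have dQ: "(Q m has_field_derivative Q (Suc m) z - Q m z * Q 1 z) (at z)" if "z \<notin> period_lattice \<tau>" for m z
  proof -
    have "(Q m has_field_derivative (T (Suc m) z * T 0 z - T m z * T (Suc 0) z) / (T 0 z * T 0 z)) (at z)"
      unfolding Q_def by (intro DERIV_divide dT T0 that)
    also have "(T (Suc m) z * T 0 z - T m z * T (Suc 0) z) / (T 0 z * T 0 z) = Q (Suc m) z - Q m z * Q 1 z"
      using T0[OF that] by (simp add: Q_def field_simps)
    finally show ?thesis .
  qed
  have d1: "deriv (rho \<tau>) z = Q 2 z - Q 1 z * Q 1 z" if "z \<notin> period_lattice \<tau>" for z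
    unfolding rho using DERIV_imp_deriv[OF dQ[OF that, of 1]] by (simp add: numeral_2_eq_2)
  have "(deriv (rho \<tau>) has_field_derivative (Q 3 z - Q 2 z * Q 1 z)
      - ((Q 2 z - Q 1 z * Q 1 z) * Q 1 z + (Q 2 z - Q 1 z * Q 1 z) * Q 1 z)) (at z)"
  proof (rule has_field_derivative_transform_within_open[OF _ open_compl_period_lattice[OF t]])
    show "((\<lambda>z. Q 2 z - Q 1 z * Q 1 z) has_field_derivative (Q 3 z - Q 2 z * Q 1 z)
      - ((Q 2 z - Q 1 z * Q 1 z) * Q 1 z + (Q 2 z - Q 1 z * Q 1 z) * Q 1 z)) (at z)"
      using dQ[OF z, of 2] dQ[OF z, of 1] by (intro DERIV_diff DERIV_mult) (simp_all add: eval_nat_numeral)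
  qed (use z d1 in auto)
  then have d2: "(deriv ^^ 2) (rho \<tau>) z = (Q 3 z - Q 2 z * Q 1 z)
      - ((Q 2 z - Q 1 z * Q 1 z) * Q 1 z + (Q 2 z - Q 1 z * Q 1 z) * Q 1 z)"
    by (simp add: numeral_2_eq_2 DERIV_imp_deriv)
  define k where "k = 4 * complex_of_real pi * \<i>"
  have k: "k \<noteq> 0" by (simp add: k_def)
  have "((\<lambda>\<tau>. (deriv ^^ 1) (\<lambda>z. theta1 z \<tau>) z / (deriv ^^ 0) (\<lambda>z. theta1 z \<tau>) z) has_field_derivative
      (T 3 z / k * T 0 z - T 1 z * (T 2 z / k)) / (T 0 z * T 0 z)) (at \<tau>)"
    using theta1_higher_deriv_tau[OF t, of 1 z] theta1_higher_deriv_tau[OF t, of 0 z] T0[OF z]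
    unfolding k_def T_def by (intro DERIV_divide) (simp_all add: eval_nat_numeral)
  also have "(T 3 z / k * T 0 z - T 1 z * (T 2 z / k)) / (T 0 z * T 0 z)
      = 2 * (((deriv ^^ 2) (rho \<tau>) z) / 2 + rho \<tau> z * deriv (rho \<tau>) z) / k"
  proof -
    have "(T 3 z / k * T 0 z - T 1 z * (T 2 z / k)) / (T 0 z * T 0 z) = (Q 3 z - Q 1 z * Q 2 z) / k"
      using T0[OF z] k by (simp add: Q_def field_simps)
    also have "Q 3 z - Q 1 z * Q 2 z = 2 * (((deriv ^^ 2) (rho \<tau>) z) / 2 + rho \<tau> z * deriv (rho \<tau>) z)"
      unfolding d2 d1[OF z] by (simp add: rho field_simps)
    finally show ?thesis .
  qed
  also have "\<dots> = rho_tau \<tau> z / (2 * of_real pi * \<i>)"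
    unfolding rho_tau_def by (simp add: k_def field_simps)
  finally show ?thesis by (simp add: rho_def)
qed

lemma continuous_on_higher_deriv_rho:
  "continuous_on regular_set (\<lambda>(z, \<tau>). (deriv ^^ m) (rho \<tau>) z)"
proof (rule continuous_on_higher_deriv_param[OF open_regular_set])
  show "rho \<tau> field_differentiable at z" if "(z, \<tau>) \<in> regular_set" for z \<tau>
    using has_field_derivative_rho[of \<tau> z] that by (auto simp: field_differentiable_def regular_set_def)
  have "continuous_on regular_set (\<lambda>(z, \<tau>). (deriv ^^ m) (\<lambda>z. theta1 z \<tau>) z)" for m
    by (rule continuous_on_subset[OF continuous_on_higher_deriv_theta1]) (auto simp: regular_set_def)
  from this[of 1] this[of 0] show "continuous_on regular_set (\<lambda>(z, \<tau>). rho \<tau> z)"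
    unfolding rho_def case_prod_unfold
    by (intro continuous_intros) (auto simp: regular_set_def theta1_eq_0_iff)
qed

lemma rho_tau_derivative:
  assumes t: "Im \<tau> > 0" and z: "z \<notin> period_lattice \<tau>"
  shows "((\<lambda>\<tau>. (deriv ^^ m) (rho \<tau>) z) has_field_derivative
           (deriv ^^ m) (rho_tau \<tau>) z / (2 * of_real pi * \<i>)) (at \<tau>)"
proof -
  have "((\<lambda>\<tau>. (deriv ^^ m) (\<lambda>z. rho \<tau> z) z) has_field_derivative
           (deriv ^^ m) (\<lambda>z. inverse (2 * of_real pi * \<i>) * rho_tau \<tau> z) z) (at \<tau>)"
  proof (rule has_field_derivative_higher_deriv_param[OF open_regular_set])
    show "rho \<tau> field_differentiable at z" if "(z, \<tau>) \<in> regular_set" for z \<tau>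
      using has_field_derivative_rho[of \<tau> z] that by (auto simp: field_differentiable_def regular_set_def)
    show "((\<lambda>\<tau>. rho \<tau> z) has_field_derivative inverse (2 * of_real pi * \<i>) * rho_tau \<tau> z) (at \<tau>)"
      if "(z, \<tau>) \<in> regular_set" for z \<tau>
      using rho_tau_derivative_0[of \<tau> z] that unfolding divide_inverse_commute regular_set_def by blast
    show "continuous_on regular_set (\<lambda>(z, \<tau>). inverse (2 * of_real pi * \<i>) * rho_tau \<tau> z)"
      using continuous_on_higher_deriv_rho[of 2] continuous_on_higher_deriv_rho[of 1] continuous_on_higher_deriv_rho[of 0]
      unfolding rho_tau_def case_prod_unfold by (intro continuous_intros) simp_all
  qed (use t z in \<open>simp add: regular_set_def\<close>)
  also have "(deriv ^^ m) (\<lambda>z. inverse (2 * of_real pi * \<i>) * rho_tau \<tau> z) z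
      = inverse (2 * of_real pi * \<i>) * (deriv ^^ m) (rho_tau \<tau>) z"
    by (rule higher_deriv_cmult[OF holomorphic_rho_tau[OF t order_refl] _ open_compl_period_lattice[OF t]])
       (use z in simp)
  also have "\<dots> = (deriv ^^ m) (rho_tau \<tau>) z / (2 * of_real pi * \<i>)"
    unfolding divide_inverse by (rule mult.commute)
  finally show ?thesis .
qed

section \<open>Parity, quasi-periods and expansion of \<open>rho\<close> at 0\<close>

lemma rho_minus:
  assumes t: "Im \<tau> > 0"
  shows "rho \<tau> (- z) = - rho \<tau> z"
proof -
  have "((\<lambda>z. - theta1 (- z) \<tau>) has_field_derivative deriv (\<lambda>z. theta1 z \<tau>) (- z)) (at z)"
    using theta1_higher_deriv_has_field_derivative[OF t, of 0 "- z"]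
    by (auto intro!: derivative_eq_intros DERIV_chain2[where g = uminus and f = "\<lambda>z. theta1 z \<tau>"])
  then have "deriv (\<lambda>z. theta1 z \<tau>) z = deriv (\<lambda>z. theta1 z \<tau>) (- z)"
    by (simp add: theta1_minus[OF t] DERIV_imp_deriv)
  then show ?thesis by (simp add: rho_def theta1_minus[OF t])
qed

text \<open>The generators 1 and \<open>\<tau>\<close> shift \<open>rho\<close> by 0 and
  \<open>- 2 \<pi> \<i>\<close>. Later arguments only need that some constant exists, a property
  stable under sums and negatives and therefore inherited by the whole lattice.\<close>

lemma rho_add_period:
  assumes t: "Im \<tau> > 0" and \<omega>: "\<omega> \<in> period_lattice \<tau>"
  obtains c where "\<And>z. z \<notin> period_lattice \<tau> \<Longrightarrow> rho \<tau> (z + \<omega>) = rho \<tau> z + c"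
proof -
  define P where "P = (\<lambda>\<omega>. \<exists>c. \<forall>z. z \<notin> period_lattice \<tau> \<longrightarrow> rho \<tau> (z + \<omega>) = rho \<tau> z + c)"
  have dth: "((\<lambda>z. theta1 (z + \<omega>) \<tau>) has_field_derivative deriv (\<lambda>z. theta1 z \<tau>) (z + \<omega>)) (at z)" for z \<omega>
    using theta1_higher_deriv_has_field_derivative[OF t, of 0 "z + \<omega>"]
    by (auto simp: DERIV_shift)
  have dth0: "((\<lambda>z. theta1 z \<tau>) has_field_derivative deriv (\<lambda>z. theta1 z \<tau>) z) (at z)" for z
    using theta1_higher_deriv_has_field_derivative[OF t, of 0 z] by simp
  have P1: "P 1"
  proof -
    have "((\<lambda>z. - theta1 z \<tau>) has_field_derivative deriv (\<lambda>z. theta1 z \<tau>) (z + 1)) (at z)" for z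
      using dth[of 1 z] by (simp add: theta1_plus_1[OF t])
    moreover have "((\<lambda>z. - theta1 z \<tau>) has_field_derivative - deriv (\<lambda>z. theta1 z \<tau>) z) (at z)" for z
      by (intro DERIV_minus dth0)
    ultimately have "deriv (\<lambda>z. theta1 z \<tau>) (z + 1) = - deriv (\<lambda>z. theta1 z \<tau>) z" for z
      by (rule DERIV_unique)
    then have "rho \<tau> (z + 1) = rho \<tau> z + 0" for z by (simp add: rho_def theta1_plus_1[OF t])
    then show ?thesis unfolding P_def by blast
  qed
  have P\<tau>: "P \<tau>"
  proof -
    define e where "e = (\<lambda>z. - exp (- of_real pi * \<i> * (\<tau> + 2 * z)))"
    have de: "(e has_field_derivative - (2 * of_real pi * \<i>) * e z) (at z)" for z
      unfolding e_def by (auto intro!: derivative_eq_intros)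
    have th: "theta1 (z + \<tau>) \<tau> = e z * theta1 z \<tau>" for z
      unfolding e_def by (rule theta1_plus_tau[OF t])
    have "((\<lambda>z. e z * theta1 z \<tau>) has_field_derivative deriv (\<lambda>z. theta1 z \<tau>) (z + \<tau>)) (at z)" for z
      using dth[of \<tau> z] by (simp add: th)
    moreover have "((\<lambda>z. e z * theta1 z \<tau>) has_field_derivative
        - (2 * of_real pi * \<i>) * e z * theta1 z \<tau> + deriv (\<lambda>z. theta1 z \<tau>) z * e z) (at z)" for z
      by (rule DERIV_mult[OF de dth0])
    ultimately have *: "deriv (\<lambda>z. theta1 z \<tau>) (z + \<tau>)
        = - (2 * of_real pi * \<i>) * e z * theta1 z \<tau> + deriv (\<lambda>z. theta1 z \<tau>) z * e z" for z
      by (rule DERIV_unique)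
    have "rho \<tau> (z + \<tau>) = rho \<tau> z + - (2 * of_real pi * \<i>)" if "z \<notin> period_lattice \<tau>" for z
    proof -
      have "theta1 z \<tau> \<noteq> 0" "e z \<noteq> 0" using that by (simp_all add: theta1_eq_0_iff[OF t] e_def)
      then show ?thesis unfolding rho_def * th by (simp add: field_simps)
    qed
    then show ?thesis unfolding P_def by blast
  qed
  have L: "1 \<in> period_lattice \<tau>" "\<tau> \<in> period_lattice \<tau>"
  proof -
    have "1 = of_int 1 + of_int 0 * \<tau>" "\<tau> = of_int 0 + of_int 1 * \<tau>" by simp_all
    then show "1 \<in> period_lattice \<tau>" "\<tau> \<in> period_lattice \<tau>" unfolding period_lattice_def by blast+
  qed
  have Padd: "P (\<omega> + \<omega>')" if P: "P \<omega>" "P \<omega>'" "\<omega> \<in> period_lattice \<tau>" for \<omega> \<omega>'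
  proof -
    obtain c c' where c: "\<And>z. z \<notin> period_lattice \<tau> \<Longrightarrow> rho \<tau> (z + \<omega>) = rho \<tau> z + c"
      "\<And>z. z \<notin> period_lattice \<tau> \<Longrightarrow> rho \<tau> (z + \<omega>') = rho \<tau> z + c'" using P unfolding P_def by blast
    have "rho \<tau> (z + (\<omega> + \<omega>')) = rho \<tau> z + (c + c')" if "z \<notin> period_lattice \<tau>" for z
      using c(2)[of "z + \<omega>"] c(1)[of z] that \<open>\<omega> \<in> _\<close>
      by (simp add: period_lattice_add_iff add.assoc)
    then show ?thesis unfolding P_def by blast
  qed
  have Pminus: "P (- \<omega>)" if P: "P \<omega>" "\<omega> \<in> period_lattice \<tau>" for \<omega>
  proof -
    obtain c where c: "\<And>z. z \<notin> period_lattice \<tau> \<Longrightarrow> rho \<tau> (z + \<omega>) = rho \<tau> z + c"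
      using P unfolding P_def by blast
    have "rho \<tau> (z + - \<omega>) = rho \<tau> z + - c" if "z \<notin> period_lattice \<tau>" for z
      using c[of "z + - \<omega>"] that \<open>\<omega> \<in> _\<close> period_lattice_add_iff[of "- \<omega>" \<tau> z] by simp
    then show ?thesis unfolding P_def by blast
  qed
  have P0: "P 0" unfolding P_def by (auto intro: exI[of _ 0])
  have Pmult: "P (of_int n * \<omega>) \<and> of_int n * \<omega> \<in> period_lattice \<tau>" if "P \<omega>" "\<omega> \<in> period_lattice \<tau>" for n :: int and \<omega>
  proof (induction n rule: int_induct[where k = 0])
    case base then show ?case using P0 by simp
  next
    case (step1 i) then show ?case
      using Padd[of "of_int i * \<omega>" \<omega>] that period_lattice_add[of "of_int i * \<omega>" \<tau> \<omega>] by (simp add: algebra_simps)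
  next
    case (step2 i) then show ?case
      using Padd[of "of_int i * \<omega>" "- \<omega>"] Pminus[of \<omega>] that period_lattice_add[of "of_int i * \<omega>" \<tau> "- \<omega>"]
      by (simp add: algebra_simps)
  qed
  obtain a b :: int where ab: "\<omega> = of_int a * 1 + of_int b * \<tau>" using \<omega> by (auto simp: period_lattice_def)
  have "P \<omega>" unfolding ab using Padd Pmult P1 P\<tau> L by blast
  then show ?thesis using that unfolding P_def by blast
qed

text \<open>Writing \<open>\<theta>\<^sub>1(z) = z G(z)\<close> with \<open>G\<close> even and
  \<open>G(0) \<noteq> 0\<close> gives \<open>h = G' / G\<close>. Evenness forces
  \<open>h(0) = 0\<close>, and \<open>h'(0) = G''(0) / G(0) = \<theta>\<^sub>1'''(0) / (3
  \<theta>\<^sub>1'(0))\<close>. This is where g1 enters the comparison with the Weierstrass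
  functions.\<close>

lemma rho_expansion_0:
  assumes t: "Im \<tau> > 0"
  obtains r h where "r > 0" "h holomorphic_on ball 0 r" "h 0 = 0"
    "deriv h 0 = 4 * of_real pi * \<i> * g1 \<tau>"
    "\<And>z. z \<in> ball 0 r - {0} \<Longrightarrow> z \<notin> period_lattice \<tau> \<and> rho \<tau> z = 1 / z + h z"
proof -
  define T where "T = (\<lambda>z. theta1 z \<tau>)"
  define G where "G = (\<lambda>z. if z = 0 then deriv T 0 else T z / z)"
  have T: "T holomorphic_on UNIV" unfolding T_def by (rule holomorphic_theta1[OF t])
  have T0: "T 0 = 0" by (simp add: T_def theta1_eq_0_iff[OF t])
  have G: "G holomorphic_on UNIV"
    using pole_lemma_open[OF T open_UNIV, of 0, unfolded T0 diff_zero] by (simp only: G_def)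
  have TG: "T = (\<lambda>z. z * G z)" by (auto simp: G_def T0)
  have G0: "G 0 \<noteq> 0" unfolding G_def T_def using deriv_theta1_0[OF t] dedekind_eta_nonzero[OF t] by simp
  have "isCont G 0" using G holomorphic_on_imp_continuous_on continuous_on_eq_continuous_at open_UNIV by blast
  then have "\<forall>\<^sub>F z in nhds 0. G z \<noteq> 0"
    using G0 by (intro tendsto_imp_eventually_ne) (auto simp: isCont_def tendsto_nhds_iff)
  then obtain r where r: "r > 0" "\<And>z. dist z 0 < r \<Longrightarrow> G z \<noteq> 0"
    unfolding eventually_nhds_metric by blast
  define h where "h = (\<lambda>z. deriv G z / G z)"
  have dG: "((deriv ^^ m) G has_field_derivative (deriv ^^ Suc m) G z) (at z)" for m z
    by (rule has_field_derivative_higher_deriv[OF G open_UNIV]) simp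
  have hT: "(deriv ^^ k) T 0 = of_nat k * (deriv ^^ (k - 1)) G 0" for k
  proof -
    have "(deriv ^^ k) T 0 = (\<Sum>i = 0..k. of_nat (k choose i) * (deriv ^^ i) (\<lambda>w. w) 0 * (deriv ^^ (k - i)) G 0)"
      unfolding TG by (rule higher_deriv_mult[OF _ G open_UNIV]) auto
    also have "\<dots> = (\<Sum>i = 0..k. if i = 1 then of_nat k * (deriv ^^ (k - 1)) G 0 else 0)"
      by (intro sum.cong refl) (auto simp: higher_deriv_ident)
    also have "\<dots> = of_nat k * (deriv ^^ (k - 1)) G 0" by (cases k) auto
    finally show ?thesis .
  qed
  have G1: "deriv G 0 = 0"
  proof -
    have "G (- z) = G z" for z using theta1_minus[OF t, of z] by (auto simp: G_def T_def)
    then have "((\<lambda>z. G (- z)) has_field_derivative deriv G 0) (at 0)" using dG[of 0 0] by simp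
    moreover have "((\<lambda>z. G (- z)) has_field_derivative - deriv G 0) (at 0)"
    proof -
      have "(uminus has_field_derivative -1) (at (0::complex))" by (auto intro!: derivative_eq_intros)
      then show ?thesis using dG[of 0 0] DERIV_chain2[of G "deriv G 0" uminus 0 "-1" UNIV] by simp
    qed
    ultimately have "deriv G 0 = - deriv G 0" by (rule DERIV_unique)
    then show ?thesis by simp
  qed
  have h: "h holomorphic_on ball 0 r"
    unfolding h_def
    by (intro holomorphic_intros holomorphic_on_subset[OF G] holomorphic_on_subset[OF holomorphic_deriv[OF G open_UNIV]])
       (use r in \<open>auto simp: dist_commute\<close>)
  have "(h has_field_derivative ((deriv ^^ 2) G 0 * G 0 - deriv G 0 * deriv G 0) / (G 0 * G 0)) (at 0)"
    unfolding h_def using dG[of 1 0] dG[of 0 0] G0 by (intro DERIV_divide) (simp_all add: numeral_2_eq_2)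
  then have "deriv h 0 = (deriv ^^ 2) G 0 / G 0" using G0 by (simp add: DERIV_imp_deriv G1)
  also have "\<dots> = 4 * of_real pi * \<i> * g1 \<tau>"
    using hT[of 3] hT[of 1] deriv3_theta1_0[OF t] G0 unfolding T_def[symmetric] by (simp add: field_simps)
  finally have dh: "deriv h 0 = 4 * of_real pi * \<i> * g1 \<tau>" .
  have main: "z \<notin> period_lattice \<tau> \<and> rho \<tau> z = 1 / z + h z" if "z \<in> ball 0 r - {0}" for z
  proof -
    have z: "z \<noteq> 0" "G z \<noteq> 0" using that r by (auto simp: dist_commute)
    have thz: "theta1 z \<tau> = z * G z" using fun_cong[OF TG, of z] by (simp only: T_def)
    have "deriv T z = G z + z * deriv G z"
      unfolding TG using dG[of 0 z] by (intro DERIV_imp_deriv) (auto intro!: derivative_eq_intros)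
    then have "rho \<tau> z = (G z + z * deriv G z) / (z * G z)"
      unfolding rho_def T_def by (simp only: thz)
    moreover have "z \<notin> period_lattice \<tau>" using thz z theta1_eq_0_iff[OF t, of z] by simp
    ultimately show ?thesis using z by (simp add: h_def field_simps)
  qed
  show ?thesis by (rule that[OF r(1) h _ dh main]) (simp_all add: h_def G1)
qed

section \<open>Liouville's theorem for elliptic functions\<close>

lemma holomorphic_on_shift:
  assumes "f holomorphic_on T" "\<And>z. z \<in> S \<Longrightarrow> z + a \<in> T"
  shows "(\<lambda>z. f (z + a)) holomorphic_on S"
proof -
  have "(f \<circ> (\<lambda>z. z + a)) holomorphic_on S"
    by (rule holomorphic_on_compose_gen[OF _ assms(1)]) (use assms(2) in \<open>auto intro!: holomorphic_intros\<close>)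
  then show ?thesis by (simp add: o_def)
qed

lemma eventually_not_period_lattice:
  assumes t: "Im \<tau> > 0"
  shows "\<forall>\<^sub>F w in at z. w - a \<notin> period_lattice \<tau>"
proof (cases "z - a \<in> period_lattice \<tau>")
  case True
  obtain r h where rh: "r > 0" "\<And>z. z \<in> ball 0 r - {0} \<Longrightarrow> z \<notin> period_lattice \<tau> \<and> rho \<tau> z = 1 / z + h z"
    using rho_expansion_0[OF t] by metis
  have "w - a \<notin> period_lattice \<tau>" if "w \<noteq> z" "dist w z < r" for w
  proof -
    have "w - z \<in> ball 0 r - {0}" using that by (simp add: dist_norm norm_minus_commute)
    then have "w - z \<notin> period_lattice \<tau>" using rh(2) by blast
    moreover have "w - a = (w - z) + (z - a)" by simp
    ultimately show ?thesis using period_lattice_add_iff[OF True] by metis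
  qed
  then show ?thesis unfolding eventually_at using rh(1) by blast
next
  case False
  have "open ((\<lambda>w. w - a) -` (- period_lattice \<tau>))"
    by (intro open_vimage open_compl_period_lattice t continuous_intros)
  then have "\<forall>\<^sub>F w in nhds z. w \<in> (\<lambda>w. w - a) -` (- period_lattice \<tau>)"
    using False by (intro eventually_nhds_in_open) auto
  then show ?thesis by (auto simp: eventually_at_filter elim: eventually_mono)
qed

text \<open>The closed fundamental parallelogram is compact and meets every class of points, so the
  function with its singularities removed is bounded. \<open>S\<close> is a parameter because
  functions singular at several classes of points occur. A finite limit is asked for at one
  translate of each point of \<open>S\<close> only; periodicity carries it to the others.\<close>

lemma elliptic_constant:
  assumes t: "Im \<tau> > 0"
    and holo: "f holomorphic_on - S"
    and S: "open (- S)" "\<And>z. \<forall>\<^sub>F w in at z. w \<notin> S"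
    and per: "\<And>z \<omega>. \<omega> \<in> period_lattice \<tau> \<Longrightarrow> z + \<omega> \<in> S \<longleftrightarrow> z \<in> S"
             "\<And>z \<omega>. \<omega> \<in> period_lattice \<tau> \<Longrightarrow> z \<notin> S \<Longrightarrow> f (z + \<omega>) = f z"
    and lim: "\<And>z. z \<in> S \<Longrightarrow> \<exists>\<omega>\<in>period_lattice \<tau>. \<exists>c. (f \<longlongrightarrow> c) (at (z + \<omega>))"
  obtains c where "\<And>z. z \<notin> S \<Longrightarrow> f z = c"
proof -
  define g where "g = remove_sings f"
  have fan: "f analytic_on {z}" if "z \<notin> S" for z
    using holo S(1) that by (intro holomorphic_on_imp_analytic_at[of _ "- S"]) auto
  have lim': "\<exists>c. (f \<longlongrightarrow> c) (at z)" if zS: "z \<in> S" for z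
  proof -
    obtain \<omega> c where w: "\<omega> \<in> period_lattice \<tau>" "(f \<longlongrightarrow> c) (at (z + \<omega>))" using lim[OF zS] by blast
    have "filterlim (\<lambda>x. x + \<omega>) (at (z + \<omega>)) (at z)"
      by (auto simp: filterlim_at eventually_at_filter intro!: tendsto_intros)
    then have "((\<lambda>x. f (x + \<omega>)) \<longlongrightarrow> c) (at z)"
      using w(2) filterlim_compose by blast
    moreover have "\<forall>\<^sub>F x in at z. f (x + \<omega>) = f x"
      using S(2)[of z] by eventually_elim (use per(2)[OF w(1)] in auto)
    ultimately have "(f \<longlongrightarrow> c) (at z)" by (rule Lim_transform_eventually)
    then show ?thesis by blast
  qed
  have iso: "isolated_singularity_at f z" for z
  proof -
    obtain r where r: "r > 0" "\<And>w. w \<noteq> z \<Longrightarrow> dist w z < r \<Longrightarrow> w \<notin> S"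
      using S(2)[of z] unfolding eventually_at by auto
    have "f holomorphic_on (ball z r - {z})"
      by (rule holomorphic_on_subset[OF holo]) (use r(2) in \<open>auto simp: dist_commute\<close>)
    then have "f analytic_on (ball z r - {z})" by (simp add: analytic_on_open open_Diff)
    then show ?thesis unfolding isolated_singularity_at_def using r(1) by blast
  qed
  have gf: "g z = f z" if "z \<notin> S" for z unfolding g_def by (rule remove_sings_at_analytic[OF fan[OF that]])
  have "g analytic_on {z}" for z
  proof (cases "z \<in> S")
    case True
    then show ?thesis unfolding g_def using lim' remove_sings_analytic_at[OF iso] by blast
  next
    case False
    then show ?thesis unfolding g_def by (intro remove_sings_analytic_on fan)
  qed
  then have "g analytic_on UNIV" by (subst analytic_on_analytic_at) blast
  then have ghol: "g holomorphic_on UNIV" by (rule analytic_imp_holomorphic)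
  define K where "K = (\<lambda>p. of_real (fst p) + of_real (snd p) * \<tau>) ` ({0..1} \<times> {0..1::real})"
  have "compact K" unfolding K_def
    by (intro compact_continuous_image compact_Times compact_Icc continuous_intros)
  then have "compact (g ` K)"
    by (intro compact_continuous_image holomorphic_on_imp_continuous_on holomorphic_on_subset[OF ghol]) auto
  then obtain B where B: "\<And>z. z \<in> K \<Longrightarrow> norm (g z) \<le> B"
    using compact_imp_bounded bounded_iff by (metis imageI)
  have B1: "norm (f z) \<le> B" if z: "z \<notin> S" for z
  proof -
    define y where "y = Im z / Im \<tau>"
    define x where "x = Re (z - of_real y * \<tau>)"
    have zxy: "z = of_real x + of_real y * \<tau>"
      using t by (auto simp: complex_eq_iff x_def y_def)
    define \<omega> where "\<omega> = of_int (- \<lfloor>x\<rfloor>) + of_int (- \<lfloor>y\<rfloor>) * \<tau>"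
    have \<omega>: "\<omega> \<in> period_lattice \<tau>" unfolding \<omega>_def period_lattice_def by blast
    have "z + \<omega> = of_real (frac x) + of_real (frac y) * \<tau>"
      by (simp add: zxy \<omega>_def frac_def algebra_simps)
    then have "z + \<omega> \<in> K" unfolding K_def
      by (intro image_eqI[of _ _ "(frac x, frac y)"]) (auto simp: frac_ge_0 less_imp_le[OF frac_lt_1])
    moreover have "z + \<omega> \<notin> S" using per(1)[OF \<omega>] z by simp
    ultimately have "norm (f (z + \<omega>)) \<le> B" using B gf by metis
    then show ?thesis using per(2)[OF \<omega> z] by simp
  qed
  have "norm (g z) \<le> B" for z
  proof (rule Lim_norm_ubound)
    show "(g \<longlongrightarrow> g z) (at z)"
      using ghol holomorphic_on_imp_continuous_on continuous_on_def by (metis UNIV_I at_within_open open_UNIV continuous_on)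
    show "\<forall>\<^sub>F w in at z. norm (g w) \<le> B"
      using S(2)[of z] by eventually_elim (simp add: gf B1)
  qed simp
  then have "bounded (range g)" by (auto simp: bounded_iff)
  then have "g constant_on UNIV" by (rule Liouville_theorem[OF ghol])
  then obtain c where "\<And>z. g z = c" by (auto simp: constant_on_def)
  then show ?thesis using that gf by metis
qed

lemma higher_deriv_rho_add_period:
  assumes t: "Im \<tau> > 0" and \<omega>: "\<omega> \<in> period_lattice \<tau>" and z: "z \<notin> period_lattice \<tau>" and m: "m > 0"
  shows "(deriv ^^ m) (rho \<tau>) (z + \<omega>) = (deriv ^^ m) (rho \<tau>) z"
proof -
  obtain c where c: "\<And>z. z \<notin> period_lattice \<tau> \<Longrightarrow> rho \<tau> (z + \<omega>) = rho \<tau> z + c"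
    using rho_add_period[OF t \<omega>] by metis
  have shift: "z + \<omega> \<in> - period_lattice \<tau>" if "z \<in> - period_lattice \<tau>" for z
    using that period_lattice_add_iff[OF \<omega>] by simp
  have "(deriv ^^ m) (rho \<tau>) (z + \<omega>) = (deriv ^^ m) (\<lambda>z. rho \<tau> (1 * z + \<omega>)) z"
    using higher_deriv_compose_linear'[OF holomorphic_rho[OF t order_refl] open_compl_period_lattice[OF t]
        open_compl_period_lattice[OF t], of z 1 \<omega> m] z shift by simp
  also have "\<dots> = (deriv ^^ m) (\<lambda>z. rho \<tau> z + c) z"
  proof (rule higher_deriv_transform_within_open[OF _ _ open_compl_period_lattice[OF t]])
    show "(\<lambda>z. rho \<tau> (1 * z + \<omega>)) holomorphic_on - period_lattice \<tau>"
      unfolding mult_1 by (rule holomorphic_on_shift[OF holomorphic_rho[OF t order_refl] shift])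
    show "(\<lambda>z. rho \<tau> z + c) holomorphic_on - period_lattice \<tau>"
      by (intro holomorphic_intros holomorphic_rho t order_refl)
  qed (use z c in auto)
  also have "\<dots> = (deriv ^^ m) (rho \<tau>) z + (deriv ^^ m) (\<lambda>z. c) z"
    by (rule higher_deriv_add[OF holomorphic_rho[OF t order_refl] _ open_compl_period_lattice[OF t]])
       (use z in auto)
  also have "(deriv ^^ m) (\<lambda>z. c) z = 0" using m by (simp add: higher_deriv_const)
  finally show ?thesis by simp
qed

lemma deriv_rho_minus:
  assumes t: "Im \<tau> > 0" and z: "z \<notin> period_lattice \<tau>"
  shows "deriv (rho \<tau>) (- z) = deriv (rho \<tau>) z"
proof -
  have "(uminus has_field_derivative -1) (at z)" by (auto intro!: derivative_eq_intros)
  moreover have "(rho \<tau> has_field_derivative deriv (rho \<tau>) (- z)) (at (- z))"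
    by (rule has_field_derivative_rho) (use t z in auto)
  ultimately have "((\<lambda>z. rho \<tau> (- z)) has_field_derivative - deriv (rho \<tau>) (- z)) (at z)"
    using DERIV_chain2[of "rho \<tau>" "deriv (rho \<tau>) (- z)" uminus z "-1" UNIV] by simp
  moreover have "((\<lambda>z. rho \<tau> (- z)) has_field_derivative - deriv (rho \<tau>) z) (at z)"
    unfolding rho_minus[OF t] by (intro DERIV_minus has_field_derivative_rho t z)
  ultimately have "- deriv (rho \<tau>) (- z) = - deriv (rho \<tau>) z" by (rule DERIV_unique)
  then show ?thesis by simp
qed

section \<open>The quadratic addition formula for \<open>rho\<close>\<close>

text \<open>For \<open>a = p\<close>, \<open>b = - q\<close>, \<open>c = q - p\<close>, of sum zero,
  this is \<open>(\<rho>(a) + \<rho>(b) + \<rho>(c))\<^sup>2 + \<rho>'(a) + \<rho>'(b) +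
  \<rho>'(c)\<close>, as \<open>\<rho>\<close> is odd and \<open>\<rho>'\<close> even. The
  asymmetric version keeps the difference \<open>p - q\<close> visible.\<close>

definition rho_add_form :: "complex \<Rightarrow> complex \<Rightarrow> complex \<Rightarrow> complex" where
  "rho_add_form \<tau> p q = (rho \<tau> p - rho \<tau> q - rho \<tau> (p - q))\<^sup>2
     + deriv (rho \<tau>) p + deriv (rho \<tau>) q + deriv (rho \<tau>) (p - q)"

text \<open>The double pole of \<open>\<rho>(p)\<^sup>2\<close> cancels that of
  \<open>\<rho>'(p)\<close>. The remaining critical term is \<open>2 k(p) / p\<close>, which has a
  limit because \<open>k(0) = h(0) - \<rho>(q) - \<rho>(- q) = 0\<close>.\<close>

lemma rho_add_form_limit_0:
  assumes t: "Im \<tau> > 0" and q: "q \<notin> period_lattice \<tau>"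
  obtains c where "((\<lambda>p. rho_add_form \<tau> p q) \<longlongrightarrow> c) (at 0)"
proof -
  obtain r h where r: "r > 0" and h: "h holomorphic_on ball 0 r" "h 0 = 0"
    and rh: "\<And>z. z \<in> ball 0 r - {0} \<Longrightarrow> z \<notin> period_lattice \<tau> \<and> rho \<tau> z = 1 / z + h z"
    using rho_expansion_0[OF t] by metis
  have q': "0 - q \<notin> period_lattice \<tau>" using q by simp
  define k where "k = (\<lambda>p. h p - rho \<tau> q - rho \<tau> (p - q))"
  have dh: "(h has_field_derivative deriv h z) (at z)" if "z \<in> ball 0 r" for z
    by (rule holomorphic_derivI[OF h(1) open_ball that])
  have d2: "(rho \<tau> has_field_derivative deriv (rho \<tau>) (0 - q)) (at (0 - q))"
    by (rule has_field_derivative_rho[OF t q'])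
  have "(k has_field_derivative deriv h 0 - 0 - deriv (rho \<tau>) (0 - q)) (at 0)"
    unfolding k_def using d2 DERIV_shift[of "rho \<tau>" _ 0 "- q"] r
    by (intro DERIV_diff dh DERIV_const) (auto simp: algebra_simps)
  then have dk: "(k has_field_derivative deriv h 0 - deriv (rho \<tau>) (0 - q)) (at 0)" by simp
  have k0: "k 0 = 0" by (simp add: k_def h(2) rho_minus[OF t])
  have kp: "((\<lambda>p. k p / p) \<longlongrightarrow> deriv h 0 - deriv (rho \<tau>) (0 - q)) (at 0)"
    using dk unfolding DERIV_def by (simp add: k0)
  have kc: "(k \<longlongrightarrow> 0) (at 0)" using DERIV_isCont[OF dk] by (simp add: isCont_def k0)
  have dhc: "(deriv h \<longlongrightarrow> deriv h 0) (at 0)"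
  proof -
    have "isCont (deriv h) 0"
      using holomorphic_on_imp_continuous_on[OF holomorphic_deriv[OF h(1) open_ball]] r
      by (simp add: continuous_on_eq_continuous_at)
    then show ?thesis by (simp add: isCont_def)
  qed
  have drc: "((\<lambda>p. deriv (rho \<tau>) (p - q)) \<longlongrightarrow> deriv (rho \<tau>) (0 - q)) (at 0)"
  proof -
    have "isCont (deriv (rho \<tau>)) (0 - q)"
      using has_field_derivative_higher_deriv_rho[OF t q', of 1] by (auto intro: DERIV_isCont)
    then have "isCont (\<lambda>p. deriv (rho \<tau>) (p - q)) 0"
      using isCont_o2[where f = "\<lambda>p. p - q" and a = 0 and g = "deriv (rho \<tau>)"] by simp
    then show ?thesis by (simp add: isCont_def)
  qed
  have L: "((\<lambda>p. 2 * (k p / p) + (k p)\<^sup>2 + deriv h p + deriv (rho \<tau>) q + deriv (rho \<tau>) (p - q)) \<longlongrightarrow>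
      2 * (deriv h 0 - deriv (rho \<tau>) (0 - q)) + 0\<^sup>2 + deriv h 0 + deriv (rho \<tau>) q + deriv (rho \<tau>) (0 - q)) (at 0)"
    by (intro tendsto_intros kp kc dhc drc)
  have E: "\<forall>\<^sub>F p in at 0. 2 * (k p / p) + (k p)\<^sup>2 + deriv h p + deriv (rho \<tau>) q + deriv (rho \<tau>) (p - q)
       = rho_add_form \<tau> p q"
  proof -
    have "\<forall>\<^sub>F p in at 0. p \<in> ball 0 r - {0}" using r by (intro eventually_at_in_open) auto
    then show ?thesis
    proof eventually_elim
      case (elim p)
      then have p: "p \<noteq> 0" by simp
      have "(rho \<tau> has_field_derivative - 1 / (p * p) + deriv h p) (at p)"
      proof (rule has_field_derivative_transform_within_open[of "\<lambda>z. 1 / z + h z" _ _ "ball 0 r - {0}"])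
        have "((\<lambda>z. 1 / z) has_field_derivative - 1 / (p * p)) (at p)"
          using p by (auto intro!: derivative_eq_intros simp: field_simps)
        then show "((\<lambda>z. 1 / z + h z) has_field_derivative - 1 / (p * p) + deriv h p) (at p)"
          by (intro DERIV_add dh) (use elim in auto)
      qed (use elim rh in \<open>auto simp: open_Diff\<close>)
      then have e1: "deriv (rho \<tau>) p = - 1 / (p * p) + deriv h p" by (rule DERIV_imp_deriv)
      have e2: "rho \<tau> p - rho \<tau> q - rho \<tau> (p - q) = 1 / p + k p"
        using rh[OF elim] by (simp add: k_def)
      have sq: "(1 / p)\<^sup>2 = 1 / (p * p)" by (simp add: power2_eq_square)
      have e3: "2 * (c / p) + c\<^sup>2 + a + x + y = (1 / p + c)\<^sup>2 + (- 1 / (p * p) + a) + x + y" for c a x y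
        unfolding power2_sum sq by simp
      show ?case unfolding rho_add_form_def e2 e1 e3 ..
    qed
  qed
  show ?thesis by (rule that[OF Lim_transform_eventually[OF L E]])
qed

lemma rho_add_form_swap: "Im \<tau> > 0 \<Longrightarrow> p - q \<notin> period_lattice \<tau> \<Longrightarrow> rho_add_form \<tau> p q = rho_add_form \<tau> q p"
  using rho_minus[of \<tau> "p - q"] deriv_rho_minus[of \<tau> "p - q"]
  by (simp add: rho_add_form_def power2_eq_square algebra_simps)

text \<open>In \<open>p\<close> the form is elliptic, since the quasi-periods of
  \<open>\<rho>(p)\<close> and \<open>\<rho>(p - q)\<close> cancel. Its possible poles are the
  classes of 0 and \<open>q\<close>. The symmetry \<open>p \<mapsto> q - p\<close> exchanges them,
  so the limit at 0 also supplies the one at \<open>q\<close>.\<close>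

lemma rho_add_form_const_1:
  assumes t: "Im \<tau> > 0" and q: "q \<notin> period_lattice \<tau>"
  obtains c where "\<And>p. p \<notin> period_lattice \<tau> \<Longrightarrow> p - q \<notin> period_lattice \<tau> \<Longrightarrow> rho_add_form \<tau> p q = c"
proof -
  define S where "S = {p. p \<in> period_lattice \<tau> \<or> p - q \<in> period_lattice \<tau>}"
  have op: "open (- S)"
  proof -
    have "- S = (- period_lattice \<tau>) \<inter> ((\<lambda>p. p - q) -` (- period_lattice \<tau>))" by (auto simp: S_def)
    also have "open \<dots>" by (intro open_Int open_vimage open_compl_period_lattice t continuous_intros)
    finally show ?thesis .
  qed
  have hol: "rho \<tau> holomorphic_on - period_lattice \<tau>" "deriv (rho \<tau>) holomorphic_on - period_lattice \<tau>"
    using holomorphic_rho[OF t order_refl] holomorphic_deriv[OF holomorphic_rho[OF t order_refl] open_compl_period_lattice[OF t]]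
    by auto
  have holS: "f holomorphic_on - S" "(\<lambda>p. f (p - q)) holomorphic_on - S" if "f holomorphic_on - period_lattice \<tau>" for f
  proof -
    show "f holomorphic_on - S" by (rule holomorphic_on_subset[OF that]) (auto simp: S_def)
    show "(\<lambda>p. f (p - q)) holomorphic_on - S"
      using holomorphic_on_shift[OF that, of "- S" "- q"] by (simp add: S_def)
  qed
  have symm: "rho_add_form \<tau> (q - p) q = rho_add_form \<tau> p q" if "p \<notin> S" for p
  proof -
    have "rho \<tau> (q - p) = - rho \<tau> (p - q)" "deriv (rho \<tau>) (q - p) = deriv (rho \<tau>) (p - q)"
      using rho_minus[OF t, of "p - q"] deriv_rho_minus[OF t, of "p - q"] that by (auto simp: S_def)
    moreover have "rho \<tau> (q - p - q) = - rho \<tau> p" "deriv (rho \<tau>) (q - p - q) = deriv (rho \<tau>) p"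
      using rho_minus[OF t, of "p"] deriv_rho_minus[OF t, of p] that by (auto simp: S_def)
    ultimately show ?thesis by (simp add: rho_add_form_def power2_eq_square algebra_simps)
  qed
  have evS: "\<forall>\<^sub>F w in at z. w \<notin> S" for z
    using eventually_not_period_lattice[OF t, of 0 z] eventually_not_period_lattice[OF t, of q z]
    by eventually_elim (simp add: S_def)
  obtain c0 where c0: "((\<lambda>p. rho_add_form \<tau> p q) \<longlongrightarrow> c0) (at 0)" by (rule rho_add_form_limit_0[OF t q])
  have cq: "((\<lambda>p. rho_add_form \<tau> p q) \<longlongrightarrow> c0) (at q)"
  proof -
    have "((\<lambda>p. q - p) \<longlongrightarrow> q - q) (at q)" by (intro tendsto_intros)
    then have "filterlim (\<lambda>p. q - p) (at (q - q)) (at q)"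
      by (rule filterlim_atI) (auto simp: eventually_at_filter)
    then have "((\<lambda>p. rho_add_form \<tau> (q - p) q) \<longlongrightarrow> c0) (at q)"
      using filterlim_compose[OF c0, of "\<lambda>p. q - p" "at q"] by simp
    moreover have "\<forall>\<^sub>F p in at q. rho_add_form \<tau> (q - p) q = rho_add_form \<tau> p q"
      using evS[of q] by eventually_elim (rule symm)
    ultimately show ?thesis by (rule Lim_transform_eventually)
  qed
  obtain c where c: "\<And>p. p \<notin> S \<Longrightarrow> rho_add_form \<tau> p q = c"
  proof (rule elliptic_constant[OF t, of "\<lambda>p. rho_add_form \<tau> p q" S])
    show "(\<lambda>p. rho_add_form \<tau> p q) holomorphic_on - S"
      unfolding rho_add_form_def by (intro holomorphic_intros holS hol)
    show "open (- S)" by (rule op)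
    show "\<forall>\<^sub>F w in at z. w \<notin> S" for z by (rule evS)
    show "z + \<omega> \<in> S \<longleftrightarrow> z \<in> S" if "\<omega> \<in> period_lattice \<tau>" for z \<omega>
      using period_lattice_add_iff[OF that, of z] period_lattice_add_iff[OF that, of "z - q"]
      by (simp add: S_def algebra_simps)
    show "rho_add_form \<tau> (z + \<omega>) q = rho_add_form \<tau> z q" if w: "\<omega> \<in> period_lattice \<tau>" and z: "z \<notin> S" for z \<omega>
    proof -
      obtain k where k: "\<And>z. z \<notin> period_lattice \<tau> \<Longrightarrow> rho \<tau> (z + \<omega>) = rho \<tau> z + k"
        using rho_add_period[OF t w] by metis
      have f: "rho \<tau> (z + \<omega>) = rho \<tau> z + k" "rho \<tau> (z - q + \<omega>) = rho \<tau> (z - q) + k"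
        "deriv (rho \<tau>) (z + \<omega>) = deriv (rho \<tau>) z" "deriv (rho \<tau>) (z - q + \<omega>) = deriv (rho \<tau>) (z - q)"
        using z k higher_deriv_rho_add_period[OF t w, of _ 1] by (auto simp: S_def)
      have e: "z + \<omega> - q = z - q + \<omega>" by simp
      have k': "rho \<tau> z + k - rho \<tau> q - (rho \<tau> (z - q) + k) = rho \<tau> z - rho \<tau> q - rho \<tau> (z - q)"
        by (simp add: algebra_simps)
      show ?thesis unfolding rho_add_form_def e f k' ..
    qed
    show "\<exists>\<omega>\<in>period_lattice \<tau>. \<exists>c. ((\<lambda>p. rho_add_form \<tau> p q) \<longlongrightarrow> c) (at (z + \<omega>))" if "z \<in> S" for z
    proof (cases "z \<in> period_lattice \<tau>")
      case True
      then show ?thesis using c0 by (intro bexI[of _ "- z"]) auto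
    next
      case False
      then have "q - z \<in> period_lattice \<tau>" using that by (auto simp: S_def period_lattice_diff_commute)
      then show ?thesis using cq by (intro bexI[of _ "q - z"]) auto
    qed
  qed (use that in auto)
  then show ?thesis using that by (auto simp: S_def)
qed

text \<open>Up to the value of the constant, this is
  \<open>(\<zeta>(x) + \<zeta>(y) + \<zeta>(z))\<^sup>2 = \<wp>(x) + \<wp>(y) + \<wp>(z)\<close> for \<open>x + y + z = 0\<close>.\<close>

lemma rho_addition:
  assumes t: "Im \<tau> > 0"
  obtains \<kappa> where "\<And>p q. p \<notin> period_lattice \<tau> \<Longrightarrow> q \<notin> period_lattice \<tau> \<Longrightarrow> p - q \<notin> period_lattice \<tau>
      \<Longrightarrow> rho_add_form \<tau> p q = \<kappa>"
proof -
  have "rho_add_form \<tau> p q = rho_add_form \<tau> p' q'"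
    if g: "p \<notin> period_lattice \<tau>" "q \<notin> period_lattice \<tau>" "p - q \<notin> period_lattice \<tau>"
      "p' \<notin> period_lattice \<tau>" "q' \<notin> period_lattice \<tau>" "p' - q' \<notin> period_lattice \<tau>" for p q p' q'
  proof -
    \<comment> \<open>An auxiliary point \<open>r\<close>, generic for both \<open>q\<close> and
      \<open>q'\<close>, links the pairs (p, q), (r, q), (q, r), (q', r), (r, q'), (p', q'):
      constancy in the first argument alternates with the swap.\<close>
    have "\<forall>\<^sub>F r in at 0. r - 0 \<notin> period_lattice \<tau> \<and> r - q \<notin> period_lattice \<tau> \<and> r - q' \<notin> period_lattice \<tau>"
      by (intro eventually_conj eventually_not_period_lattice t)
    then obtain r where r: "r \<notin> period_lattice \<tau>" "r - q \<notin> period_lattice \<tau>" "r - q' \<notin> period_lattice \<tau>"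
      using eventually_happens[of _ "at (0::complex)"] by auto
    have r': "q - r \<notin> period_lattice \<tau>" "q' - r \<notin> period_lattice \<tau>"
      using r period_lattice_diff_commute by blast+
    have "rho_add_form \<tau> p q = rho_add_form \<tau> r q"
      using rho_add_form_const_1[OF t g(2)] g r by metis
    also have "\<dots> = rho_add_form \<tau> q r" by (rule rho_add_form_swap[OF t r(2)])
    also have "\<dots> = rho_add_form \<tau> q' r" using rho_add_form_const_1[OF t r(1)] g r' by metis
    also have "\<dots> = rho_add_form \<tau> r q'" by (rule rho_add_form_swap[OF t r'(2)])
    also have "\<dots> = rho_add_form \<tau> p' q'" using rho_add_form_const_1[OF t g(5)] g r by metis
    finally show ?thesis .
  qed
  then show ?thesis using that by metis
qed

text \<open>Solved so that the terms other than \<open>\<rho>\<close> and \<open>\<rho>'\<close> at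
  \<open>p\<close> and \<open>q\<close> depend on \<open>p - q\<close> alone. The theta factors of
  the superpotential at \<open>z\<close> and at \<open>y\<close> have arguments differing by
  \<open>z - y\<close>, so the same terms serve for every factor.\<close>

lemma rho_add_eq:
  assumes t: "Im \<tau> > 0"
  obtains \<kappa> where "\<And>p q. p \<notin> period_lattice \<tau> \<Longrightarrow> q \<notin> period_lattice \<tau> \<Longrightarrow> p - q \<notin> period_lattice \<tau>
      \<Longrightarrow> (rho \<tau> p - rho \<tau> q)\<^sup>2 + deriv (rho \<tau>) p + deriv (rho \<tau>) q
        = 2 * (rho \<tau> p - rho \<tau> q) * rho \<tau> (p - q) - (rho \<tau> (p - q))\<^sup>2 - deriv (rho \<tau>) (p - q) + \<kappa>"
proof -
  obtain \<kappa> where k: "\<And>p q. p \<notin> period_lattice \<tau> \<Longrightarrow> q \<notin> period_lattice \<tau> \<Longrightarrow> p - q \<notin> period_lattice \<tau>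
      \<Longrightarrow> rho_add_form \<tau> p q = \<kappa>" using rho_addition[OF t] by metis
  show ?thesis
    by (rule that[of \<kappa>], drule (2) k) (simp add: rho_add_form_def power2_eq_square algebra_simps)
qed

text \<open>Derivative of the addition formula along \<open>(p + s, q + s)\<close>: the difference
  of the arguments stays fixed, so \<open>\<rho>(p - q)\<close> behaves as a constant.\<close>

lemma rho_tau_sum_0:
  assumes t: "Im \<tau> > 0" and g: "p \<notin> period_lattice \<tau>" "q \<notin> period_lattice \<tau>" "p - q \<notin> period_lattice \<tau>"
  shows "rho_tau \<tau> p + rho_tau \<tau> q = rho \<tau> (p - q) * (deriv (rho \<tau>) p - deriv (rho \<tau>) q)
           + (deriv (rho \<tau>) p * rho \<tau> q + rho \<tau> p * deriv (rho \<tau>) q)"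
proof -
  define d where "d = rho \<tau> (p - q)"
  define T where "T = (\<lambda>s. rho \<tau> (s + p) - rho \<tau> (s + q) - d)"
  define F where "F = (\<lambda>s. T s * T s + deriv (rho \<tau>) (s + p) + deriv (rho \<tau>) (s + q) + deriv (rho \<tau>) (p - q))"
  obtain \<kappa> where \<kappa>: "\<And>p q. p \<notin> period_lattice \<tau> \<Longrightarrow> q \<notin> period_lattice \<tau> \<Longrightarrow> p - q \<notin> period_lattice \<tau>
      \<Longrightarrow> rho_add_form \<tau> p q = \<kappa>" using rho_addition[OF t] by metis
  have dm: "((\<lambda>s. (deriv ^^ m) (rho \<tau>) (s + x)) has_field_derivative (deriv ^^ Suc m) (rho \<tau>) x) (at 0)"
    if "x \<notin> period_lattice \<tau>" for x m
    using has_field_derivative_higher_deriv_rho[OF t that, of m] DERIV_shift[of "(deriv ^^ m) (rho \<tau>)" _ 0 x]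
    by simp
  have dT: "(T has_field_derivative deriv (rho \<tau>) p - deriv (rho \<tau>) q - 0) (at 0)"
    unfolding T_def using dm[OF g(1), of 0] dm[OF g(2), of 0] by (intro DERIV_diff DERIV_const) simp_all
  have "(F has_field_derivative (deriv (rho \<tau>) p - deriv (rho \<tau>) q - 0) * T 0 + (deriv (rho \<tau>) p - deriv (rho \<tau>) q - 0) * T 0
      + (deriv ^^ 2) (rho \<tau>) p + (deriv ^^ 2) (rho \<tau>) q + 0) (at 0)"
    unfolding F_def using dm[OF g(1), of 1] dm[OF g(2), of 1]
    by (intro DERIV_add DERIV_mult dT DERIV_const) (simp_all add: numeral_2_eq_2)
  moreover have "(F has_field_derivative 0) (at 0)"
  proof -
    have "\<forall>\<^sub>F s in nhds 0. s + p \<notin> period_lattice \<tau> \<and> s + q \<notin> period_lattice \<tau>"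
    proof -
      have "\<forall>\<^sub>F s in nhds 0. s + x \<notin> period_lattice \<tau>" if "x \<notin> period_lattice \<tau>" for x
      proof -
        have "open ((\<lambda>s. s + x) -` (- period_lattice \<tau>))"
          by (intro open_vimage open_compl_period_lattice t continuous_intros)
        from eventually_nhds_in_open[OF this, of 0] that show ?thesis by simp
      qed
      from eventually_conj[OF this[OF g(1)] this[OF g(2)]] show ?thesis .
    qed
    then have "\<forall>\<^sub>F s in nhds 0. F s = \<kappa>"
    proof eventually_elim
      case (elim s)
      then have "rho_add_form \<tau> (s + p) (s + q) = \<kappa>" using g by (intro \<kappa>) auto
      then show ?case by (simp add: F_def T_def d_def rho_add_form_def power2_eq_square)
    qed
    from DERIV_cong_ev[OF refl this refl] show ?thesis by simp
  qed
  ultimately have "(deriv (rho \<tau>) p - deriv (rho \<tau>) q - 0) * T 0 + (deriv (rho \<tau>) p - deriv (rho \<tau>) q - 0) * T 0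
      + (deriv ^^ 2) (rho \<tau>) p + (deriv ^^ 2) (rho \<tau>) q + 0 = 0" by (rule DERIV_unique)
  then have e1: "(deriv ^^ 2) (rho \<tau>) p + (deriv ^^ 2) (rho \<tau>) q
      = - 2 * (deriv (rho \<tau>) p - deriv (rho \<tau>) q) * (rho \<tau> p - rho \<tau> q - d)"
    by (simp add: T_def algebra_simps)
  have e2: "rho_tau \<tau> p + rho_tau \<tau> q = ((deriv ^^ 2) (rho \<tau>) p + (deriv ^^ 2) (rho \<tau>) q) / 2
      + rho \<tau> p * deriv (rho \<tau>) p + rho \<tau> q * deriv (rho \<tau>) q"
    by (simp add: rho_tau_def field_simps)
  show ?thesis unfolding e2 e1 by (simp add: d_def field_simps)
qed

text \<open>The \<open>m\<close>-th derivative of \<open>rho_tau_sum_0\<close> along \<open>(p + s, q + s)\<close>.\<close>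

lemma rho_tau_sum:
  assumes t: "Im \<tau> > 0" and g: "p \<notin> period_lattice \<tau>" "q \<notin> period_lattice \<tau>" "p - q \<notin> period_lattice \<tau>"
  shows "(deriv ^^ m) (rho_tau \<tau>) p + (deriv ^^ m) (rho_tau \<tau>) q =
      rho \<tau> (p - q) * ((deriv ^^ Suc m) (rho \<tau>) p - (deriv ^^ Suc m) (rho \<tau>) q)
      + (\<Sum>i = 0..Suc m. of_nat (Suc m choose i) * (deriv ^^ i) (rho \<tau>) p * (deriv ^^ (Suc m - i)) (rho \<tau>) q)"
proof -
  define A where "A = ((\<lambda>s. s + p) -` (- period_lattice \<tau>)) \<inter> ((\<lambda>s. s + q) -` (- period_lattice \<tau>))"
  have A: "open A" "0 \<in> A"
  proof -
    show "open A" unfolding A_def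
      by (intro open_Int open_vimage open_compl_period_lattice t continuous_intros)
    show "0 \<in> A" using g by (simp add: A_def)
  qed
  have hol: "(\<lambda>s. f (s + p)) holomorphic_on A" "(\<lambda>s. f (s + q)) holomorphic_on A"
    if "f holomorphic_on - period_lattice \<tau>" for f
    by (rule holomorphic_on_shift[OF that], simp add: A_def)+
  have hr: "rho \<tau> holomorphic_on - period_lattice \<tau>" "deriv (rho \<tau>) holomorphic_on - period_lattice \<tau>"
    "rho_tau \<tau> holomorphic_on - period_lattice \<tau>"
    using holomorphic_rho[OF t order_refl] holomorphic_rho_tau[OF t order_refl]
      holomorphic_deriv[OF holomorphic_rho[OF t order_refl] open_compl_period_lattice[OF t]] by auto
  \<comment> \<open>The last bracket of \<open>rho_tau_sum_0\<close> is the derivative of this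
    product, so its m-th derivative is a Leibniz sum of order \<open>Suc m\<close>.\<close>
  define P where "P = (\<lambda>s. rho \<tau> (s + p) * rho \<tau> (s + q))"
  have P: "P holomorphic_on A" unfolding P_def by (intro holomorphic_intros hol hr)
  define d where "d = rho \<tau> (p - q)"
  have dP: "deriv P s = deriv (rho \<tau>) (s + p) * rho \<tau> (s + q) + rho \<tau> (s + p) * deriv (rho \<tau>) (s + q)" if "s \<in> A" for s
  proof (rule DERIV_imp_deriv)
    have "((\<lambda>s. rho \<tau> (s + x)) has_field_derivative deriv (rho \<tau>) (s + x)) (at s)" if "s + x \<notin> period_lattice \<tau>" for x
      using has_field_derivative_rho[OF t that] by (simp add: DERIV_shift)
    from DERIV_mult[OF this this, of p q] that
    show "(P has_field_derivative deriv (rho \<tau>) (s + p) * rho \<tau> (s + q) + rho \<tau> (s + p) * deriv (rho \<tau>) (s + q)) (at s)"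
      unfolding P_def by (simp add: A_def mult.commute)
  qed
  have "(deriv ^^ m) (\<lambda>s. rho_tau \<tau> (s + p) + rho_tau \<tau> (s + q)) 0 =
      (deriv ^^ m) (\<lambda>s. d * (deriv (rho \<tau>) (s + p) - deriv (rho \<tau>) (s + q)) + deriv P s) 0"
  proof (rule higher_deriv_transform_within_open[OF _ _ A])
    show "(\<lambda>s. rho_tau \<tau> (s + p) + rho_tau \<tau> (s + q)) holomorphic_on A" by (intro holomorphic_intros hol hr)
    show "(\<lambda>s. d * (deriv (rho \<tau>) (s + p) - deriv (rho \<tau>) (s + q)) + deriv P s) holomorphic_on A"
      by (intro holomorphic_on_add holomorphic_on_mult holomorphic_on_diff holomorphic_on_const hol hr
          holomorphic_deriv P A)
    show "rho_tau \<tau> (s + p) + rho_tau \<tau> (s + q) = d * (deriv (rho \<tau>) (s + p) - deriv (rho \<tau>) (s + q)) + deriv P s"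
      if "s \<in> A" for s
      using rho_tau_sum_0[OF t, of "s + p" "s + q"] dP[OF that] that g by (simp add: A_def d_def)
  qed
  also have "\<dots> = (deriv ^^ m) (\<lambda>s. d * (deriv (rho \<tau>) (s + p) - deriv (rho \<tau>) (s + q))) 0 + (deriv ^^ m) (deriv P) 0"
    by (rule higher_deriv_add[OF _ _ A])
       (intro holomorphic_on_mult holomorphic_on_diff holomorphic_on_const hol hr holomorphic_deriv P A)+
  also have "(deriv ^^ m) (\<lambda>s. d * (deriv (rho \<tau>) (s + p) - deriv (rho \<tau>) (s + q))) 0
     = d * (deriv ^^ m) (\<lambda>s. deriv (rho \<tau>) (s + p) - deriv (rho \<tau>) (s + q)) 0"
    by (rule higher_deriv_cmult[OF _ A(2,1)]) (intro holomorphic_on_diff hol hr)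
  also have "(deriv ^^ m) (\<lambda>s. deriv (rho \<tau>) (s + p) - deriv (rho \<tau>) (s + q)) 0
      = (deriv ^^ m) (\<lambda>s. deriv (rho \<tau>) (s + p)) 0 - (deriv ^^ m) (\<lambda>s. deriv (rho \<tau>) (s + q)) 0"
    by (rule higher_deriv_diff[OF _ _ A]) (intro hol hr)+
  also have "(deriv ^^ m) (deriv P) 0 = (deriv ^^ Suc m) P 0" by (simp only: funpow_Suc_right o_apply)
  also have "\<dots> = (\<Sum>i = 0..Suc m. of_nat (Suc m choose i) * (deriv ^^ i) (\<lambda>s. rho \<tau> (s + p)) 0
      * (deriv ^^ (Suc m - i)) (\<lambda>s. rho \<tau> (s + q)) 0)"
    unfolding P_def by (rule higher_deriv_mult[OF _ _ A]) (intro hol hr)+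
  also have "(deriv ^^ m) (\<lambda>s. rho_tau \<tau> (s + p) + rho_tau \<tau> (s + q)) 0
      = (deriv ^^ m) (\<lambda>s. rho_tau \<tau> (s + p)) 0 + (deriv ^^ m) (\<lambda>s. rho_tau \<tau> (s + q)) 0"
    by (rule higher_deriv_add[OF _ _ A]) (intro hol hr)+
  finally show ?thesis
    unfolding higher_deriv_shift d_def by (simp only: funpow_Suc_right o_apply)
qed

section \<open>The Weierstrass functions\<close>

text \<open>The finite partial sums converge uniformly along the filter of finite subsets, so
  holomorphy and all derivatives pass to the limit and the lattice need not be enumerated.\<close>

lemma infsum_holomorphic:
  fixes f :: "'a \<Rightarrow> complex \<Rightarrow> complex"
  assumes B: "open B" and hol: "\<And>\<omega>. \<omega> \<in> A \<Longrightarrow> f \<omega> holomorphic_on B"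
    and bound: "\<And>\<omega> z. \<omega> \<in> A \<Longrightarrow> z \<in> B \<Longrightarrow> norm (f \<omega> z) \<le> M \<omega>" and M: "M summable_on A"
  shows "(\<lambda>z. \<Sum>\<^sub>\<infinity>\<omega>\<in>A. f \<omega> z) holomorphic_on B"
    and "z \<in> B \<Longrightarrow> ((\<lambda>\<omega>. (deriv ^^ m) (f \<omega>) z) has_sum (deriv ^^ m) (\<lambda>z. \<Sum>\<^sub>\<infinity>\<omega>\<in>A. f \<omega> z) z) A"
proof -
  have lim: "uniform_limit B (\<lambda>X z. \<Sum>\<omega>\<in>X. f \<omega> z) (\<lambda>z. \<Sum>\<^sub>\<infinity>\<omega>\<in>A. f \<omega> z) (finite_subsets_at_top A)"
    by (rule Weierstrass_m_test_general[OF bound M])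
  have ev: "\<forall>\<^sub>F X in finite_subsets_at_top A. finite X \<and> X \<subseteq> A"
    by (simp add: eventually_finite_subsets_at_top_weakI)
  have hols: "(\<lambda>z. \<Sum>\<omega>\<in>X. f \<omega> z) holomorphic_on B" if "X \<subseteq> A" for X
    using that by (intro holomorphic_on_sum hol) auto
  show "(\<lambda>z. \<Sum>\<^sub>\<infinity>\<omega>\<in>A. f \<omega> z) holomorphic_on B"
  proof -
    have "\<exists>d>0. (\<lambda>z. \<Sum>\<^sub>\<infinity>\<omega>\<in>A. f \<omega> z) holomorphic_on ball z d" if zB: "z \<in> B" for z
    proof -
      obtain d where d: "d > 0" "cball z d \<subseteq> B" using B zB open_contains_cball by blast
      have "\<forall>\<^sub>F X in finite_subsets_at_top A. continuous_on (cball z d) (\<lambda>z. \<Sum>\<omega>\<in>X. f \<omega> z)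
          \<and> (\<lambda>z. \<Sum>\<omega>\<in>X. f \<omega> z) holomorphic_on ball z d"
        using ev
      proof eventually_elim
        case (elim X)
        have "(\<lambda>z. \<Sum>\<omega>\<in>X. f \<omega> z) holomorphic_on cball z d"
          by (rule holomorphic_on_subset[OF hols]) (use elim d in auto)
        then show ?case
          using holomorphic_on_imp_continuous_on holomorphic_on_subset ball_subset_cball by blast
      qed
      from holomorphic_uniform_limit[OF this uniform_limit_on_subset[OF lim d(2)]]
      show ?thesis using d(1) by auto
    qed
    then have "(\<lambda>z. \<Sum>\<^sub>\<infinity>\<omega>\<in>A. f \<omega> z) analytic_on B" by (auto simp: analytic_on_def)
    then show ?thesis by (rule analytic_imp_holomorphic)
  qed
  assume z: "z \<in> B"
  have "((\<lambda>X. (deriv ^^ m) (\<lambda>z. \<Sum>\<omega>\<in>X. f \<omega> z) z) \<longlongrightarrow> (deriv ^^ m) (\<lambda>z. \<Sum>\<^sub>\<infinity>\<omega>\<in>A. f \<omega> z) z)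
      (finite_subsets_at_top A)"
  proof (rule higher_deriv_complex_uniform_limit[OF lim _ _ B z])
    show "\<forall>\<^sub>F X in finite_subsets_at_top A. (\<lambda>z. \<Sum>\<omega>\<in>X. f \<omega> z) holomorphic_on B"
      using ev by eventually_elim (auto intro: hols)
  qed simp
  moreover have "\<forall>\<^sub>F X in finite_subsets_at_top A.
      (deriv ^^ m) (\<lambda>z. \<Sum>\<omega>\<in>X. f \<omega> z) z = (\<Sum>\<omega>\<in>X. (deriv ^^ m) (f \<omega>) z)"
    using ev
  proof eventually_elim
    case (elim X)
    then have "finite X" "X \<subseteq> A" by auto
    then show ?case
    proof (induction X rule: finite_induct)
      case empty
      show ?case by (simp add: higher_deriv_const)
    next
      case (insert x X)
      then show ?case
        by (simp add: higher_deriv_add[OF hol hols B z])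
    qed
  qed
  ultimately show "((\<lambda>\<omega>. (deriv ^^ m) (f \<omega>) z) has_sum (deriv ^^ m) (\<lambda>z. \<Sum>\<^sub>\<infinity>\<omega>\<in>A. f \<omega> z) z) A"
    unfolding has_sum_def by (rule Lim_transform_eventually)
qed

lemma summable_on_int_powr: "(\<lambda>a::int. (1 + \<bar>real_of_int a\<bar>) powr (-3/2)) summable_on UNIV"
proof -
  define u where "u = (\<lambda>a::int. (1 + \<bar>real_of_int a\<bar>) powr (-3/2))"
  have "summable (\<lambda>n. real (Suc n) powr (-3/2))"
    using summable_real_powr_iff[of "-3/2"] by (subst summable_Suc_iff) simp
  then have "(\<lambda>n. real (Suc n) powr (-3/2)) summable_on UNIV"
    by (subst summable_on_UNIV_nonneg_real_iff) auto
  then have s: "(u \<circ> int) summable_on UNIV" "(u \<circ> (\<lambda>n. - int n)) summable_on UNIV"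
    by (simp_all add: u_def o_def)
  have "u summable_on range int" "u summable_on range (\<lambda>n. - int n)"
    using s by (simp_all add: summable_on_reindex inj_on_def)
  then have "u summable_on (range int \<union> range (\<lambda>n. - int n))" by (rule summable_on_union)
  moreover have "range int \<union> range (\<lambda>n. - int n) = UNIV"
  proof -
    have "x \<in> range int \<union> range (\<lambda>n. - int n)" for x by (cases x rule: int_cases2) auto
    then show ?thesis by blast
  qed
  ultimately show ?thesis by (simp add: u_def)
qed

lemma period_lattice_eq_image: "period_lattice \<tau> = (\<lambda>(a, b). of_int a + of_int b * \<tau>) ` UNIV"
  by (auto simp: period_lattice_def)

text \<open>The modulus of \<open>a + b \<tau>\<close> is at least \<open>\<delta> M\<close> with
  \<open>M = max |a| |b|\<close>, and \<open>(1 + |a|) (1 + |b|) \<le> (2 M)\<^sup>2\<close>. The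
  cube is therefore bounded below by a multiple of \<open>((1 + |a|) (1 + |b|)) powr (3/2)\<close>:
  the exponent 3 is shared equally between two one-dimensional sums.\<close>

lemma period_lattice_summable:
  assumes t: "Im \<tau> > 0"
  shows "(\<lambda>\<omega>. 1 / norm \<omega> ^ 3) summable_on (period_lattice \<tau> - {0})"
proof -
  define h where "h = (\<lambda>(a, b). of_int a + of_int b * \<tau>)"
  define u where "u = (\<lambda>a::int. (1 + \<bar>real_of_int a\<bar>) powr (-3/2))"
  \<comment> \<open>The first entry comes from \<open>|Im (a + b \<tau>)| = |b| Im \<tau>\<close>,
    the second from \<open>|a| \<le> |a + b \<tau>| + |b| |\<tau>|\<close> with the first bound
    inserted for \<open>|b|\<close>.\<close>
  define \<delta> where "\<delta> = min (Im \<tau>) (1 / (1 + norm \<tau> / Im \<tau>))"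
  have den: "1 + norm \<tau> / Im \<tau> > 0" using t by (intro add_pos_nonneg) auto
  have \<delta>: "\<delta> > 0" using t den by (simp add: \<delta>_def)
  have inj: "inj h"
  proof (rule injI)
    fix x y assume "h x = h y"
    then have "Im (h x) = Im (h y)" "Re (h x) = Re (h y)" by simp_all
    then show "x = y" using t by (auto simp: h_def case_prod_unfold prod_eq_iff)
  qed
  have lower: "\<delta> * max \<bar>real_of_int a\<bar> \<bar>real_of_int b\<bar> \<le> norm (h (a, b))" for a b
  proof -
    have "\<bar>Im (h (a, b))\<bar> \<le> norm (h (a, b))" by (rule abs_Im_le_cmod)
    then have b: "Im \<tau> * \<bar>real_of_int b\<bar> \<le> norm (h (a, b))" using t by (simp add: h_def abs_mult mult.commute)
    have "\<bar>real_of_int a\<bar> = norm (h (a, b) - of_int b * \<tau>)" by (simp add: h_def)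
    also have "\<dots> \<le> norm (h (a, b)) + \<bar>real_of_int b\<bar> * norm \<tau>"
      using norm_triangle_ineq4[of "h (a, b)" "of_int b * \<tau>"] by (simp add: norm_mult)
    also have "\<bar>real_of_int b\<bar> \<le> norm (h (a, b)) / Im \<tau>" using b t by (simp add: field_simps)
    then have "norm (h (a, b)) + \<bar>real_of_int b\<bar> * norm \<tau> \<le> norm (h (a, b)) + norm (h (a, b)) / Im \<tau> * norm \<tau>"
      by (intro add_left_mono mult_right_mono) auto
    finally have "\<bar>real_of_int a\<bar> \<le> norm (h (a, b)) * (1 + norm \<tau> / Im \<tau>)" by (simp add: algebra_simps)
    then have a: "1 / (1 + norm \<tau> / Im \<tau>) * \<bar>real_of_int a\<bar> \<le> norm (h (a, b))"
      using den by (simp add: pos_divide_le_eq)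
    have "\<delta> * \<bar>real_of_int a\<bar> \<le> 1 / (1 + norm \<tau> / Im \<tau>) * \<bar>real_of_int a\<bar>" "\<delta> * \<bar>real_of_int b\<bar> \<le> Im \<tau> * \<bar>real_of_int b\<bar>"
      by (intro mult_right_mono; simp add: \<delta>_def)+
    then show ?thesis using a b by (auto simp: max_def)
  qed
  have bound: "1 / norm (h (a, b)) ^ 3 \<le> (2 / \<delta>) ^ 3 * (u a * u b)" if "(a, b) \<noteq> (0, 0)" for a b
  proof -
    define M where "M = max \<bar>real_of_int a\<bar> \<bar>real_of_int b\<bar>"
    have M1: "M \<ge> 1" using that unfolding M_def by (auto simp: le_max_iff_disj simp flip: of_int_abs)
    have dM: "0 < \<delta> * M" using \<delta> M1 by simp
    have "(1 + \<bar>real_of_int a\<bar>) * (1 + \<bar>real_of_int b\<bar>) \<le> (2 * M) * (2 * M)"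
      using M1 by (intro mult_mono) (auto simp: M_def)
    then have le: "((1 + \<bar>real_of_int a\<bar>) * (1 + \<bar>real_of_int b\<bar>)) powr (3/2) \<le> ((2 * M) * (2 * M)) powr (3/2)"
      by (intro powr_mono2) auto
    have "((2 * M) * (2 * M)) powr (3/2) = (2 * M) powr 3"
      using M1 by (simp add: powr_mult powr_add[symmetric])
    also have "\<dots> = (2 * M) ^ 3" using M1 powr_realpow[of "2 * M" 3] by simp
    finally have le: "((1 + \<bar>real_of_int a\<bar>) * (1 + \<bar>real_of_int b\<bar>)) powr (3/2) \<le> (2 * M) ^ 3" using le by simp
    have "(\<delta> * M) ^ 3 \<le> norm (h (a, b)) ^ 3"
      using lower[of a b] \<delta> M1 by (intro power_mono) (auto simp: M_def[symmetric])
    then have "1 / norm (h (a, b)) ^ 3 \<le> 1 / (\<delta> * M) ^ 3"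
      using dM less_le_trans[OF dM lower[of a b, folded M_def]]
      by (intro divide_left_mono mult_pos_pos zero_less_power) (use \<delta> M1 in auto)
    also have "\<dots> = (2 / \<delta>) ^ 3 * (1 / (2 * M) ^ 3)" using M1 \<delta> by (simp add: field_simps)
    also have "1 / (2 * M) ^ 3 \<le> 1 / ((1 + \<bar>real_of_int a\<bar>) * (1 + \<bar>real_of_int b\<bar>)) powr (3/2)"
      using le M1 by (intro divide_left_mono mult_pos_pos) auto
    also have "1 / ((1 + \<bar>real_of_int a\<bar>) * (1 + \<bar>real_of_int b\<bar>)) powr (3/2) = u a * u b"
      by (simp add: u_def powr_mult powr_minus_divide)
    finally show ?thesis using \<delta> by (simp add: mult_left_mono)
  qed
  have us: "u summable_on UNIV" unfolding u_def by (rule summable_on_int_powr)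
  have "(\<lambda>(a, b). u a * u b) summable_on (UNIV \<times> UNIV)"
  proof (rule summable_on_SigmaI)
    show "((\<lambda>b. case (a, b) of (a, b) \<Rightarrow> u a * u b) has_sum u a * infsum u UNIV) UNIV" for a
      using has_sum_cmult_right[OF has_sum_infsum[OF us], of "u a"] by simp
    show "(\<lambda>a. u a * infsum u UNIV) summable_on UNIV" by (intro summable_on_cmult_left us)
  qed (simp add: u_def)
  then have "(\<lambda>x. (2 / \<delta>) ^ 3 * (case x of (a, b) \<Rightarrow> u a * u b)) summable_on (UNIV - {(0, 0)})"
    by (intro summable_on_cmult_right) (rule summable_on_subset_banach, auto)
  then have "(\<lambda>x. 1 / norm (h x) ^ 3) summable_on (UNIV - {(0, 0)})"
    by (rule summable_on_comparison_test) (use bound in auto)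
  moreover have "h ` (UNIV - {(0, 0)}) = period_lattice \<tau> - {0}"
  proof -
    have "h ` (UNIV - {(0, 0)}) = h ` UNIV - h ` {(0, 0)}" using inj by (rule image_set_diff)
    then show ?thesis by (simp add: h_def period_lattice_eq_image)
  qed
  ultimately show ?thesis
    using summable_on_reindex[of h "UNIV - {(0, 0)}" "\<lambda>\<omega>. 1 / norm \<omega> ^ 3"] inj
    by (simp add: o_def inj_on_subset)
qed

section \<open>The zeta series and its derivatives\<close>

definition zeta_term :: "complex \<Rightarrow> complex \<Rightarrow> complex" where
  "zeta_term \<omega> z = 1 / (z - \<omega>) + 1 / \<omega> + z / \<omega>\<^sup>2"

text \<open>The pole at 0 is split off so that this part is holomorphic at 0 too, where it is
  compared with the regular part \<open>h\<close> of \<open>rho\<close>.\<close>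

definition zeta_part :: "complex \<Rightarrow> complex \<Rightarrow> complex" where
  "zeta_part \<tau> z = (\<Sum>\<^sub>\<infinity>\<omega>\<in>period_lattice \<tau> - {0}. zeta_term \<omega> z)"

lemma weierstrass_zeta_eq: "weierstrass_zeta z \<tau> = 1 / z + zeta_part \<tau> z"
  by (simp add: weierstrass_zeta_def zeta_part_def zeta_term_def)

lemma zeta_term_derivs:
  assumes "z \<noteq> \<omega>" "\<omega> \<noteq> 0"
  shows "deriv (zeta_term \<omega>) z = - (1 / (z - \<omega>)\<^sup>2 - 1 / \<omega>\<^sup>2)"
    and "(deriv ^^ 2) (zeta_term \<omega>) z = 2 / (z - \<omega>) ^ 3"
proof -
  have 1: "(zeta_term \<omega> has_field_derivative - (1 / (z - \<omega>)\<^sup>2 - 1 / \<omega>\<^sup>2)) (at z)" if "z \<noteq> \<omega>" for z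
    unfolding zeta_term_def using that assms(2)
    by (auto intro!: derivative_eq_intros simp: power2_eq_square)
  then show "deriv (zeta_term \<omega>) z = - (1 / (z - \<omega>)\<^sup>2 - 1 / \<omega>\<^sup>2)" using assms by (intro DERIV_imp_deriv)
  have "(deriv (zeta_term \<omega>) has_field_derivative 2 / (z - \<omega>) ^ 3) (at z)"
  proof (rule has_field_derivative_transform_within_open[of "\<lambda>z. - (1 / (z - \<omega>)\<^sup>2 - 1 / \<omega>\<^sup>2)" _ _ "- {\<omega>}"])
    show "((\<lambda>z. - (1 / (z - \<omega>)\<^sup>2 - 1 / \<omega>\<^sup>2)) has_field_derivative 2 / (z - \<omega>) ^ 3) (at z)"
    proof -
      have "((\<lambda>x. - (1 / x\<^sup>2 - 1 / \<omega>\<^sup>2)) has_field_derivative 2 / x ^ 3) (at x)" if "x \<noteq> 0" for x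
        using that assms by (auto intro!: derivative_eq_intros simp: power2_eq_square power3_eq_cube)
      from this[of "z - \<omega>"] assms
      have b: "((\<lambda>x. - (1 / x\<^sup>2 - 1 / \<omega>\<^sup>2)) has_field_derivative 2 / (z - \<omega>) ^ 3) (at (z - \<omega>))"
        by simp
      have s: "((\<lambda>z. z - \<omega>) has_field_derivative 1) (at z)" by (auto intro!: derivative_eq_intros)
      show ?thesis using DERIV_chain2[OF b s] by (simp only: mult_1_right)
    qed
  qed (use assms 1 in \<open>auto intro!: DERIV_imp_deriv[symmetric]\<close>)
  then show "(deriv ^^ 2) (zeta_term \<omega>) z = 2 / (z - \<omega>) ^ 3" by (simp add: numeral_2_eq_2 DERIV_imp_deriv)
qed

text \<open>The convergence terms give \<open>zeta_term \<omega> z = z\<^sup>2 / (\<omega>\<^sup>2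
  (z - \<omega>))\<close>, of order \<open>1 / |\<omega>|^3\<close> uniformly near
  \<open>z0\<close>. The hypothesis admits \<open>z0 = 0\<close>, where the value and the first
  derivative are needed.\<close>

lemma zeta_part_local:
  assumes t: "Im \<tau> > 0" and z0: "z0 \<notin> period_lattice \<tau> - {0}"
  obtains r where "r > 0" "zeta_part \<tau> holomorphic_on ball z0 r"
    "\<And>z. z \<in> ball z0 r \<Longrightarrow> z \<notin> period_lattice \<tau> - {0}"
    "\<And>m. ((\<lambda>\<omega>. (deriv ^^ m) (zeta_term \<omega>) z0) has_sum (deriv ^^ m) (zeta_part \<tau>) z0) (period_lattice \<tau> - {0})"
proof -
  obtain d where d: "d > 0" "\<And>w. w \<noteq> z0 \<Longrightarrow> dist w z0 < d \<Longrightarrow> w \<notin> period_lattice \<tau>"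
    using eventually_not_period_lattice[OF t, of 0 z0] unfolding eventually_at by auto
  define r where "r = d / 2"
  define R where "R = norm z0 + r"
  \<comment> \<open>Serves the bound \<open>|z - \<omega>| \<ge> \<kappa> |\<omega>|\<close> in two
    ranges: for \<open>|\<omega>| \<ge> 2 R\<close> the modulus of \<open>z\<close> is at most half
    that of \<open>\<omega>\<close>; otherwise \<open>|z - \<omega>| \<ge> r\<close> while
    \<open>|\<omega>| < 2 R\<close>.\<close>
  define \<kappa> where "\<kappa> = min (1/2) (r / (2 * R))"
  have r: "r > 0" "R > 0" using d by (auto simp: r_def R_def add_nonneg_pos)
  have \<kappa>: "\<kappa> > 0" using r by (simp add: \<kappa>_def)
  have far: "dist \<omega> z0 \<ge> 2 * r" if "\<omega> \<in> period_lattice \<tau> - {0}" for \<omega>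
    using d(2)[of \<omega>] that z0 by (force simp: r_def)
  have low: "norm (z - \<omega>) \<ge> \<kappa> * norm \<omega>" if w: "\<omega> \<in> period_lattice \<tau> - {0}" and z: "z \<in> ball z0 r" for \<omega> z
  proof (cases "norm \<omega> \<ge> 2 * R")
    case True
    have "norm z \<le> norm z0 + dist z0 z" by (metis dist_norm norm_minus_commute norm_triangle_sub)
    then have "norm z \<le> norm \<omega> / 2" using z True by (simp add: R_def)
    then have "norm (z - \<omega>) \<ge> norm \<omega> / 2" using norm_triangle_ineq2[of \<omega> z] by (simp add: norm_minus_commute)
    moreover have "\<kappa> * norm \<omega> \<le> 1/2 * norm \<omega>" by (intro mult_right_mono) (auto simp: \<kappa>_def)
    ultimately show ?thesis by simp
  next
    case False
    have "2 * r \<le> dist \<omega> z + dist z z0" using far[OF w] dist_triangle[of \<omega> z0 z] by linarith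
    then have "r \<le> norm (z - \<omega>)" using z by (simp add: dist_norm norm_minus_commute)
    moreover have "\<kappa> * norm \<omega> \<le> r / (2 * R) * (2 * R)"
      using False r by (intro mult_mono) (auto simp: \<kappa>_def)
    ultimately show ?thesis using r by simp
  qed
  have ne: "z \<noteq> \<omega>" if "\<omega> \<in> period_lattice \<tau> - {0}" "z \<in> ball z0 r" for \<omega> z
    using low[OF that] that mult_pos_pos[OF \<kappa>, of "norm \<omega>"] by auto
  have bound: "norm (zeta_term \<omega> z) \<le> R\<^sup>2 / \<kappa> * (1 / norm \<omega> ^ 3)"
    if w: "\<omega> \<in> period_lattice \<tau> - {0}" and z: "z \<in> ball z0 r" for \<omega> z
  proof -
    have w0: "\<omega> \<noteq> 0" using w by simp
    have "zeta_term \<omega> z = z\<^sup>2 / (\<omega>\<^sup>2 * (z - \<omega>))"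
      using ne[OF w z] w0 by (simp add: zeta_term_def power2_eq_square field_simps)
    then have "norm (zeta_term \<omega> z) = (norm z)\<^sup>2 / ((norm \<omega>)\<^sup>2 * norm (z - \<omega>))"
      by (simp add: norm_divide norm_mult norm_power)
    also have "\<dots> \<le> R\<^sup>2 / ((norm \<omega>)\<^sup>2 * (\<kappa> * norm \<omega>))"
    proof (rule frac_le)
      have "norm z \<le> norm z0 + dist z0 z" by (metis dist_norm norm_minus_commute norm_triangle_sub)
      then show "(norm z)\<^sup>2 \<le> R\<^sup>2" using z by (intro power_mono) (auto simp: R_def)
      show "(norm \<omega>)\<^sup>2 * (\<kappa> * norm \<omega>) \<le> (norm \<omega>)\<^sup>2 * norm (z - \<omega>)"
        by (intro mult_left_mono low w z) simp
    qed (use w0 \<kappa> in auto)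
    also have "\<dots> = R\<^sup>2 / \<kappa> * (1 / norm \<omega> ^ 3)" by (simp add: power2_eq_square power3_eq_cube)
    finally show ?thesis .
  qed
  have hol: "zeta_term \<omega> holomorphic_on ball z0 r" if "\<omega> \<in> period_lattice \<tau> - {0}" for \<omega>
    unfolding zeta_term_def[abs_def] using ne[OF that] that by (intro holomorphic_intros) auto
  have M: "(\<lambda>\<omega>. R\<^sup>2 / \<kappa> * (1 / norm \<omega> ^ 3)) summable_on (period_lattice \<tau> - {0})"
    by (intro summable_on_cmult_right period_lattice_summable t)
  show ?thesis
  proof (rule that[OF r(1)])
    show "zeta_part \<tau> holomorphic_on ball z0 r"
      unfolding zeta_part_def[abs_def] by (rule infsum_holomorphic(1)[OF open_ball hol bound M])
    show "((\<lambda>\<omega>. (deriv ^^ m) (zeta_term \<omega>) z0) has_sum (deriv ^^ m) (zeta_part \<tau>) z0) (period_lattice \<tau> - {0})" for m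
      unfolding zeta_part_def[abs_def] by (rule infsum_holomorphic(2)[OF open_ball hol bound M centre_in_ball[THEN iffD2, OF r(1)]])
  qed (use ne in auto)
qed

lemma zeta_part_sums:
  assumes t: "Im \<tau> > 0" and z: "z \<notin> period_lattice \<tau> - {0}"
  shows "((\<lambda>\<omega>. 1 / (z - \<omega>)\<^sup>2 - 1 / \<omega>\<^sup>2) has_sum - deriv (zeta_part \<tau>) z) (period_lattice \<tau> - {0})"
    and "((\<lambda>\<omega>. 2 / (z - \<omega>) ^ 3) has_sum (deriv ^^ 2) (zeta_part \<tau>) z) (period_lattice \<tau> - {0})"
    and "((\<lambda>\<omega>. zeta_term \<omega> z) has_sum zeta_part \<tau> z) (period_lattice \<tau> - {0})"
proof -
  obtain r where r: "\<And>m. ((\<lambda>\<omega>. (deriv ^^ m) (zeta_term \<omega>) z) has_sum (deriv ^^ m) (zeta_part \<tau>) z) (period_lattice \<tau> - {0})"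
    using zeta_part_local[OF t z] by metis
  have ne: "z \<noteq> \<omega>" if "\<omega> \<in> period_lattice \<tau> - {0}" for \<omega> using that z by auto
  have "((\<lambda>\<omega>. - (1 / (z - \<omega>)\<^sup>2 - 1 / \<omega>\<^sup>2)) has_sum deriv (zeta_part \<tau>) z) (period_lattice \<tau> - {0})"
    using r[of 1] by (subst has_sum_cong[of _ _ "\<lambda>\<omega>. deriv (zeta_term \<omega>) z"]) (auto simp: zeta_term_derivs(1) ne)
  from has_sum_uminus[THEN iffD1, OF this]
  show "((\<lambda>\<omega>. 1 / (z - \<omega>)\<^sup>2 - 1 / \<omega>\<^sup>2) has_sum - deriv (zeta_part \<tau>) z) (period_lattice \<tau> - {0})" by simp
  show "((\<lambda>\<omega>. 2 / (z - \<omega>) ^ 3) has_sum (deriv ^^ 2) (zeta_part \<tau>) z) (period_lattice \<tau> - {0})"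
    using r[of 2] by (subst has_sum_cong[of _ _ "\<lambda>\<omega>. (deriv ^^ 2) (zeta_term \<omega>) z"]) (auto simp: zeta_term_derivs(2) ne)
  show "((\<lambda>\<omega>. zeta_term \<omega> z) has_sum zeta_part \<tau> z) (period_lattice \<tau> - {0})"
    using r[of 0] by simp
qed

lemma weierstrass_p_eq:
  assumes t: "Im \<tau> > 0" and z: "z \<notin> period_lattice \<tau>"
  shows "weierstrass_p z \<tau> = 1 / z\<^sup>2 - deriv (zeta_part \<tau>) z"
  using infsumI[OF zeta_part_sums(1)[OF t, of z]] z by (simp add: weierstrass_p_def)

lemma zeta_part_at_0:
  assumes t: "Im \<tau> > 0"
  shows "zeta_part \<tau> 0 = 0" "deriv (zeta_part \<tau>) 0 = 0"
proof -
  have "((\<lambda>\<omega>. 0) has_sum zeta_part \<tau> 0) (period_lattice \<tau> - {0})"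
    using zeta_part_sums(3)[OF t, of 0] by (simp add: zeta_term_def)
  then show "zeta_part \<tau> 0 = 0" using has_sum_0 infsumI by (metis infsum_0)
  have "((\<lambda>\<omega>. 0) has_sum - deriv (zeta_part \<tau>) 0) (period_lattice \<tau> - {0})"
    using zeta_part_sums(1)[OF t, of 0] by simp
  then show "deriv (zeta_part \<tau>) 0 = 0" using infsumI by (metis infsum_0 neg_equal_0_iff_equal)
qed

text \<open>Two derivatives remove the convergence terms, and \<open>2 / z^3\<close> is the summand
  for \<open>\<omega> = 0\<close>. The series thus runs over the full lattice, and its periodicity
  and oddness become mere reindexings.\<close>

lemma cube_sum:
  assumes t: "Im \<tau> > 0" and z: "z \<notin> period_lattice \<tau>"
  shows "((\<lambda>\<omega>. 2 / (z - \<omega>) ^ 3) has_sum 2 / z ^ 3 + (deriv ^^ 2) (zeta_part \<tau>) z) (period_lattice \<tau>)"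
proof -
  have "insert 0 (period_lattice \<tau> - {0}) = period_lattice \<tau>" by auto
  then show ?thesis
    using has_sum_insert[of 0 "period_lattice \<tau> - {0}", OF _ zeta_part_sums(2)[OF t, of z]] z by simp
qed

lemma analytic_zeta_part:
  assumes t: "Im \<tau> > 0"
  shows "zeta_part \<tau> analytic_on - (period_lattice \<tau> - {0})"
  unfolding analytic_on_def
proof
  fix z assume "z \<in> - (period_lattice \<tau> - {0})"
  then obtain r where "r > 0" "zeta_part \<tau> holomorphic_on ball z r"
    using zeta_part_local[OF t, of z] by (metis ComplD)
  then show "\<exists>r>0. zeta_part \<tau> holomorphic_on ball z r" by blast
qed

lemma connected_compl_period_lattice: "connected (- period_lattice \<tau>)"
proof -
  have "countable (period_lattice \<tau>)" unfolding period_lattice_eq_image by (intro countable_image) simp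
  then show ?thesis
    by (intro path_connected_imp_connected path_connected_complement_countable) simp_all
qed

section \<open>Identification of the Weierstrass functions with \<open>rho\<close>\<close>

lemma higher_deriv_2_inverse:
  assumes "z \<noteq> (0::complex)"
  shows "(deriv ^^ 2) (\<lambda>z. 1 / z) z = 2 / z ^ 3"
proof -
  have 1: "((\<lambda>z. 1 / z) has_field_derivative - (1 / z\<^sup>2)) (at z)" if "z \<noteq> 0" for z :: complex
    using that by (auto intro!: derivative_eq_intros simp: power2_eq_square)
  have "((\<lambda>z. - (1 / z\<^sup>2)) has_field_derivative 2 / z ^ 3) (at z)"
    using assms by (auto intro!: derivative_eq_intros simp: power2_eq_square power3_eq_cube)
  then have "(deriv (\<lambda>z. 1 / z) has_field_derivative 2 / z ^ 3) (at z)"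
    by (rule has_field_derivative_transform_within_open[of _ _ _ "- {0}"])
       (use assms 1 in \<open>auto intro!: DERIV_imp_deriv[symmetric]\<close>)
  then show ?thesis by (simp add: numeral_2_eq_2 DERIV_imp_deriv)
qed

text \<open>\<open>D\<close> is the difference of \<open>rho\<close> and the zeta series. Its second
  derivative is elliptic with removable singularities, hence constant, and odd, hence 0. So
  \<open>D\<close> is affine, with coefficients \<open>h(0) = 0\<close> and
  \<open>h'(0) = \<gamma>\<close> read off at 0. Starting from \<open>D''\<close> means that the
  quasi-periods of zeta need not be known: the sum of cubes is periodic by reindexing.\<close>

lemma weierstrass_zeta_p_rho:
  assumes t: "Im \<tau> > 0"
  defines "D \<equiv> (\<lambda>z. rho \<tau> z - (1 / z + zeta_part \<tau> z))"
  defines "\<gamma> \<equiv> 4 * of_real pi * \<i> * g1 \<tau>"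
  assumes z: "z \<notin> period_lattice \<tau>"
  shows "D z = \<gamma> * z" "deriv D z = \<gamma>"
proof -
  define U where "U = - period_lattice \<tau>"
  have U: "open U" "connected U"
    using open_compl_period_lattice[OF t] connected_compl_period_lattice by (simp_all add: U_def)
  have nz: "z \<noteq> 0" if "z \<in> U" for z using that by (auto simp: U_def)
  have hr: "rho \<tau> holomorphic_on U" unfolding U_def by (rule holomorphic_rho[OF t order_refl])
  have hF: "zeta_part \<tau> holomorphic_on U"
    by (rule holomorphic_on_subset[OF analytic_imp_holomorphic[OF analytic_zeta_part[OF t]]]) (auto simp: U_def)
  have hi: "(\<lambda>z. 1 / z) holomorphic_on U" by (intro holomorphic_intros) (auto dest: nz)
  have hD: "D holomorphic_on U" unfolding D_def by (intro holomorphic_on_diff holomorphic_on_add hr hF hi)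
  define K where "K = (\<lambda>z. \<Sum>\<^sub>\<infinity>\<omega>\<in>period_lattice \<tau>. 2 / (z - \<omega>) ^ 3)"
  have K: "K z = 2 / z ^ 3 + (deriv ^^ 2) (zeta_part \<tau>) z" if "z \<in> U" for z
    unfolding K_def using cube_sum[OF t, of z] that by (intro infsumI) (simp add: U_def)
  have D2: "(deriv ^^ 2) D z = (deriv ^^ 2) (rho \<tau>) z - K z" if zU: "z \<in> U" for z
  proof -
    have "(deriv ^^ 2) D z = (deriv ^^ 2) (rho \<tau>) z - (deriv ^^ 2) (\<lambda>z. 1 / z + zeta_part \<tau> z) z"
      unfolding D_def by (rule higher_deriv_diff[OF hr _ U(1) zU]) (intro holomorphic_on_add hi hF)
    also have "(deriv ^^ 2) (\<lambda>z. 1 / z + zeta_part \<tau> z) z = K z"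
      unfolding K[OF zU] higher_deriv_add[OF hi hF U(1) zU] higher_deriv_2_inverse[OF nz[OF zU]] ..
    finally show ?thesis .
  qed
  have Kper: "K (z + \<omega>) = K z" if w: "\<omega> \<in> period_lattice \<tau>" for z \<omega>
  proof -
    have m: "x + - \<omega> \<in> period_lattice \<tau>" if "x \<in> period_lattice \<tau>" for x
      by (rule period_lattice_add) (use that w in auto)
    show ?thesis unfolding K_def
      by (rule infsum_reindex_bij_witness[of _ "\<lambda>x. x + \<omega>" "\<lambda>x. x - \<omega>"])
         (use m w in \<open>auto intro: period_lattice_add simp: algebra_simps\<close>)
  qed
  have Kodd: "K (- z) = - K z" for z
  proof -
    have "K (- z) = (\<Sum>\<^sub>\<infinity>\<omega>\<in>period_lattice \<tau>. - (2 / (z - \<omega>) ^ 3))"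
      unfolding K_def
    proof (rule infsum_reindex_bij_witness[of _ uminus uminus])
      show "- (2 / (z - - a) ^ 3) = 2 / (- z - a) ^ 3" for a
      proof -
        have "(- z - a) ^ 3 = - ((z + a) ^ 3)" by (simp add: power3_eq_cube algebra_simps)
        then show ?thesis by (simp only: diff_minus_eq_add divide_minus_right)
      qed
    qed auto
    then show ?thesis by (simp add: K_def infsum_uminus)
  qed
  have rodd: "(deriv ^^ 2) (rho \<tau>) (- z) = - (deriv ^^ 2) (rho \<tau>) z" if zU: "z \<in> U" for z
  proof -
    have "(uminus has_field_derivative -1) (at z)" by (auto intro!: derivative_eq_intros)
    moreover have "(deriv (rho \<tau>) has_field_derivative (deriv ^^ 2) (rho \<tau>) (- z)) (at (- z))"
      using has_field_derivative_higher_deriv_rho[OF t, of "- z" 1] zU by (simp add: U_def numeral_2_eq_2)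
    ultimately have "((\<lambda>z. deriv (rho \<tau>) (- z)) has_field_derivative - (deriv ^^ 2) (rho \<tau>) (- z)) (at z)"
      using DERIV_chain2[of "deriv (rho \<tau>)" "(deriv ^^ 2) (rho \<tau>) (- z)" uminus z "-1" UNIV] by simp
    then have "(deriv (rho \<tau>) has_field_derivative - (deriv ^^ 2) (rho \<tau>) (- z)) (at z)"
      by (rule has_field_derivative_transform_within_open[OF _ U(1) zU])
         (simp add: deriv_rho_minus[OF t] U_def)
    then have "deriv (deriv (rho \<tau>)) z = - (deriv ^^ 2) (rho \<tau>) (- z)" by (rule DERIV_imp_deriv)
    then show ?thesis by (simp add: numeral_2_eq_2)
  qed
  obtain r0 h where r0: "r0 > 0" and h: "h holomorphic_on ball 0 r0" "h 0 = 0" "deriv h 0 = \<gamma>"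
    and rh: "\<And>z. z \<in> ball 0 r0 - {0} \<Longrightarrow> z \<notin> period_lattice \<tau> \<and> rho \<tau> z = 1 / z + h z"
    using rho_expansion_0[OF t] unfolding \<gamma>_def by metis
  obtain r1 where r1: "r1 > 0" "zeta_part \<tau> holomorphic_on ball 0 r1"
    using zeta_part_local[OF t, of 0] by (metis Diff_iff singletonI)
  define r where "r = min r0 r1"
  have r: "r > 0" using r0 r1 by (simp add: r_def)
  \<comment> \<open>\<open>E\<close> continues \<open>D\<close> holomorphically across 0: the poles
    \<open>1 / z\<close> of \<open>rho\<close> and of zeta have cancelled.\<close>
  define E where "E = (\<lambda>z. h z - zeta_part \<tau> z)"
  have hhr: "h holomorphic_on ball 0 r" "zeta_part \<tau> holomorphic_on ball 0 r"
    by (rule holomorphic_on_subset[OF h(1)] holomorphic_on_subset[OF r1(2)]; force simp: r_def)+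
  have hE: "E holomorphic_on ball 0 r" unfolding E_def by (intro holomorphic_on_diff hhr)
  have DE: "(deriv ^^ m) D z = (deriv ^^ m) E z" if "z \<in> ball 0 r - {0}" for m z
  proof (rule higher_deriv_transform_within_open[OF _ _ _ that])
    show "D holomorphic_on ball 0 r - {0}"
      by (rule holomorphic_on_subset[OF hD]) (use rh in \<open>auto simp: U_def r_def\<close>)
    show "E holomorphic_on ball 0 r - {0}" by (rule holomorphic_on_subset[OF hE]) auto
    show "D w = E w" if "w \<in> ball 0 r - {0}" for w
      using rh[of w] that by (simp add: D_def E_def r_def)
  qed (simp add: open_Diff)
  have evb: "\<forall>\<^sub>F z in at 0. z \<in> ball 0 r - {0}" using r by (intro eventually_at_in_open) auto
  have lim: "((deriv ^^ m) D \<longlongrightarrow> (deriv ^^ m) E 0) (at 0)" for m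
  proof -
    have "isCont ((deriv ^^ m) E) 0"
      using holomorphic_on_imp_continuous_on[OF holomorphic_higher_deriv[OF hE open_ball]] r
      by (simp add: continuous_on_eq_continuous_at)
    then have "((deriv ^^ m) E \<longlongrightarrow> (deriv ^^ m) E 0) (at 0)" by (simp add: isCont_def)
    moreover have "\<forall>\<^sub>F z in at 0. (deriv ^^ m) E z = (deriv ^^ m) D z"
      using evb by eventually_elim (simp add: DE)
    ultimately show ?thesis by (rule Lim_transform_eventually)
  qed
  have E0: "E 0 = 0" "deriv E 0 = \<gamma>"
  proof -
    show "E 0 = 0" by (simp add: E_def h zeta_part_at_0[OF t])
    have "deriv E 0 = deriv h 0 - deriv (zeta_part \<tau>) 0"
      unfolding E_def using higher_deriv_diff[OF hhr open_ball, of 0 1] r by simp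
    then show "deriv E 0 = \<gamma>" by (simp add: h zeta_part_at_0[OF t])
  qed
  have evU: "\<forall>\<^sub>F z in at 0. z \<in> U"
    using eventually_not_period_lattice[OF t, of 0 0] by (simp add: U_def)
  have const_lim: "c = l" if "(f \<longlongrightarrow> l) (at 0)" "\<And>z. z \<in> U \<Longrightarrow> f z = c" for f :: "complex \<Rightarrow> complex" and c l
  proof -
    have "\<forall>\<^sub>F z in at 0. f z = c" using evU by eventually_elim (rule that(2))
    from Lim_transform_eventually[OF that(1) this] show ?thesis
      using tendsto_unique[OF at_neq_bot tendsto_const] by blast
  qed
  obtain c where c: "\<And>z. z \<notin> period_lattice \<tau> \<Longrightarrow> (deriv ^^ 2) D z = c"
  proof (rule elliptic_constant[OF t, of "(deriv ^^ 2) D" "period_lattice \<tau>"])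
    show "(deriv ^^ 2) D holomorphic_on - period_lattice \<tau>"
      using holomorphic_higher_deriv[OF hD U(1)] by (simp add: U_def)
    show "open (- period_lattice \<tau>)" by (rule open_compl_period_lattice[OF t])
    show "\<forall>\<^sub>F w in at z. w \<notin> period_lattice \<tau>" for z
      using eventually_not_period_lattice[OF t, of 0 z] by simp
    show "z + \<omega> \<in> period_lattice \<tau> \<longleftrightarrow> z \<in> period_lattice \<tau>" if "\<omega> \<in> period_lattice \<tau>" for z \<omega>
      by (rule period_lattice_add_iff[OF that])
    show "(deriv ^^ 2) D (z + \<omega>) = (deriv ^^ 2) D z" if "\<omega> \<in> period_lattice \<tau>" "z \<notin> period_lattice \<tau>" for z \<omega>
      using D2[of z] D2[of "z + \<omega>"] Kper[OF that(1), of z] that period_lattice_add_iff[OF that(1), of z]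
        higher_deriv_rho_add_period[OF t that, of 2] by (simp add: U_def)
    show "\<exists>\<omega>\<in>period_lattice \<tau>. \<exists>c. ((deriv ^^ 2) D \<longlongrightarrow> c) (at (z + \<omega>))" if "z \<in> period_lattice \<tau>" for z
      using lim[of 2] that by (intro bexI[of _ "- z"]) auto
  qed (use that in auto)
  have c0: "c = 0"
  proof -
    have "(deriv ^^ 2) D z = c" "(deriv ^^ 2) D (- z) = c" using c z by auto
    moreover have "(deriv ^^ 2) D (- z) = - (deriv ^^ 2) D z"
      using D2[of z] D2[of "- z"] Kodd[of z] rodd[of z] z by (simp add: U_def)
    ultimately show ?thesis by simp
  qed
  have dD: "(D has_field_derivative deriv D z) (at z)" "(deriv D has_field_derivative 0) (at z)" if "z \<in> U" for z
    using has_field_derivative_higher_deriv[OF hD U(1) that, of 0]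
      has_field_derivative_higher_deriv[OF hD U(1) that, of 1] c[of z] c0 that
    by (simp_all add: U_def numeral_2_eq_2)
  have "deriv D constant_on U" by (rule has_field_derivative_0_imp_constant_on[OF dD(2) U(2,1)])
  then obtain c1 where c1: "\<And>z. z \<in> U \<Longrightarrow> deriv D z = c1" by (auto simp: constant_on_def)
  have "c1 = \<gamma>" using const_lim[of "deriv D" "deriv E 0" c1] lim[of 1] c1 E0 by simp
  with c1 have d1: "deriv D z = \<gamma>" if "z \<in> U" for z using that by simp
  then show "deriv D z = \<gamma>" using z by (simp add: U_def)
  have "(\<lambda>z. D z - \<gamma> * z) constant_on U"
  proof (rule has_field_derivative_0_imp_constant_on[OF _ U(2,1)])
    show "((\<lambda>z. D z - \<gamma> * z) has_field_derivative 0) (at z)" if "z \<in> U" for z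
      using dD(1)[OF that] d1[OF that] by (auto intro!: derivative_eq_intros)
  qed
  then obtain c2 where c2: "\<And>z. z \<in> U \<Longrightarrow> D z - \<gamma> * z = c2" by (auto simp: constant_on_def)
  have "((\<lambda>z. D z - \<gamma> * z) \<longlongrightarrow> E 0 - \<gamma> * 0) (at 0)" using lim[of 0] by (intro tendsto_intros) simp
  then have "c2 = 0" using const_lim c2 E0 by fastforce
  then show "D z = \<gamma> * z" using c2[of z] z by (simp add: U_def)
qed

theorem weierstrass_zeta_rho:
  assumes t: "Im \<tau> > 0" and z: "z \<notin> period_lattice \<tau>"
  shows "weierstrass_zeta z \<tau> = rho \<tau> z - 4 * of_real pi * \<i> * g1 \<tau> * z"
  using weierstrass_zeta_p_rho(1)[OF t z] by (simp add: weierstrass_zeta_eq algebra_simps)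

theorem weierstrass_p_rho:
  assumes t: "Im \<tau> > 0" and z: "z \<notin> period_lattice \<tau>"
  shows "weierstrass_p z \<tau> = 4 * of_real pi * \<i> * g1 \<tau> - deriv (rho \<tau>) z"
proof -
  have z0: "z \<noteq> 0" using z by auto
  have "zeta_part \<tau> analytic_on {z}"
    by (rule analytic_on_subset[OF analytic_zeta_part[OF t]]) (use z in auto)
  then have "(zeta_part \<tau> has_field_derivative deriv (zeta_part \<tau>) z) (at z)"
    using analytic_on_imp_differentiable_at DERIV_deriv_iff_field_differentiable by blast
  then have "((\<lambda>z. rho \<tau> z - (1 / z + zeta_part \<tau> z)) has_field_derivative
      deriv (rho \<tau>) z - (- (1 / z\<^sup>2) + deriv (zeta_part \<tau>) z)) (at z)"
    using has_field_derivative_rho[OF t z] z0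
    by (auto intro!: derivative_eq_intros simp: power2_eq_square)
  from DERIV_imp_deriv[OF this] weierstrass_zeta_p_rho(2)[OF t z]
  show ?thesis by (simp add: weierstrass_p_eq[OF t z] algebra_simps)
qed

section \<open>The superpotential\<close>

abbreviation \<gamma>\<^sub>1 :: "complex \<Rightarrow> complex" where
  "\<gamma>\<^sub>1 \<tau> \<equiv> 4 * of_real pi * \<i> * g1 \<tau>"

text \<open>The functions multiplying \<open>\<phi>\<^sub>k\<close> in the defining identity, expressed by \<open>rho\<close>.\<close>

definition phi_basis :: "complex \<Rightarrow> complex \<Rightarrow> nat \<Rightarrow> complex \<Rightarrow> complex" where
  "phi_basis \<tau> c k z =
     (if k = 0 then 1
      else if k = 1 then rho \<tau> z - rho \<tau> (z + c) + rho \<tau> c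
      else (-1) ^ (k - 1) / fact (k - 1) * (deriv ^^ (k - 1)) (rho \<tau>) z + (if k = 2 then \<gamma>\<^sub>1 \<tau> else 0))"

lemma higher_deriv_weierstrass_p:
  assumes t: "Im \<tau> > 0" and z: "z \<notin> period_lattice \<tau>"
  shows "(deriv ^^ m) (\<lambda>x. weierstrass_p x \<tau>) z = (if m = 0 then \<gamma>\<^sub>1 \<tau> else 0) - (deriv ^^ Suc m) (rho \<tau>) z"
proof -
  have op: "open (- period_lattice \<tau>)" by (rule open_compl_period_lattice[OF t])
  have hd: "deriv (rho \<tau>) holomorphic_on - period_lattice \<tau>"
    by (intro holomorphic_deriv holomorphic_rho t op order_refl)
  have h2: "(\<lambda>x. \<gamma>\<^sub>1 \<tau> - deriv (rho \<tau>) x) holomorphic_on - period_lattice \<tau>"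
    by (intro holomorphic_on_diff holomorphic_on_const hd)
  have h1: "(\<lambda>x. weierstrass_p x \<tau>) holomorphic_on - period_lattice \<tau>"
    by (rule holomorphic_transform[OF h2]) (simp add: weierstrass_p_rho[OF t])
  have "(deriv ^^ m) (\<lambda>x. weierstrass_p x \<tau>) z = (deriv ^^ m) (\<lambda>x. \<gamma>\<^sub>1 \<tau> - deriv (rho \<tau>) x) z"
    by (rule higher_deriv_transform_within_open[OF h1 h2 op]) (use z weierstrass_p_rho[OF t] in auto)
  also have "\<dots> = (deriv ^^ m) (\<lambda>x. \<gamma>\<^sub>1 \<tau>) z - (deriv ^^ m) (deriv (rho \<tau>)) z"
    by (rule higher_deriv_diff[OF holomorphic_on_const hd op]) (use z in simp)
  also have "(deriv ^^ m) (\<lambda>x. \<gamma>\<^sub>1 \<tau>) z = (if m = 0 then \<gamma>\<^sub>1 \<tau> else 0)" by (simp add: higher_deriv_const)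
  finally show ?thesis by (simp only: funpow_Suc_right o_apply)
qed

text \<open>The linear terms that separate zeta from \<open>rho\<close> cancel in
  \<open>\<zeta>(z) - \<zeta>(z + c) + \<zeta>(c)\<close>, so g1 survives only in the basis function
  of index 2.\<close>

lemma superpotential_expansion:
  fixes \<phi> :: "nat \<Rightarrow> ('n::finite) point \<Rightarrow> complex"
  assumes phi: "defines_phi \<phi>" and p: "p \<in> Omega_reg"
  defines "c \<equiv> (of_nat CARD('n) + 1) * w_of p"
  assumes z: "z \<notin> period_lattice (tau_of p)" "z + c \<notin> period_lattice (tau_of p)"
  shows "superpotential p z = (\<Sum>k\<le>CARD('n). \<phi> k p * phi_basis (tau_of p) c k z)"
proof -
  define n where "n = CARD('n)"
  define \<tau> where "\<tau> = tau_of p"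
  have n: "n \<ge> 1" unfolding n_def by (simp add: Suc_leI)
  have t: "Im \<tau> > 0" and c: "c \<notin> period_lattice \<tau>" using p by (auto simp: Omega_reg_def \<tau>_def c_def)
  note z = z[folded \<tau>_def]
  have sum: "(\<Sum>k=2..n. (-1) ^ k / fact (k - 1) * \<phi> k p * (deriv ^^ (k - 2)) (\<lambda>x. weierstrass_p x \<tau>) z)
      = (\<Sum>k=2..n. \<phi> k p * phi_basis \<tau> c k z)"
  proof (intro sum.cong refl)
    fix k assume "k \<in> {2..n}"
    then obtain j where j: "k = j + 2" by (metis add.commute atLeastAtMost_iff le_Suc_ex)
    show "(-1) ^ k / fact (k - 1) * \<phi> k p * (deriv ^^ (k - 2)) (\<lambda>x. weierstrass_p x \<tau>) z = \<phi> k p * phi_basis \<tau> c k z"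
      unfolding j add_diff_cancel_right' higher_deriv_weierstrass_p[OF t z(1)] phi_basis_def
      by (cases "j = 0") (simp_all add: algebra_simps)
  qed
  have "superpotential p z = (\<Sum>k=2..n. (-1) ^ k / fact (k - 1) * \<phi> k p * (deriv ^^ (k - 2)) (\<lambda>x. weierstrass_p x \<tau>) z)
       + \<phi> 1 p * (weierstrass_zeta z \<tau> - weierstrass_zeta (z + c) \<tau> + weierstrass_zeta c \<tau>) + \<phi> 0 p"
    using phi p z unfolding defines_phi_def Let_def \<tau>_def c_def n_def by blast
  also have "weierstrass_zeta z \<tau> - weierstrass_zeta (z + c) \<tau> + weierstrass_zeta c \<tau> = phi_basis \<tau> c 1 z"
    using z c by (simp add: weierstrass_zeta_rho[OF t] phi_basis_def algebra_simps)
  also have "\<phi> 0 p = \<phi> 0 p * phi_basis \<tau> c 0 z" by (simp add: phi_basis_def)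
  also have "(\<Sum>k=2..n. (-1) ^ k / fact (k - 1) * \<phi> k p * (deriv ^^ (k - 2)) (\<lambda>x. weierstrass_p x \<tau>) z)
      + \<phi> 1 p * phi_basis \<tau> c 1 z + \<phi> 0 p * phi_basis \<tau> c 0 z = (\<Sum>k\<in>{0,1} \<union> {2..n}. \<phi> k p * phi_basis \<tau> c k z)"
    unfolding sum by (subst sum.union_disjoint) auto
  also have "{0,1} \<union> {2..n} = {..n}" using n by auto
  finally show ?thesis by (simp add: n_def \<tau>_def)
qed

lemma higher_deriv_inverse_complex:
  "z \<noteq> (0::complex) \<Longrightarrow> (deriv ^^ m) (\<lambda>z. 1 / z) z = (-1) ^ m * fact m / z ^ Suc m"
proof (induction m arbitrary: z)
  case (Suc m)
  have "((deriv ^^ m) (\<lambda>z. 1 / z) has_field_derivative (-1) ^ Suc m * fact (Suc m) / z ^ Suc (Suc m)) (at z)"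
  proof (rule has_field_derivative_transform_within_open[of "\<lambda>z. (-1) ^ m * fact m / z ^ Suc m" _ _ "- {0}"])
    have "((\<lambda>z. (-1) ^ m * fact m / z ^ Suc m) has_field_derivative
        (0 * z ^ Suc m - (-1) ^ m * fact m * (of_nat (Suc m) * z ^ m)) / (z ^ Suc m * z ^ Suc m)) (at z)"
    proof (intro DERIV_divide DERIV_const)
      show "((\<lambda>z. z ^ Suc m) has_field_derivative of_nat (Suc m) * z ^ m) (at z)"
        by (rule derivative_eq_intros refl)+ simp
    qed (use Suc.prems in simp)
    also have "(0 * z ^ Suc m - (-1) ^ m * fact m * (of_nat (Suc m) * z ^ m)) / (z ^ Suc m * z ^ Suc m)
        = (-1) ^ Suc m * fact (Suc m) / z ^ Suc (Suc m)"
      using Suc.prems by (simp add: field_simps)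
    finally show "((\<lambda>z. (-1) ^ m * fact m / z ^ Suc m) has_field_derivative
        (-1) ^ Suc m * fact (Suc m) / z ^ Suc (Suc m)) (at z)" .
  qed (use Suc in auto)
  then show ?case by (simp add: DERIV_imp_deriv)
qed simp

lemma higher_deriv_rho_pole:
  assumes t: "Im \<tau> > 0"
  shows "((\<lambda>z. z ^ Suc m * (deriv ^^ m) (rho \<tau>) z) \<longlongrightarrow> (-1) ^ m * fact m) (at 0)"
proof -
  obtain r h where r: "r > 0" and h: "h holomorphic_on ball 0 r"
    and rh: "\<And>z. z \<in> ball 0 r - {0} \<Longrightarrow> z \<notin> period_lattice \<tau> \<and> rho \<tau> z = 1 / z + h z"
    using rho_expansion_0[OF t] by metis
  have op: "open (ball 0 r - {0::complex})" by (simp add: open_Diff)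
  have h1: "(\<lambda>z. 1 / z) holomorphic_on ball 0 r - {0}" by (intro holomorphic_intros) auto
  have h2: "h holomorphic_on ball 0 r - {0}" by (rule holomorphic_on_subset[OF h]) auto
  have e: "(deriv ^^ m) (rho \<tau>) z = (-1) ^ m * fact m / z ^ Suc m + (deriv ^^ m) h z" if z: "z \<in> ball 0 r - {0}" for z
  proof -
    have "(deriv ^^ m) (rho \<tau>) z = (deriv ^^ m) (\<lambda>z. 1 / z + h z) z"
      by (rule higher_deriv_transform_within_open[OF _ holomorphic_on_add[OF h1 h2] op z])
         (use rh in \<open>auto intro!: holomorphic_rho t\<close>)
    also have "\<dots> = (deriv ^^ m) (\<lambda>z. 1 / z) z + (deriv ^^ m) h z" by (rule higher_deriv_add[OF h1 h2 op z])
    also have "(deriv ^^ m) (\<lambda>z. 1 / z) z = (-1) ^ m * fact m / z ^ Suc m"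
      by (rule higher_deriv_inverse_complex) (use z in simp)
    finally show ?thesis .
  qed
  have "isCont ((deriv ^^ m) h) 0"
    using holomorphic_on_imp_continuous_on[OF holomorphic_higher_deriv[OF h open_ball]] r
    by (simp add: continuous_on_eq_continuous_at)
  then have "((\<lambda>z. (-1) ^ m * fact m + z ^ Suc m * (deriv ^^ m) h z) \<longlongrightarrow>
      (-1) ^ m * fact m + 0 ^ Suc m * (deriv ^^ m) h 0) (at 0)"
    unfolding isCont_def by (intro tendsto_intros)
  moreover have "\<forall>\<^sub>F z in at 0. (-1) ^ m * fact m + z ^ Suc m * (deriv ^^ m) h z = z ^ Suc m * (deriv ^^ m) (rho \<tau>) z"
  proof -
    have "\<forall>\<^sub>F z in at 0. z \<in> ball 0 r - {0}" using r by (intro eventually_at_in_open) auto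
    then show ?thesis
    proof eventually_elim
      case (elim z)
      then show ?case unfolding e[OF elim] by (simp add: distrib_left)
    qed
  qed
  ultimately have "((\<lambda>z. z ^ Suc m * (deriv ^^ m) (rho \<tau>) z) \<longlongrightarrow>
      (-1) ^ m * fact m + 0 ^ Suc m * (deriv ^^ m) h 0) (at 0)" by (rule Lim_transform_eventually)
  then show ?thesis by simp
qed

lemma rho_shift_tendsto:
  assumes t: "Im \<tau> > 0" and c: "c \<notin> period_lattice \<tau>"
  shows "((\<lambda>z. rho \<tau> (z + c)) \<longlongrightarrow> rho \<tau> c) (at 0)"
proof -
  have "isCont (rho \<tau>) (0 + c)" using DERIV_isCont[OF has_field_derivative_rho[OF t c]] by simp
  then have "isCont (\<lambda>z. rho \<tau> (z + c)) 0"
    using isCont_o2[where f = "\<lambda>z. z + c" and a = 0 and g = "rho \<tau>"] by simp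
  then show ?thesis by (simp add: isCont_def)
qed

text \<open>The factors \<open>(-1)^k / (k - 1)!\<close> of the defining identity are what
  normalises the leading term to \<open>z^(-k)\<close>. At index 1 only \<open>\<rho>(z)\<close> is
  singular at 0, because \<open>c\<close> is not a period.\<close>

lemma phi_basis_pole:
  assumes t: "Im \<tau> > 0" and c: "c \<notin> period_lattice \<tau>"
  shows "((\<lambda>z. z ^ k * phi_basis \<tau> c k z) \<longlongrightarrow> 1) (at 0)"
proof -
  consider "k = 0" | "k = 1" | j where "k = Suc (Suc j)" by (metis One_nat_def not0_implies_Suc)
  then show ?thesis
  proof cases
    case 1 then show ?thesis by (simp add: phi_basis_def)
  next
    case 2
    have "((\<lambda>z. z ^ Suc 0 * (deriv ^^ 0) (rho \<tau>) z + z * (rho \<tau> c - rho \<tau> (z + c))) \<longlongrightarrow>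
        (-1) ^ 0 * fact 0 + 0 * (rho \<tau> c - rho \<tau> c)) (at 0)"
      by (intro tendsto_intros higher_deriv_rho_pole[OF t] rho_shift_tendsto[OF t c])
    then show ?thesis using 2 by (simp add: phi_basis_def algebra_simps)
  next
    case (3 j)
    let ?a = "(-1) ^ Suc j / fact (Suc j) :: complex"
    let ?b = "if Suc (Suc j) = 2 then \<gamma>\<^sub>1 \<tau> else 0"
    have "((\<lambda>z. ?a * (z ^ Suc (Suc j) * (deriv ^^ Suc j) (rho \<tau>) z) + z ^ Suc (Suc j) * ?b) \<longlongrightarrow>
        ?a * ((-1) ^ Suc j * fact (Suc j)) + 0 ^ Suc (Suc j) * ?b) (at 0)"
      by (intro tendsto_intros higher_deriv_rho_pole[OF t])
    moreover have "?a * ((-1) ^ Suc j * fact (Suc j)) + 0 ^ Suc (Suc j) * ?b = 1"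
      by (simp add: power_mult_distrib[symmetric] del: fact_Suc)
    moreover have "?a * (z ^ Suc (Suc j) * (deriv ^^ Suc j) (rho \<tau>) z) + z ^ Suc (Suc j) * ?b
        = z ^ k * phi_basis \<tau> c k z" for z
      unfolding 3 phi_basis_def by (simp only: nat.simps if_False diff_Suc_1 One_nat_def Suc_not_Zero) (simp only: distrib_left mult_ac, simp)
    ultimately show ?thesis by (simp only:)
  qed
qed

text \<open>Let \<open>K\<close> be the largest index with a nonzero coefficient. After
  multiplication by \<open>z ^ K\<close> the lower terms tend to 0 at the origin, so the sum tends
  to \<open>a K\<close>.\<close>

lemma phi_basis_independent:
  assumes t: "Im \<tau> > 0" and c: "c \<notin> period_lattice \<tau>"
    and zero: "\<forall>\<^sub>F z in at 0. (\<Sum>k\<le>n. a k * phi_basis \<tau> c k z) = 0" and k: "k \<le> n"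
  shows "a k = 0"
proof (rule ccontr)
  assume "a k \<noteq> 0"
  define K where "K = Max {k. k \<le> n \<and> a k \<noteq> 0}"
  have fin: "finite {k. k \<le> n \<and> a k \<noteq> 0}" by simp
  have "K \<in> {k. k \<le> n \<and> a k \<noteq> 0}"
    unfolding K_def by (rule Max_in[OF fin]) (use \<open>a k \<noteq> 0\<close> k in blast)
  then have K: "K \<le> n" "a K \<noteq> 0" by auto
  have above: "a j = 0" if "j \<le> n" "j > K" for j
  proof (rule ccontr)
    assume "a j \<noteq> 0"
    then have "j \<le> K" unfolding K_def using that by (intro Max_ge[OF fin]) simp
    then show False using that by simp
  qed
  have "((\<lambda>z. \<Sum>j\<le>K. a j * z ^ (K - j) * (z ^ j * phi_basis \<tau> c j z)) \<longlongrightarrow> (\<Sum>j\<le>K. a j * 0 ^ (K - j) * 1)) (at 0)"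
    by (intro tendsto_sum tendsto_mult tendsto_power tendsto_ident_at tendsto_const phi_basis_pole t c)
  also have "(\<Sum>j\<le>K. a j * 0 ^ (K - j) * 1) = (\<Sum>j\<le>K. if j = K then a K else 0)"
    by (intro sum.cong refl) (auto simp: power_0_left)
  also have "\<dots> = a K" by simp
  finally have lim: "((\<lambda>z. \<Sum>j\<le>K. a j * z ^ (K - j) * (z ^ j * phi_basis \<tau> c j z)) \<longlongrightarrow> a K) (at 0)" .
  have "\<forall>\<^sub>F z in at 0. (\<Sum>j\<le>K. a j * z ^ (K - j) * (z ^ j * phi_basis \<tau> c j z)) = 0"
    using zero
  proof eventually_elim
    case (elim z)
    have "(\<Sum>j\<le>K. a j * z ^ (K - j) * (z ^ j * phi_basis \<tau> c j z)) = z ^ K * (\<Sum>j\<le>K. a j * phi_basis \<tau> c j z)"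
      unfolding sum_distrib_left
      by (intro sum.cong refl) (simp add: power_add[symmetric] mult_ac)
    also have "(\<Sum>j\<le>K. a j * phi_basis \<tau> c j z) = (\<Sum>j\<le>n. a j * phi_basis \<tau> c j z)"
      by (rule sum.mono_neutral_left) (use K above in auto)
    finally show ?case using elim by simp
  qed
  with lim have "((\<lambda>_. 0) \<longlongrightarrow> a K) (at (0::complex))" by (rule Lim_transform_eventually)
  then show False using K tendsto_unique[OF at_neq_bot _ tendsto_const] by (metis at_neq_bot tendsto_const_iff)
qed

section \<open>Derivatives of the basis functions\<close>

definition phi_basis' :: "complex \<Rightarrow> complex \<Rightarrow> nat \<Rightarrow> complex \<Rightarrow> complex" where
  "phi_basis' \<tau> c k z =
     (if k = 0 then 0
      else if k = 1 then deriv (rho \<tau>) z - deriv (rho \<tau>) (z + c)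
      else (-1) ^ (k - 1) / fact (k - 1) * (deriv ^^ k) (rho \<tau>) z)"

lemma phi_basis_deriv:
  assumes t: "Im \<tau> > 0" and z: "z \<notin> period_lattice \<tau>" "z + c \<notin> period_lattice \<tau>"
  shows "(phi_basis \<tau> c k has_field_derivative phi_basis' \<tau> c k z) (at z)"
proof -
  consider "k = 0" | "k = 1" | j where "k = Suc (Suc j)" by (metis One_nat_def not0_implies_Suc)
  then show ?thesis
  proof cases
    case 1 then show ?thesis by (simp add: phi_basis_def[abs_def] phi_basis'_def)
  next
    case 2
    have "((\<lambda>z. rho \<tau> z - rho \<tau> (z + c) + rho \<tau> c) has_field_derivative
        deriv (rho \<tau>) z - deriv (rho \<tau>) (z + c) + 0) (at z)"
      using has_field_derivative_rho[OF t z(2)]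
      by (intro DERIV_add DERIV_diff DERIV_const has_field_derivative_rho[OF t z(1)]) (simp add: DERIV_shift)
    then show ?thesis using 2 by (simp add: phi_basis_def[abs_def] phi_basis'_def)
  next
    case (3 j)
    have "((\<lambda>z. (-1) ^ Suc j / fact (Suc j) * (deriv ^^ Suc j) (rho \<tau>) z + (if k = 2 then \<gamma>\<^sub>1 \<tau> else 0)) has_field_derivative
        (-1) ^ Suc j / fact (Suc j) * (deriv ^^ Suc (Suc j)) (rho \<tau>) z + 0) (at z)"
      by (intro DERIV_add DERIV_cmult DERIV_const has_field_derivative_higher_deriv_rho t z)
    then show ?thesis using 3 by (simp add: phi_basis_def[abs_def] phi_basis'_def)
  qed
qed

text \<open>The \<tau>-derivative at fixed \<open>z\<close> and \<open>c\<close>, scaled by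
  \<open>2 \<pi> \<i>\<close> like \<open>rho_tau\<close>. In the intersection form it meets the
  factor \<open>- 2 \<pi> \<i>\<close> of the u-derivative, and the scaling disappears.\<close>

definition phi_basis_tau :: "complex \<Rightarrow> complex \<Rightarrow> nat \<Rightarrow> complex \<Rightarrow> complex" where
  "phi_basis_tau \<tau> c k z =
     (if k = 0 then 0
      else if k = 1 then rho_tau \<tau> z - rho_tau \<tau> (z + c) + rho_tau \<tau> c
      else (-1) ^ (k - 1) / fact (k - 1) * (deriv ^^ (k - 1)) (rho_tau \<tau>) z
           + (if k = 2 then 2 * of_real pi * \<i> * deriv \<gamma>\<^sub>1 \<tau> else 0))"

lemma g1_differentiable:
  assumes t: "Im \<tau> > 0"
  shows "(\<gamma>\<^sub>1 has_field_derivative deriv \<gamma>\<^sub>1 \<tau>) (at \<tau>)"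
proof -
  have "\<gamma>\<^sub>1 holomorphic_on {\<tau>. Im \<tau> > 0}"
    unfolding g1_def[abs_def]
    by (intro holomorphic_on_mult holomorphic_on_divide holomorphic_on_const holomorphic_deriv
          holomorphic_dedekind_eta open_halfspace_Im_gt) (use dedekind_eta_nonzero in auto)
  from holomorphic_derivI[OF this open_halfspace_Im_gt] show ?thesis using t by simp
qed

lemma phi_basis_tau_deriv:
  assumes t: "Im \<tau> > 0" and z: "z \<notin> period_lattice \<tau>" "z + c \<notin> period_lattice \<tau>" and c: "c \<notin> period_lattice \<tau>"
  shows "((\<lambda>\<tau>. phi_basis \<tau> c k z) has_field_derivative phi_basis_tau \<tau> c k z / (2 * of_real pi * \<i>)) (at \<tau>)"
proof -
  consider "k = 0" | "k = 1" | j where "k = Suc (Suc j)" by (metis One_nat_def not0_implies_Suc)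
  then show ?thesis
  proof cases
    case 1 then show ?thesis by (simp add: phi_basis_def phi_basis_tau_def)
  next
    case 2
    have "((\<lambda>\<tau>. rho \<tau> z - rho \<tau> (z + c) + rho \<tau> c) has_field_derivative
        rho_tau \<tau> z / (2 * of_real pi * \<i>) - rho_tau \<tau> (z + c) / (2 * of_real pi * \<i>)
        + rho_tau \<tau> c / (2 * of_real pi * \<i>)) (at \<tau>)"
      by (intro DERIV_add DERIV_diff rho_tau_derivative_0 t z c)
    then show ?thesis using 2 by (simp add: phi_basis_def phi_basis_tau_def diff_divide_distrib add_divide_distrib)
  next
    case (3 j)
    have g: "((\<lambda>\<tau>. if k = 2 then \<gamma>\<^sub>1 \<tau> else 0) has_field_derivative (if k = 2 then deriv \<gamma>\<^sub>1 \<tau> else 0)) (at \<tau>)"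
      using g1_differentiable[OF t] by simp
    have "((\<lambda>\<tau>. (-1) ^ Suc j / fact (Suc j) * (deriv ^^ Suc j) (rho \<tau>) z + (if k = 2 then \<gamma>\<^sub>1 \<tau> else 0)) has_field_derivative
        (-1) ^ Suc j / fact (Suc j) * ((deriv ^^ Suc j) (rho_tau \<tau>) z / (2 * of_real pi * \<i>)) + (if k = 2 then deriv \<gamma>\<^sub>1 \<tau> else 0)) (at \<tau>)"
      by (rule DERIV_add[OF DERIV_cmult[OF rho_tau_derivative[OF t z(1)]] g])
    also have "(-1) ^ Suc j / fact (Suc j) * ((deriv ^^ Suc j) (rho_tau \<tau>) z / (2 * of_real pi * \<i>)) + (if k = 2 then deriv \<gamma>\<^sub>1 \<tau> else 0)
       = phi_basis_tau \<tau> c k z / (2 * of_real pi * \<i>)"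
      unfolding phi_basis_tau_def 3 by (cases "j = 0") (simp_all add: add_divide_distrib diff_divide_distrib)
    finally show ?thesis unfolding phi_basis_def 3 by simp
  qed
qed

lemma phi_basis_w_deriv:
  assumes t: "Im \<tau> > 0" and z: "z + a * w \<notin> period_lattice \<tau>" and c: "a * w \<notin> period_lattice \<tau>"
  shows "((\<lambda>w. phi_basis \<tau> (a * w) k z) has_field_derivative
     (if k = 1 then a * (deriv (rho \<tau>) (a * w) - deriv (rho \<tau>) (z + a * w)) else 0)) (at w)"
proof (cases "k = 1")
  case True
  have a: "((\<lambda>w. a * w) has_field_derivative a) (at w)" "((\<lambda>w. z + a * w) has_field_derivative a) (at w)"
    by (auto intro!: derivative_eq_intros)
  have "((\<lambda>w. rho \<tau> z - rho \<tau> (z + a * w) + rho \<tau> (a * w)) has_field_derivative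
      0 - deriv (rho \<tau>) (z + a * w) * a + deriv (rho \<tau>) (a * w) * a) (at w)"
    by (intro DERIV_add DERIV_diff DERIV_const DERIV_chain2[OF has_field_derivative_rho[OF t z] a(2)]
        DERIV_chain2[OF has_field_derivative_rho[OF t c] a(1)])
  then show ?thesis using True by (simp add: phi_basis_def algebra_simps)
next
  case False
  then have "(\<lambda>w. phi_basis \<tau> (a * w) k z) = (\<lambda>w. phi_basis \<tau> 0 k z)" by (intro ext) (simp add: phi_basis_def)
  then show ?thesis using False by simp
qed

section \<open>Expansion of the \<delta>-coefficient in products of basis functions\<close>

text \<open>What \<open>\<phi>\<^sub>k\<close> contributes to the coefficient of \<delta>: the
  z-derivative terms of the collapsed form with the undifferentiated superpotential replaced by 1,
  and the correction for the \<tau>-dependence of the basis function. The dependence on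
  \<open>w\<close>, present for \<open>k = 1\<close> only, is added in
  \<open>phi_defect_1\<close>.\<close>

definition phi_defect :: "complex \<Rightarrow> complex \<Rightarrow> nat \<Rightarrow> complex \<Rightarrow> complex \<Rightarrow> complex" where
  "phi_defect \<tau> c k z y =
     - phi_basis' \<tau> c k z * (rho \<tau> y + rho \<tau> (z - y)) - phi_basis' \<tau> c k y * (rho \<tau> z - rho \<tau> (z - y))
     + (phi_basis_tau \<tau> c k z + phi_basis_tau \<tau> c k y)"

lemma phi_defect_0: "phi_defect \<tau> c 0 z y = 0"
  by (simp add: phi_defect_def phi_basis'_def phi_basis_tau_def)

text \<open>\<open>rho_tau_sum_0\<close> is used for \<open>(z, y)\<close> and for
  \<open>(z + c, y + c)\<close>. Both pairs have the difference \<open>z - y\<close>, and all terms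
  with \<open>\<rho>(z - y)\<close> cancel. No product of nonconstant basis functions in
  \<open>z\<close> and \<open>y\<close> survives, which is why the entries of index 1 off the row of
  \<open>\<phi>\<^sub>0\<close> vanish.\<close>

lemma phi_defect_1:
  assumes t: "Im \<tau> > 0" and z: "z \<notin> period_lattice \<tau>" "z + c \<notin> period_lattice \<tau>"
    and y: "y \<notin> period_lattice \<tau>" "y + c \<notin> period_lattice \<tau>" and zy: "z - y \<notin> period_lattice \<tau>"
  shows "phi_defect \<tau> c 1 z y
     + (rho \<tau> z - rho \<tau> (z + c)) * (deriv (rho \<tau>) c - deriv (rho \<tau>) (y + c))
     + (rho \<tau> y - rho \<tau> (y + c)) * (deriv (rho \<tau>) c - deriv (rho \<tau>) (z + c))
     = deriv (rho \<tau>) c * (phi_basis \<tau> c 1 z + phi_basis \<tau> c 1 y) + (2 * rho_tau \<tau> c - 2 * deriv (rho \<tau>) c * rho \<tau> c)"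
proof -
  have 1: "rho_tau \<tau> z = rho \<tau> (z - y) * (deriv (rho \<tau>) z - deriv (rho \<tau>) y)
           + (deriv (rho \<tau>) z * rho \<tau> y + rho \<tau> z * deriv (rho \<tau>) y) - rho_tau \<tau> y"
    using rho_tau_sum_0[OF t z(1) y(1) zy] by (simp add: algebra_simps)
  have 2: "rho_tau \<tau> (z + c) = rho \<tau> (z - y) * (deriv (rho \<tau>) (z + c) - deriv (rho \<tau>) (y + c))
           + (deriv (rho \<tau>) (z + c) * rho \<tau> (y + c) + rho \<tau> (z + c) * deriv (rho \<tau>) (y + c)) - rho_tau \<tau> (y + c)"
    using rho_tau_sum_0[OF t z(2) y(2)] zy by (simp add: algebra_simps)
  have 3: "phi_basis_tau \<tau> c 1 z + phi_basis_tau \<tau> c 1 y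
      = (rho_tau \<tau> z - rho_tau \<tau> (z + c) + rho_tau \<tau> c) + (rho_tau \<tau> y - rho_tau \<tau> (y + c) + rho_tau \<tau> c)"
    by (simp add: phi_basis_tau_def)
  show ?thesis
    unfolding phi_defect_def 3 1 2 by (simp add: phi_basis'_def phi_basis_def algebra_simps)
qed

text \<open>The end terms of the Leibniz sum in \<open>rho_tau_sum\<close> cancel the terms with
  \<open>\<rho>(y)\<close> and \<open>\<rho>(z)\<close>. By
  \<open>(k choose i) / (k - 1)! = k / (i! (k - i)!)\<close> the inner terms become products of
  basis functions whose pole orders add up to \<open>k + 2\<close>. Replacing \<open>\<rho>'\<close>
  by \<open>\<gamma>\<^sub>1 - \<wp>\<close> where it occurs produces the terms with
  \<open>\<gamma>\<^sub>1\<close>.\<close>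

lemma phi_defect_ge_2:
  assumes t: "Im \<tau> > 0" and z: "z \<notin> period_lattice \<tau>" and y: "y \<notin> period_lattice \<tau>"
    and zy: "z - y \<notin> period_lattice \<tau>" and k: "k \<ge> 2"
  shows "phi_defect \<tau> c k z y = - (of_nat k * (\<Sum>i=2..k. phi_basis \<tau> c i z * phi_basis \<tau> c (k + 2 - i) y))
     + of_nat k * \<gamma>\<^sub>1 \<tau> * (phi_basis \<tau> c k z + phi_basis \<tau> c k y)
     + (if k = 2 then 4 * of_real pi * \<i> * deriv \<gamma>\<^sub>1 \<tau> - 2 * (\<gamma>\<^sub>1 \<tau>)\<^sup>2 else 0)"
proof -
  obtain m where m: "k = Suc m" "m \<ge> 1" using k by (cases k) auto
  define g where "g = (\<lambda>j z. (-1) ^ j / fact j * (deriv ^^ j) (rho \<tau>) z)"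
  define a where "a = ((-1) ^ m / fact m :: complex)"
  define \<gamma> where "\<gamma> = \<gamma>\<^sub>1 \<tau>"
  have f: "phi_basis \<tau> c i z = g (i - 1) z + (if i = 2 then \<gamma> else 0)" if "i \<ge> 2" for i z
    using that by (simp add: phi_basis_def g_def \<gamma>_def)
  let ?r = "\<lambda>j. (deriv ^^ j) (rho \<tau>)"
  have bt: "phi_basis_tau \<tau> c k z + phi_basis_tau \<tau> c k y
      = a * ((deriv ^^ m) (rho_tau \<tau>) z + (deriv ^^ m) (rho_tau \<tau>) y) + (if k = 2 then 4 * of_real pi * \<i> * deriv \<gamma>\<^sub>1 \<tau> else 0)"
    using m k by (simp add: phi_basis_tau_def a_def distrib_left)
  have bp: "phi_basis' \<tau> c k x = a * ?r (Suc m) x" for x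
    using m k by (simp add: phi_basis'_def a_def del: funpow.simps)
  have ends: "(\<Sum>i = 0..Suc m. of_nat (Suc m choose i) * ?r i z * ?r (Suc m - i) y)
      = rho \<tau> z * ?r (Suc m) y + ?r (Suc m) z * rho \<tau> y + (\<Sum>i = 1..m. of_nat (Suc m choose i) * ?r i z * ?r (Suc m - i) y)"
  proof -
    have "{0..Suc m} = insert 0 (insert (Suc m) {1..m})" by auto
    then show ?thesis by (simp del: funpow.simps add: funpow_0)
  qed
  have "phi_defect \<tau> c k z y = a * (- ?r (Suc m) z * (rho \<tau> y + rho \<tau> (z - y)) - ?r (Suc m) y * (rho \<tau> z - rho \<tau> (z - y))
      + ((deriv ^^ m) (rho_tau \<tau>) z + (deriv ^^ m) (rho_tau \<tau>) y)) + (if k = 2 then 4 * of_real pi * \<i> * deriv \<gamma>\<^sub>1 \<tau> else 0)"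
    unfolding phi_defect_def bt bp by (simp add: algebra_simps del: funpow.simps)
  also have "- ?r (Suc m) z * (rho \<tau> y + rho \<tau> (z - y)) - ?r (Suc m) y * (rho \<tau> z - rho \<tau> (z - y))
      + ((deriv ^^ m) (rho_tau \<tau>) z + (deriv ^^ m) (rho_tau \<tau>) y)
      = (\<Sum>i = 1..m. of_nat (Suc m choose i) * ?r i z * ?r (Suc m - i) y)"
    unfolding rho_tau_sum[OF t z y zy] ends by (simp add: algebra_simps del: funpow.simps)
  also have "a * (\<Sum>i = 1..m. of_nat (Suc m choose i) * ?r i z * ?r (Suc m - i) y)
      = - (of_nat k * (\<Sum>i = 1..m. g i z * g (k - i) y))"
    unfolding sum_distrib_left sum_negf[symmetric]
  proof (intro sum.cong refl)
    fix i assume i: "i \<in> {1..m}"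
    have e1: "of_nat (Suc m choose i) = (fact (Suc m) / (fact i * fact (Suc m - i)) :: complex)"
      using i by (intro binomial_fact) auto
    have e2: "(-1) ^ m = - ((-1) ^ i * (-1) ^ (Suc m - i) :: complex)"
      using i by (simp add: power_add[symmetric])
    have e3: "- (s * t) / F * (N * F / (u * v) * X * Y) = - (N * (s / u * X * (t / v * Y)))"
      if "F \<noteq> 0" for s t F N u v X Y :: complex using that by simp
    show "a * (of_nat (Suc m choose i) * ?r i z * ?r (Suc m - i) y) = - (of_nat k * (g i z * g (k - i) y))"
      unfolding a_def g_def m(1) e1 e2 fact_Suc by (rule e3) simp
  qed
  also have "(\<Sum>i = 1..m. g i z * g (k - i) y) = (\<Sum>i = 2..k. g (i - 1) z * g (k + 1 - i) y)"
    unfolding m(1) using sum.shift_bounds_cl_nat_ivl[of "\<lambda>i. g (i - 1) z * g (Suc m + 1 - i) y" 1 1 m] by (simp add: numeral_2_eq_2)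
  \<comment> \<open>The shift by \<open>\<gamma>\<close> affects the first factor at
    \<open>i = 2\<close> and the second at \<open>i = k\<close>. For \<open>k = 2\<close> both
    happen in the same summand, which is the source of \<open>\<gamma>\<^sup>2\<close>.\<close>
  also have "\<dots> = (\<Sum>i=2..k. phi_basis \<tau> c i z * phi_basis \<tau> c (k + 2 - i) y)
      - \<gamma> * (phi_basis \<tau> c k z + phi_basis \<tau> c k y) + (if k = 2 then \<gamma>\<^sup>2 else 0)"
  proof -
    have "(\<Sum>i=2..k. phi_basis \<tau> c i z * phi_basis \<tau> c (k + 2 - i) y)
        = (\<Sum>i=2..k. g (i - 1) z * g (k + 1 - i) y + (if i = 2 then \<gamma> * g (k - 1) y else 0)
            + (if i = k then g (k - 1) z * \<gamma> else 0) + (if i = 2 then if k = 2 then \<gamma>\<^sup>2 else 0 else 0))"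
    proof (intro sum.cong refl)
      fix i assume i: "i \<in> {2..k}"
      have "phi_basis \<tau> c i z = g (i - 1) z + (if i = 2 then \<gamma> else 0)" using i by (intro f) auto
      moreover have "phi_basis \<tau> c (k + 2 - i) y = g (k + 2 - i - 1) y + (if k + 2 - i = 2 then \<gamma> else 0)"
        using i by (intro f) auto
      moreover have "k + 2 - i - 1 = k + 1 - i" "k + 2 - i = 2 \<longleftrightarrow> i = k" using i by auto
      ultimately show "phi_basis \<tau> c i z * phi_basis \<tau> c (k + 2 - i) y
        = g (i - 1) z * g (k + 1 - i) y + (if i = 2 then \<gamma> * g (k - 1) y else 0)
            + (if i = k then g (k - 1) z * \<gamma> else 0) + (if i = 2 then if k = 2 then \<gamma>\<^sup>2 else 0 else 0)"
        using i by (auto simp: power2_eq_square algebra_simps)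
    qed
    also have "\<dots> = (\<Sum>i=2..k. g (i - 1) z * g (k + 1 - i) y) + \<gamma> * g (k - 1) y + g (k - 1) z * \<gamma> + (if k = 2 then \<gamma>\<^sup>2 else 0)"
      using k by (simp add: sum.distrib)
    finally have "(\<Sum>i=2..k. phi_basis \<tau> c i z * phi_basis \<tau> c (k + 2 - i) y) = \<dots>" .
    then show ?thesis using f[OF k, of z] f[OF k, of y] by (auto simp: power2_eq_square algebra_simps)
  qed
  finally show ?thesis by (auto simp: \<gamma>_def power2_eq_square algebra_simps)
qed

section \<open>Logarithmic derivatives of the superpotential\<close>

lemma theta1_log_deriv:
  assumes t: "Im \<tau> > 0" and X: "(X has_field_derivative X') (at s)" and nz: "X s \<notin> period_lattice \<tau>"
  shows "((\<lambda>s. theta1 (X s) \<tau>) has_field_derivative theta1 (X s) \<tau> * (rho \<tau> (X s) * X')) (at s)"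
proof -
  have "((\<lambda>z. theta1 z \<tau>) has_field_derivative deriv (\<lambda>z. theta1 z \<tau>) (X s)) (at (X s))"
    using theta1_higher_deriv_has_field_derivative[OF t, of 0 "X s"] by simp
  from DERIV_chain2[OF this X]
  have "((\<lambda>s. theta1 (X s) \<tau>) has_field_derivative deriv (\<lambda>z. theta1 z \<tau>) (X s) * X') (at s)" .
  also have "deriv (\<lambda>z. theta1 z \<tau>) (X s) * X' = theta1 (X s) \<tau> * (rho \<tau> (X s) * X')"
    using nz theta1_eq_0_iff[OF t, of "X s"] by (simp add: rho_def)
  finally show ?thesis .
qed

lemma theta1_deriv_2:
  assumes t: "Im \<tau> > 0" and nz: "x \<notin> period_lattice \<tau>"
  shows "(deriv ^^ 2) (\<lambda>z. theta1 z \<tau>) x = theta1 x \<tau> * (deriv (rho \<tau>) x + (rho \<tau> x)\<^sup>2)"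
proof -
  have "deriv (\<lambda>z. theta1 z \<tau>) z = theta1 z \<tau> * rho \<tau> z" if "z \<in> - period_lattice \<tau>" for z
    using that theta1_eq_0_iff[OF t, of z] by (simp add: rho_def)
  moreover have "((\<lambda>z. theta1 z \<tau> * rho \<tau> z) has_field_derivative
      theta1 x \<tau> * (rho \<tau> x * 1) * rho \<tau> x + deriv (rho \<tau>) x * theta1 x \<tau>) (at x)"
    by (rule DERIV_mult[OF theta1_log_deriv[OF t DERIV_ident nz] has_field_derivative_rho[OF t nz]])
  ultimately have "(deriv (\<lambda>z. theta1 z \<tau>) has_field_derivative
      theta1 x \<tau> * (rho \<tau> x * 1) * rho \<tau> x + deriv (rho \<tau>) x * theta1 x \<tau>) (at x)"
    using has_field_derivative_transform_within_open[OF _ open_compl_period_lattice[OF t], of _ _ x] nz by simp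
  then show ?thesis by (simp add: numeral_2_eq_2 DERIV_imp_deriv power2_eq_square algebra_simps)
qed

lemma theta1_log_deriv_tau:
  assumes t: "Im \<tau> > 0" and nz: "x \<notin> period_lattice \<tau>"
  shows "((\<lambda>s. theta1 x (\<tau> + s)) has_field_derivative
     theta1 x \<tau> * ((deriv (rho \<tau>) x + (rho \<tau> x)\<^sup>2) / (4 * of_real pi * \<i>))) (at 0)"
proof -
  have "((\<lambda>s. theta1 x (s + \<tau>)) has_field_derivative
     (deriv ^^ 2) (\<lambda>z. theta1 z \<tau>) x / (4 * of_real pi * \<i>)) (at 0)"
    using theta1_heat[OF t, of x] DERIV_shift[of "theta1 x" _ 0 \<tau>] by simp
  then show ?thesis unfolding theta1_deriv_2[OF t nz] by (simp add: add.commute)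
qed

text \<open>Writing a logarithmic derivative \<open>L\<close> as \<open>f' = f L\<close> lets the
  product rule be used without dividing by \<open>f\<close>.\<close>

lemma log_deriv_mult:
  fixes f g :: "complex \<Rightarrow> complex"
  assumes "(f has_field_derivative f s * a) (at s)" "(g has_field_derivative g s * b) (at s)"
  shows "((\<lambda>s. f s * g s) has_field_derivative (f s * g s) * (a + b)) (at s)"
  using DERIV_mult[OF assms] by (simp add: algebra_simps)

lemma log_deriv_divide:
  fixes f g :: "complex \<Rightarrow> complex"
  assumes "(f has_field_derivative f s * a) (at s)" "(g has_field_derivative g s * b) (at s)" "g s \<noteq> 0"
  shows "((\<lambda>s. f s / g s) has_field_derivative (f s / g s) * (a - b)) (at s)"
proof -
  have "(f s * a * g s - f s * (g s * b)) / (g s * g s) = (f s / g s) * (a - b)"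
    using assms(3) by (simp add: field_simps)
  then show ?thesis using DERIV_divide[OF assms] by simp
qed

lemma log_deriv_prod:
  fixes f :: "'a \<Rightarrow> complex \<Rightarrow> complex"
  assumes "finite A" "\<And>i. i \<in> A \<Longrightarrow> (f i has_field_derivative f i s * L i) (at s)"
  shows "((\<lambda>s. \<Prod>i\<in>A. f i s) has_field_derivative (\<Prod>i\<in>A. f i s) * (\<Sum>i\<in>A. L i)) (at s)"
  using assms
proof (induction A rule: finite_induct)
  case (insert x A)
  then show ?case using log_deriv_mult[of "f x" s "L x" "\<lambda>s. \<Prod>i\<in>A. f i s" "\<Sum>i\<in>A. L i"] by simp
qed simp

lemma log_deriv_quotient:
  fixes e xn b c :: "complex \<Rightarrow> complex" and x :: "'n::finite \<Rightarrow> complex \<Rightarrow> complex"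
  assumes e: "(e has_field_derivative e s * le) (at s)"
    and x: "\<And>a. (x a has_field_derivative x a s * lx a) (at s)"
    and xn: "(xn has_field_derivative xn s * lxn) (at s)"
    and b: "(b has_field_derivative b s * lb) (at s)" "b s \<noteq> 0"
    and c: "(c has_field_derivative c s * lc) (at s)" "c s \<noteq> 0"
  shows "((\<lambda>s. e s * ((\<Prod>a\<in>UNIV. x a s) * xn s) / (b s ^ n * c s)) has_field_derivative
      (e s * ((\<Prod>a\<in>UNIV. x a s) * xn s) / (b s ^ n * c s))
        * (le + (\<Sum>a\<in>UNIV. lx a) + lxn - of_nat n * lb - lc)) (at s)"
proof -
  have bn: "((\<lambda>s. b s ^ n) has_field_derivative b s ^ n * (of_nat n * lb)) (at s)"
    using log_deriv_prod[of "{..<n}" "\<lambda>_. b" s "\<lambda>_. lb"] b by simp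
  have N: "((\<lambda>s. e s * ((\<Prod>a\<in>UNIV. x a s) * xn s)) has_field_derivative
      (e s * ((\<Prod>a\<in>UNIV. x a s) * xn s)) * (le + ((\<Sum>a\<in>UNIV. lx a) + lxn))) (at s)"
    by (intro log_deriv_mult log_deriv_prod e x xn) simp
  have D: "((\<lambda>s. b s ^ n * c s) has_field_derivative (b s ^ n * c s) * (of_nat n * lb + lc)) (at s)"
    by (intro log_deriv_mult bn c)
  have "le + ((\<Sum>a\<in>UNIV. lx a) + lxn) - (of_nat n * lb + lc) = le + (\<Sum>a\<in>UNIV. lx a) + lxn - of_nat n * lb - lc"
    by simp
  with log_deriv_divide[OF N D] b(2) c(2) show ?thesis by simp
qed

lemma superpotential_eq:
  fixes v :: "complex ^ 'n::finite"
  shows "superpotential (u, v, w, \<tau>) z = exp (- 2 * of_real pi * \<i> * u)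
       * ((\<Prod>a\<in>UNIV. theta1 (z - v $ a + w) \<tau>) * theta1 (z + (\<Sum>a\<in>UNIV. v $ a) + w) \<tau>)
       / (theta1 z \<tau> ^ CARD('n) * theta1 (z + (of_nat CARD('n) + 1) * w) \<tau>)"
  by (simp add: superpotential_def Let_def)

text \<open>Every theta argument is affine in \<open>s\<close>, so one computation serves the
  directions \<open>u\<close>, \<open>v\<^sub>a\<close>, \<open>w\<close> and, through
  \<open>hz\<close>, the variable \<open>z\<close>. The increment with the sum over
  \<open>hv\<close> belongs to the factor of \<open>v\<^sub>n\<close>, minus the sum of the other
  \<open>v\<^sub>a\<close>. The direction \<open>\<tau>\<close> is separate because it needs the
  heat equation.\<close>

lemma superpotential_deriv:
  fixes v hv :: "complex ^ 'n::finite"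
  assumes t: "Im \<tau> > 0"
    and x: "\<And>a. z - v $ a + w \<notin> period_lattice \<tau>" and xn: "z + (\<Sum>a\<in>UNIV. v $ a) + w \<notin> period_lattice \<tau>"
    and z: "z \<notin> period_lattice \<tau>" and c: "z + (of_nat CARD('n) + 1) * w \<notin> period_lattice \<tau>"
  shows "((\<lambda>s. superpotential ((u, v, w, \<tau>) + cscale s (hu, hv, hw, 0)) (z + s * hz)) has_field_derivative
     superpotential (u, v, w, \<tau>) z *
      (- 2 * of_real pi * \<i> * hu + (\<Sum>a\<in>UNIV. rho \<tau> (z - v $ a + w) * (hz - hv $ a + hw))
        + rho \<tau> (z + (\<Sum>a\<in>UNIV. v $ a) + w) * (hz + (\<Sum>a\<in>UNIV. hv $ a) + hw)
        - of_nat CARD('n) * (rho \<tau> z * hz)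
        - rho \<tau> (z + (of_nat CARD('n) + 1) * w) * (hz + (of_nat CARD('n) + 1) * hw))) (at 0)"
proof -
  define e where "e = (\<lambda>s. exp (- 2 * of_real pi * \<i> * (u + s * hu)))"
  define X where "X = (\<lambda>a s. z + s * hz - (v $ a + s * hv $ a) + (w + s * hw))"
  define Xn where "Xn = (\<lambda>s. z + s * hz + (\<Sum>a\<in>UNIV. v $ a + s * hv $ a) + (w + s * hw))"
  define Z where "Z = (\<lambda>s. z + s * hz)"
  define C where "C = (\<lambda>s. z + s * hz + (of_nat CARD('n) + 1) * (w + s * hw))"
  have 0: "X a 0 = z - v $ a + w" "Xn 0 = z + (\<Sum>a\<in>UNIV. v $ a) + w" "Z 0 = z"
    "C 0 = z + (of_nat CARD('n) + 1) * w" "e 0 = exp (- 2 * of_real pi * \<i> * u)" for a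
    by (simp_all add: X_def Xn_def Z_def C_def e_def)
  have de: "(e has_field_derivative e 0 * (- 2 * of_real pi * \<i> * hu)) (at 0)"
    unfolding e_def by (auto intro!: derivative_eq_intros)
  have dX: "(X a has_field_derivative (hz - hv $ a + hw)) (at 0)" for a
    unfolding X_def by (auto intro!: derivative_eq_intros)
  have dXn: "(Xn has_field_derivative (hz + (\<Sum>a\<in>UNIV. hv $ a) + hw)) (at 0)"
    unfolding Xn_def sum.distrib sum_distrib_left[symmetric] by (auto intro!: derivative_eq_intros)
  have dZ: "(Z has_field_derivative hz) (at 0)"
    unfolding Z_def by (auto intro!: derivative_eq_intros)
  have dC: "(C has_field_derivative (hz + (of_nat CARD('n) + 1) * hw)) (at 0)"
    unfolding C_def by (auto intro!: derivative_eq_intros simp: algebra_simps)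
  have nz: "theta1 (Z 0) \<tau> \<noteq> 0" "theta1 (C 0) \<tau> \<noteq> 0"
    using z c by (simp_all add: 0 theta1_eq_0_iff[OF t])
  have "superpotential ((u, v, w, \<tau>) + cscale s (hu, hv, hw, 0)) (z + s * hz)
      = e s * ((\<Prod>a\<in>UNIV. theta1 (X a s) \<tau>) * theta1 (Xn s) \<tau>) / (theta1 (Z s) \<tau> ^ CARD('n) * theta1 (C s) \<tau>)" for s
    by (simp add: cscale_def superpotential_eq e_def X_def Xn_def Z_def C_def)
  moreover have "((\<lambda>s. e s * ((\<Prod>a\<in>UNIV. theta1 (X a s) \<tau>) * theta1 (Xn s) \<tau>) / (theta1 (Z s) \<tau> ^ CARD('n) * theta1 (C s) \<tau>))
     has_field_derivative
      e 0 * ((\<Prod>a\<in>UNIV. theta1 (X a 0) \<tau>) * theta1 (Xn 0) \<tau>) / (theta1 (Z 0) \<tau> ^ CARD('n) * theta1 (C 0) \<tau>)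
      * (- 2 * of_real pi * \<i> * hu + (\<Sum>a\<in>UNIV. rho \<tau> (X a 0) * (hz - hv $ a + hw))
        + rho \<tau> (Xn 0) * (hz + (\<Sum>a\<in>UNIV. hv $ a) + hw) - of_nat CARD('n) * (rho \<tau> (Z 0) * hz)
        - rho \<tau> (C 0) * (hz + (of_nat CARD('n) + 1) * hw))) (at 0)"
    by (intro log_deriv_quotient de theta1_log_deriv t dX dXn dZ dC nz) (use x xn z c in \<open>simp_all add: 0\<close>)
  ultimately show ?thesis by (simp only: 0 superpotential_eq)
qed

lemma superpotential_deriv_tau:
  fixes v :: "complex ^ 'n::finite"
  assumes t: "Im \<tau> > 0"
    and x: "\<And>a. z - v $ a + w \<notin> period_lattice \<tau>" and xn: "z + (\<Sum>a\<in>UNIV. v $ a) + w \<notin> period_lattice \<tau>"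
    and z: "z \<notin> period_lattice \<tau>" and c: "z + (of_nat CARD('n) + 1) * w \<notin> period_lattice \<tau>"
  defines "l \<equiv> (\<lambda>x. (deriv (rho \<tau>) x + (rho \<tau> x)\<^sup>2) / (4 * of_real pi * \<i>))"
  shows "((\<lambda>s. superpotential ((u, v, w, \<tau>) + cscale s (0, 0, 0, 1)) z) has_field_derivative
     superpotential (u, v, w, \<tau>) z *
      (0 + (\<Sum>a\<in>UNIV. l (z - v $ a + w)) + l (z + (\<Sum>a\<in>UNIV. v $ a) + w)
        - of_nat CARD('n) * l z - l (z + (of_nat CARD('n) + 1) * w))) (at 0)"
proof -
  define e where "e = (\<lambda>s::complex. exp (- 2 * of_real pi * \<i> * u))"
  have de: "(e has_field_derivative e 0 * 0) (at 0)" unfolding e_def by simp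
  have th: "((\<lambda>s. theta1 x (\<tau> + s)) has_field_derivative theta1 x (\<tau> + 0) * l x) (at 0)"
    if "x \<notin> period_lattice \<tau>" for x
    using theta1_log_deriv_tau[OF t that] by (simp add: l_def)
  have nz: "theta1 z (\<tau> + 0) \<noteq> 0" "theta1 (z + (of_nat CARD('n) + 1) * w) (\<tau> + 0) \<noteq> 0"
    using z c by (simp_all add: theta1_eq_0_iff[OF t])
  have "superpotential ((u, v, w, \<tau>) + cscale s (0, 0, 0, 1)) z
      = e s * ((\<Prod>a\<in>UNIV. theta1 (z - v $ a + w) (\<tau> + s)) * theta1 (z + (\<Sum>a\<in>UNIV. v $ a) + w) (\<tau> + s))
       / (theta1 z (\<tau> + s) ^ CARD('n) * theta1 (z + (of_nat CARD('n) + 1) * w) (\<tau> + s))" for s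
    by (simp add: cscale_def superpotential_eq e_def)
  moreover note log_deriv_quotient[where s = 0 and n = "CARD('n)", OF de th[OF x] th[OF xn] th[OF z] nz(1) th[OF c] nz(2)]
  ultimately show ?thesis by (simp only: superpotential_eq e_def add_0_right)
qed

section \<open>The intersection form\<close>

text \<open>Applied with \<open>r\<^sub>a, s\<^sub>a\<close> the values of \<open>\<rho>\<close> at \<open>z - v\<^sub>a + w\<close> and \<open>y - v\<^sub>a + w\<close>, with primed
  letters for the values of \<open>\<rho>'\<close> and \<open>K = \<rho>(z - y)\<close>; the constant \<open>k\<close> cancels because
  the numerator and the denominator of \<open>\<lambda>\<close> have equally many theta factors.\<close>

lemma log_superpotential_form:
  fixes r s r' s' :: "'n::finite \<Rightarrow> complex" and N :: complex
  assumes N: "N = of_nat CARD('n)"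
    and a: "\<And>a. (r a - s a)\<^sup>2 + r' a + s' a = 2 * (r a - s a) * K - k"
    and an: "(rn - sn)\<^sup>2 + rn' + sn' = 2 * (rn - sn) * K - k"
    and az: "(A - B)\<^sup>2 + A' + B' = 2 * (A - B) * K - k"
    and ac: "(P - Q)\<^sup>2 + P' + Q' = 2 * (P - Q) * K - k"
  defines "R \<equiv> (\<Sum>a\<in>UNIV. r a) + rn" and "S \<equiv> (\<Sum>a\<in>UNIV. s a) + sn"
  defines "Lz \<equiv> R - N * A - P" and "Ly \<equiv> S - N * B - Q"
  shows "(\<Sum>a\<in>UNIV. (rn - r a) * (sn - s a)) - 1 / (N + 1) * (\<Sum>a\<in>UNIV. rn - r a) * (\<Sum>a\<in>UNIV. sn - s a)
     - 1 / (N * (N + 1)) * (R - (N + 1) * P) * (S - (N + 1) * Q)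
     - 1 / 2 * ((\<Sum>a\<in>UNIV. s' a + (s a)\<^sup>2) + (sn' + sn\<^sup>2) - N * (B' + B\<^sup>2) - (Q' + Q\<^sup>2))
     - 1 / 2 * ((\<Sum>a\<in>UNIV. r' a + (r a)\<^sup>2) + (rn' + rn\<^sup>2) - N * (A' + A\<^sup>2) - (P' + P\<^sup>2))
     = - (1 / N) * Lz * Ly - Lz * (B + K) - Ly * (A - K)"
proof -
  have N0: "N \<noteq> 0" "N + 1 \<noteq> 0"
  proof -
    show "N \<noteq> 0" unfolding N by simp
    have "N + 1 = of_nat (Suc CARD('n))" unfolding N by simp
    then show "N + 1 \<noteq> 0" by (simp only: of_nat_eq_0_iff; simp)
  qed
  \<comment> \<open>This mixed sum arises in the v-part \<open>T1\<close> and, through the addition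
    formula, in the \<tau>-part \<open>T5\<close>; the two occurrences cancel.\<close>
  define W where "W = (\<Sum>a\<in>UNIV. r a * s a)"
  have sr: "(\<Sum>a\<in>UNIV. r a) = R - rn" "(\<Sum>a\<in>UNIV. s a) = S - sn" by (simp_all add: R_def S_def)
  have T1: "(\<Sum>a\<in>UNIV. (rn - r a) * (sn - s a)) = (N + 2) * rn * sn - rn * S - sn * R + W"
  proof -
    have "(\<Sum>a\<in>UNIV. (rn - r a) * (sn - s a)) = (\<Sum>a\<in>UNIV. rn * sn - rn * s a - sn * r a + r a * s a)"
      by (intro sum.cong refl) (simp add: algebra_simps)
    also have "\<dots> = N * (rn * sn) - rn * (S - sn) - sn * (R - rn) + W"
      by (simp add: sum.distrib sum_subtractf sum_distrib_left[symmetric] W_def N sr)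
    finally show ?thesis by (simp add: algebra_simps)
  qed
  have T2: "(\<Sum>a\<in>UNIV. rn - r a) = (N + 1) * rn - R" "(\<Sum>a\<in>UNIV. sn - s a) = (N + 1) * sn - S"
    by (simp_all add: sum_subtractf sr N algebra_simps)
  have "r' a + (r a)\<^sup>2 + (s' a + (s a)\<^sup>2) = 2 * (r a * s a) + 2 * K * r a - 2 * K * s a - k" for a
    using a[of a] by (simp add: power2_eq_square algebra_simps)
  then have "(\<Sum>a\<in>UNIV. r' a + (r a)\<^sup>2) + (\<Sum>a\<in>UNIV. s' a + (s a)\<^sup>2)
     = (\<Sum>a\<in>UNIV. 2 * (r a * s a) + 2 * K * r a - 2 * K * s a - k)"
    by (simp add: sum.distrib[symmetric])
  also have "\<dots> = 2 * W + 2 * K * (R - rn) - 2 * K * (S - sn) - N * k"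
    by (simp add: sum.distrib sum_subtractf sum_distrib_left[symmetric] W_def N sr)
  finally have T4: "(\<Sum>a\<in>UNIV. s' a + (s a)\<^sup>2) = 2 * W + 2 * K * (R - rn) - 2 * K * (S - sn) - N * k - (\<Sum>a\<in>UNIV. r' a + (r a)\<^sup>2)"
    by (simp add: algebra_simps)
  have e: "sn' = 2 * (rn - sn) * K - k - (rn - sn)\<^sup>2 - rn'" "B' = 2 * (A - B) * K - k - (A - B)\<^sup>2 - A'"
    "Q' = 2 * (P - Q) * K - k - (P - Q)\<^sup>2 - P'"
    using an az ac by (simp_all add: algebra_simps)
  have T5: "1 / 2 * ((\<Sum>a\<in>UNIV. s' a + (s a)\<^sup>2) + (sn' + sn\<^sup>2) - N * (B' + B\<^sup>2) - (Q' + Q\<^sup>2))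
     + 1 / 2 * ((\<Sum>a\<in>UNIV. r' a + (r a)\<^sup>2) + (rn' + rn\<^sup>2) - N * (A' + A\<^sup>2) - (P' + P\<^sup>2))
     = - (- W - rn * sn - (R - S) * K + N * (A * B + (A - B) * K) + P * Q + (P - Q) * K)"
    unfolding T4 e by (simp add: power2_eq_square field_simps)
  \<comment> \<open>The two rank one terms merge, since
    \<open>1 / (N + 1) + 1 / (N (N + 1)) = 1 / N\<close>. The weight of the w-direction in the form
    is exactly what makes this work.\<close>
  have T3: "1 / (N + 1) * ((N + 1) * rn - R) * ((N + 1) * sn - S)
      + 1 / (N * (N + 1)) * (R - (N + 1) * P) * (S - (N + 1) * Q)
      = - (- (N + 1) * rn * sn + rn * S + sn * R - P * Q - 1 / N * (R - P) * (S - Q))"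
  proof -
    define M where "M = N + 1"
    have M: "M \<noteq> 0" "N = M - 1" "M - 1 \<noteq> 0" using N0 by (simp_all add: M_def)
    show ?thesis unfolding M_def[symmetric] using M by (simp add: divide_simps; simp add: algebra_simps)
  qed
  have final: "- (1 / N) * (R - P) * (S - Q) - (R - S) * K + N * (A * B + (A - B) * K) + (P - Q) * K
     = - (1 / N) * Lz * Ly - Lz * (B + K) - Ly * (A - K)"
    unfolding Lz_def Ly_def using N0(1) by (simp add: divide_simps; simp add: algebra_simps)
  have split: "t - x - y - e - f = t - (x + y) - (e + f)" for t x y e f :: complex by simp
  show ?thesis unfolding T1 T2 split T3 T5 final[symmetric] by (simp add: algebra_simps)
qed

section \<open>The intersection form as a bilinear form on gradients\<close>

text \<open>\<open>matA\<close> is the identity plus the all-ones matrix \<open>J\<close>, and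
  \<open>J\<^sup>2 = n J\<close>, whence the inverse is the identity minus
  \<open>J / (n + 1)\<close>. Since \<open>matrix_inv\<close> is a chosen two-sided inverse, it is
  identified with \<open>M\<close> by uniqueness.\<close>

lemma matrix_inv_matA:
  "matrix_inv (matA :: complex ^ 'n::finite ^ 'n) $ a $ b = (if a = b then 1 else 0) - 1 / (of_nat CARD('n) + 1)"
proof -
  define t where "t = 1 / (of_nat CARD('n) + 1 :: complex)"
  define M :: "complex ^ 'n ^ 'n" where "M = (\<chi> a b. (if a = b then 1 else 0) - t)"
  have "(of_nat CARD('n) + 1 :: complex) = of_nat (Suc CARD('n))" by simp
  then have "(of_nat CARD('n) + 1 :: complex) \<noteq> 0" by (simp only: of_nat_eq_0_iff; simp)
  then have t: "of_nat CARD('n) * t = 1 - t" by (simp add: t_def field_simps)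
  have sum: "(\<Sum>k\<in>UNIV. (if a = k then 2 else 1) * ((if k = b then 1 else 0) - t)) = (if a = b then 1 else (0::complex))" for a b :: 'n
  proof -
    have "(\<Sum>k\<in>UNIV. (if a = k then 2 else 1) * ((if k = b then 1 else 0) - t))
       = (\<Sum>k\<in>UNIV. (if a = k then (if a = b then 1 else 0) - t else 0) + ((if k = b then 1 else 0) - t))"
      by (intro sum.cong refl) auto
    also have "\<dots> = (if a = b then 1 else 0) - t + (1 - of_nat CARD('n) * t)"
      by (simp add: sum.distrib sum_subtractf)
    finally show ?thesis by (simp add: t)
  qed
  have 1: "matA ** M = mat 1"
    using sum by (simp add: matrix_matrix_mult_def matA_def M_def mat_def vec_eq_iff)
  then have 2: "M ** matA = mat 1" by (simp add: matrix_left_right_inverse)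
  let ?A = "matA :: complex ^ 'n ^ 'n"
  have "?A ** matrix_inv ?A = mat 1 \<and> matrix_inv ?A ** ?A = mat 1"
    unfolding matrix_inv_def
    by (rule someI[where P = "\<lambda>A'. ?A ** A' = mat 1 \<and> A' ** ?A = mat 1" and x = M]) (use 1 2 in simp)
  then have inv: "matrix_inv ?A ** ?A = mat 1" ..
  have "matrix_inv matA = matrix_inv matA ** (matA ** M)" by (simp add: 1 matrix_mul_rid)
  also have "\<dots> = M" using inv by (simp add: matrix_mul_assoc)
  finally show ?thesis by (simp add: M_def t_def)
qed

text \<open>The form on two gradients given by their components, detached from any function, so that
  it applies to the gradients of the \<open>\<phi>\<^sub>k\<close> and to combinations of them
  weighted by values of basis functions.\<close>

definition gform :: "('n::finite \<Rightarrow> complex) \<Rightarrow> complex \<Rightarrow> complex \<Rightarrow> complex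
    \<Rightarrow> ('n \<Rightarrow> complex) \<Rightarrow> complex \<Rightarrow> complex \<Rightarrow> complex \<Rightarrow> complex" where
  "gform fv fw fu ft hv hw hu ht =
     (\<Sum>a\<in>UNIV. fv a * hv a) - 1 / (of_nat CARD('n) + 1) * (\<Sum>a\<in>UNIV. fv a) * (\<Sum>a\<in>UNIV. hv a)
     - 1 / (of_nat CARD('n) * (of_nat CARD('n) + 1)) * fw * hw + fu * ht + ft * hu"

lemma intersection_form_gform:
  fixes f h :: "('n::finite) point \<Rightarrow> complex"
  shows "intersection_form f h p =
    gform (\<lambda>a. d_v a f p) (d_w f p) (d_u f p) (d_tau f p) (\<lambda>a. d_v a h p) (d_w h p) (d_u h p) (d_tau h p)"
proof -
  define t where "t = 1 / (of_nat CARD('n) + 1 :: complex)"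
  have "(\<Sum>a\<in>UNIV. \<Sum>b\<in>UNIV. matrix_inv matA $ a $ b * d_v a f p * d_v b h p)
      = (\<Sum>a\<in>UNIV. \<Sum>b\<in>UNIV. (if a = b then d_v a f p * d_v b h p else 0) - t * (d_v a f p * d_v b h p))"
    unfolding matrix_inv_matA t_def by (intro sum.cong refl) (simp add: algebra_simps)
  also have "\<dots> = (\<Sum>a\<in>UNIV. d_v a f p * d_v a h p) - t * ((\<Sum>a\<in>UNIV. d_v a f p) * (\<Sum>b\<in>UNIV. d_v b h p))"
  proof -
    have "(\<Sum>a\<in>UNIV. \<Sum>b\<in>UNIV. t * (d_v a f p * d_v b h p)) = t * ((\<Sum>a\<in>UNIV. d_v a f p) * (\<Sum>b\<in>UNIV. d_v b h p))"
      unfolding sum_product unfolding sum_distrib_left ..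
    then show ?thesis by (simp add: sum_subtractf)
  qed
  finally show ?thesis by (simp add: intersection_form_def gform_def t_def mult.assoc)
qed

text \<open>Bilinearity. The offsets in the \<open>w\<close> and \<open>\<tau>\<close> components
  stand for the derivatives of the basis functions themselves, which belong to the gradient of the
  superpotential but not to the combination of the gradients of the
  \<open>\<phi>\<^sub>k\<close>.\<close>

lemma gform_sum:
  fixes Fv :: "nat \<Rightarrow> 'n::finite \<Rightarrow> complex"
  assumes "finite A"
  shows "gform (\<lambda>a. \<Sum>k\<in>A. \<alpha> k * Fv k a) ((\<Sum>k\<in>A. \<alpha> k * Fw k) + x) (\<Sum>k\<in>A. \<alpha> k * Fu k) ((\<Sum>k\<in>A. \<alpha> k * Ft k) + t)
          (\<lambda>a. \<Sum>k\<in>A. \<beta> k * Fv k a) ((\<Sum>k\<in>A. \<beta> k * Fw k) + x') (\<Sum>k\<in>A. \<beta> k * Fu k) ((\<Sum>k\<in>A. \<beta> k * Ft k) + t')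
     = (\<Sum>i\<in>A. \<Sum>j\<in>A. gform (Fv i) (Fw i) (Fu i) (Ft i) (Fv j) (Fw j) (Fu j) (Ft j) * (\<alpha> i * \<beta> j))
      - 1 / (of_nat CARD('n) * (of_nat CARD('n) + 1)) * (x' * (\<Sum>k\<in>A. \<alpha> k * Fw k) + x * (\<Sum>k\<in>A. \<beta> k * Fw k) + x * x')
      + (t' * (\<Sum>k\<in>A. \<alpha> k * Fu k) + t * (\<Sum>k\<in>A. \<beta> k * Fu k))"
proof -
  have pr: "(\<Sum>k\<in>A. \<alpha> k * X k) * (\<Sum>k\<in>A. \<beta> k * Y k) = (\<Sum>i\<in>A. \<Sum>j\<in>A. (X i * Y j) * (\<alpha> i * \<beta> j))" for X Y
    unfolding sum_product by (intro sum.cong refl) (simp only: mult_ac)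
  have v1: "(\<Sum>a\<in>UNIV. (\<Sum>k\<in>A. \<alpha> k * Fv k a) * (\<Sum>k\<in>A. \<beta> k * Fv k a))
      = (\<Sum>i\<in>A. \<Sum>j\<in>A. (\<Sum>a\<in>UNIV. Fv i a * Fv j a) * (\<alpha> i * \<beta> j))"
  proof -
    have "(\<Sum>a\<in>UNIV. (\<Sum>k\<in>A. \<alpha> k * Fv k a) * (\<Sum>k\<in>A. \<beta> k * Fv k a))
       = (\<Sum>a\<in>UNIV. \<Sum>i\<in>A. \<Sum>j\<in>A. (Fv i a * Fv j a) * (\<alpha> i * \<beta> j))" unfolding pr ..
    also have "\<dots> = (\<Sum>i\<in>A. \<Sum>a\<in>UNIV. \<Sum>j\<in>A. (Fv i a * Fv j a) * (\<alpha> i * \<beta> j))" by (rule sum.swap)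
    also have "\<dots> = (\<Sum>i\<in>A. \<Sum>j\<in>A. \<Sum>a\<in>UNIV. (Fv i a * Fv j a) * (\<alpha> i * \<beta> j))"
      by (intro sum.cong refl sum.swap)
    finally show ?thesis unfolding sum_distrib_right .
  qed
  have v2: "(\<Sum>a\<in>UNIV. \<Sum>k\<in>A. c k * Fv k a) = (\<Sum>k\<in>A. c k * (\<Sum>a\<in>UNIV. Fv k a))" for c
    unfolding sum_distrib_left by (rule sum.swap)
  let ?T = "1 / (of_nat CARD('n) + 1) :: complex" and ?C = "1 / (of_nat CARD('n) * (of_nat CARD('n) + 1)) :: complex"
  have "(\<Sum>i\<in>A. \<Sum>j\<in>A. gform (Fv i) (Fw i) (Fu i) (Ft i) (Fv j) (Fw j) (Fu j) (Ft j) * (\<alpha> i * \<beta> j))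
     = (\<Sum>i\<in>A. \<Sum>j\<in>A. (\<Sum>a\<in>UNIV. Fv i a * Fv j a) * (\<alpha> i * \<beta> j)
          - ?T * (((\<Sum>a\<in>UNIV. Fv i a) * (\<Sum>a\<in>UNIV. Fv j a)) * (\<alpha> i * \<beta> j))
          - ?C * ((Fw i * Fw j) * (\<alpha> i * \<beta> j)) + (Fu i * Ft j) * (\<alpha> i * \<beta> j) + (Ft i * Fu j) * (\<alpha> i * \<beta> j))"
    by (intro sum.cong refl) (simp add: gform_def distrib_right left_diff_distrib mult.assoc)
  also have "\<dots> = (\<Sum>a\<in>UNIV. (\<Sum>k\<in>A. \<alpha> k * Fv k a) * (\<Sum>k\<in>A. \<beta> k * Fv k a))
      - ?T * ((\<Sum>k\<in>A. \<alpha> k * (\<Sum>a\<in>UNIV. Fv k a)) * (\<Sum>k\<in>A. \<beta> k * (\<Sum>a\<in>UNIV. Fv k a)))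
      - ?C * ((\<Sum>k\<in>A. \<alpha> k * Fw k) * (\<Sum>k\<in>A. \<beta> k * Fw k))
      + (\<Sum>k\<in>A. \<alpha> k * Fu k) * (\<Sum>k\<in>A. \<beta> k * Ft k) + (\<Sum>k\<in>A. \<alpha> k * Ft k) * (\<Sum>k\<in>A. \<beta> k * Fu k)"
    unfolding v1 unfolding pr by (simp only: sum.distrib sum_subtractf sum_distrib_left[symmetric])
  finally have G: "(\<Sum>i\<in>A. \<Sum>j\<in>A. gform (Fv i) (Fw i) (Fu i) (Ft i) (Fv j) (Fw j) (Fu j) (Ft j) * (\<alpha> i * \<beta> j)) = \<dots>" .
  show ?thesis unfolding G unfolding gform_def v2
    by (simp only: distrib_left distrib_right mult.assoc) (simp add: algebra_simps)
qed

section \<open>Complex lines in the chart\<close>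

lemma bounded_linear_cscale: "bounded_linear (\<lambda>s. cscale s (h :: ('n::finite) point))"
proof -
  obtain a b c d where h: "h = (a, b, c, d)" by (metis prod.exhaust)
  have "linear (\<lambda>s. cscale s h)"
    by (rule linearI) (simp_all add: h cscale_def vec_eq_iff distrib_right)
  then show ?thesis by (simp add: linear_conv_bounded_linear)
qed

lemma cscale_0 [simp]: "cscale 0 h = 0"
  by (cases h) (simp add: cscale_def zero_prod_def)

lemma eventually_line_in:
  assumes "open U" "(p :: ('n::finite) point) \<in> U"
  shows "\<forall>\<^sub>F s in nhds 0. p + cscale s h \<in> U"
proof -
  have "isCont (\<lambda>s. p + cscale s h) 0"
    by (intro continuous_intros linear_continuous_at bounded_linear_cscale)
  then have "((\<lambda>s. p + cscale s h) \<longlongrightarrow> p) (nhds 0)"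
    by (simp add: isCont_def tendsto_nhds_iff)
  then show ?thesis using assms by (rule topological_tendstoD)
qed

text \<open>Complex linearity of the Frechet derivative turns \<open>D (cscale s h)\<close> into
  \<open>s\<close> times a fixed vector, so the restriction to a complex line is complex
  differentiable. This makes the \<open>deriv\<close> in \<open>partial_along\<close> a genuine
  derivative.\<close>

lemma phi_line_derivative:
  fixes \<phi> :: "nat \<Rightarrow> ('n::finite) point \<Rightarrow> complex"
  assumes hol: "holomorphic_map_on (phi_coords \<phi> e) U" and p: "p \<in> U"
    and e: "bij_betw e UNIV {1..CARD('n)}" and k: "k \<le> CARD('n)"
  shows "((\<lambda>s. \<phi> k (p + cscale s h)) has_field_derivative partial_along h (\<phi> k) p) (at 0)"
proof -
  obtain D where D: "(phi_coords \<phi> e has_derivative D) (at p)" "\<And>c h. D (cscale c h) = cscale c (D h)"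
    using hol p unfolding holomorphic_map_on_def by blast
  have line: "((\<lambda>s. p + cscale s h) has_derivative (\<lambda>s. cscale s h)) (at 0)"
    using has_derivative_add[OF has_derivative_const bounded_linear_imp_has_derivative[OF bounded_linear_cscale], of p h "at 0"]
    by simp
  have "((\<lambda>s. phi_coords \<phi> e (p + cscale s h)) has_derivative (\<lambda>s. D (cscale s h))) (at 0)"
    using has_derivative_compose[OF line] D(1) by simp
  then have comp: "((\<lambda>s. phi_coords \<phi> e (p + cscale s h)) has_derivative (\<lambda>s. cscale s (D h))) (at 0)"
    by (simp only: D(2))
  have "\<exists>d. ((\<lambda>s. \<phi> k (p + cscale s h)) has_field_derivative d) (at 0)"
  proof (cases "k = 0")
    case True
    have "((\<lambda>s. fst (phi_coords \<phi> e (p + cscale s h))) has_derivative (\<lambda>s. fst (cscale s (D h)))) (at 0)"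
      by (rule has_derivative_fst[OF comp])
    moreover have "(\<lambda>s. fst (cscale s (D h))) = (*) (fst (D h))"
      by (auto simp: cscale_def case_prod_unfold)
    ultimately show ?thesis using True unfolding has_field_derivative_def phi_coords_def by auto
  next
    case False
    then have "k \<in> e ` UNIV" using e k by (simp add: bij_betw_def)
    then obtain a where a: "e a = k" by auto
    have "((\<lambda>s. fst (snd (phi_coords \<phi> e (p + cscale s h))) $ a) has_derivative (\<lambda>s. fst (snd (cscale s (D h))) $ a)) (at 0)"
      by (rule bounded_linear.has_derivative[OF bounded_linear_vec_nth])
         (rule has_derivative_fst[OF has_derivative_snd[OF comp]])
    moreover have "(\<lambda>s. fst (snd (cscale s (D h))) $ a) = (*) (fst (snd (D h)) $ a)"
      by (auto simp: cscale_def case_prod_unfold)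
    ultimately show ?thesis using a unfolding has_field_derivative_def phi_coords_def by auto
  qed
  then show ?thesis unfolding partial_along_def by (metis DERIV_imp_deriv)
qed

definition generic_arg :: "('n::finite) point \<Rightarrow> complex \<Rightarrow> bool" where
  "generic_arg p z \<longleftrightarrow> (case p of (u, v, w, \<tau>) \<Rightarrow>
     z \<notin> period_lattice \<tau> \<and> z + (of_nat CARD('n) + 1) * w \<notin> period_lattice \<tau>
     \<and> (\<forall>a. z - v $ a + w \<notin> period_lattice \<tau>) \<and> z + (\<Sum>a\<in>UNIV. v $ a) + w \<notin> period_lattice \<tau>)"

lemma eventually_generic_arg:
  assumes "Im (tau_of (p :: ('n::finite) point)) > 0"
  shows "\<forall>\<^sub>F z in at 0. generic_arg p z"
proof -
  obtain u v w \<tau> where p: "p = (u, v, w, \<tau>)" by (metis prod.exhaust)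
  have t: "Im \<tau> > 0" using assms by (simp add: p tau_of_def)
  note E = eventually_not_period_lattice[OF t, of _ 0]
  have "\<forall>\<^sub>F z in at 0. \<forall>a\<in>UNIV. z - (v $ a - w) \<notin> period_lattice \<tau>"
    by (intro eventually_ball_finite ballI E) simp
  moreover note E[of 0] E[of "- ((of_nat CARD('n) + 1) * w)"] E[of "- ((\<Sum>a\<in>UNIV. v $ a) + w)"]
  ultimately show ?thesis
    by eventually_elim (simp add: generic_arg_def p algebra_simps)
qed

section \<open>The gradient of the superpotential in the chart\<close>

locale phi_chart =
  fixes \<phi> :: "nat \<Rightarrow> ('n::finite) point \<Rightarrow> complex" and e :: "'n \<Rightarrow> nat" and U :: "'n point set"
  assumes phi: "defines_phi \<phi>"
    and e: "bij_betw e UNIV {1..CARD('n)}"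
    and U: "U \<subseteq> Omega_reg" "local_coordinates_on (phi_coords \<phi> e) U"
begin

lemma open_U: "open U" and hol_U: "holomorphic_map_on (phi_coords \<phi> e) U"
  using U(2) by (auto simp: local_coordinates_on_def)

abbreviation "c_of (p :: 'n point) \<equiv> (of_nat CARD('n) + 1) * w_of p"
abbreviation "basis_at (p :: 'n point) k z \<equiv> phi_basis (tau_of p) (c_of p) k z"

text \<open>Product rule for
  \<open>\<lambda>(z) = \<Sum>\<^sub>k \<phi>\<^sub>k f\<^sub>k(z)\<close> at fixed
  \<open>z\<close>. The expansion has to hold along the line near \<open>p\<close> although
  \<open>\<tau>\<close>, and with it the lattice, may move; \<open>open_regular_set\<close> provides
  this.\<close>

lemma superpotential_line_derivative:
  assumes p: "p \<in> U" and z: "z \<notin> period_lattice (tau_of p)" "z + c_of p \<notin> period_lattice (tau_of p)"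
    and D: "\<And>k. ((\<lambda>s. basis_at (p + cscale s h) k z) has_field_derivative D k) (at 0)"
  shows "((\<lambda>s. superpotential (p + cscale s h) z) has_field_derivative
    (\<Sum>k\<le>CARD('n). basis_at p k z * partial_along h (\<phi> k) p) + (\<Sum>k\<le>CARD('n). \<phi> k p * D k)) (at 0)"
proof -
  have cont: "isCont (\<lambda>s. (x s, tau_of (p + cscale s h))) 0" if "isCont x 0" for x :: "complex \<Rightarrow> complex"
    unfolding tau_of_def
    by (intro continuous_intros that linear_continuous_at bounded_linear_cscale)
  have ev: "\<forall>\<^sub>F s in nhds 0. x s \<notin> period_lattice (tau_of (p + cscale s h))"
    if x: "isCont x 0" "x 0 \<notin> period_lattice (tau_of p)" for x :: "complex \<Rightarrow> complex"
  proof -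
    have "((\<lambda>s. (x s, tau_of (p + cscale s h))) \<longlongrightarrow> (x 0, tau_of p)) (nhds 0)"
      using cont[OF x(1)] by (simp add: isCont_def tendsto_nhds_iff)
    moreover have "(x 0, tau_of p) \<in> regular_set" using x(2) p U(1) by (auto simp: regular_set_def Omega_reg_def)
    ultimately have "\<forall>\<^sub>F s in nhds 0. (x s, tau_of (p + cscale s h)) \<in> regular_set"
      using topological_tendstoD[OF _ open_regular_set] by blast
    then show ?thesis by eventually_elim (simp add: regular_set_def)
  qed
  have "isCont (\<lambda>s. z + c_of (p + cscale s h)) 0"
    unfolding w_of_def by (intro continuous_intros linear_continuous_at bounded_linear_cscale)
  then have "\<forall>\<^sub>F s in nhds 0. z \<notin> period_lattice (tau_of (p + cscale s h)) \<and>
      z + c_of (p + cscale s h) \<notin> period_lattice (tau_of (p + cscale s h)) \<and> p + cscale s h \<in> U"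
    by (intro eventually_conj ev eventually_line_in open_U p) (use z in simp_all)
  then have evq: "\<forall>\<^sub>F s in nhds 0. superpotential (p + cscale s h) z
      = (\<Sum>k\<le>CARD('n). \<phi> k (p + cscale s h) * basis_at (p + cscale s h) k z)"
    by eventually_elim (use U(1) in \<open>auto intro!: superpotential_expansion[OF phi]\<close>)
  have "((\<lambda>s. \<Sum>k\<le>CARD('n). \<phi> k (p + cscale s h) * basis_at (p + cscale s h) k z) has_field_derivative
      (\<Sum>k\<le>CARD('n). partial_along h (\<phi> k) p * basis_at (p + cscale 0 h) k z + D k * \<phi> k (p + cscale 0 h))) (at 0)"
    by (intro DERIV_sum DERIV_mult D phi_line_derivative[OF hol_U p e]) simp
  from DERIV_cong_ev[OF refl evq refl, THEN iffD2, OF this]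
  show ?thesis by (simp add: sum.distrib mult.commute)
qed

text \<open>The derivatives of \<open>\<lambda>(z) = \<Sum>\<^sub>k \<phi>\<^sub>k f\<^sub>k(z)\<close> with the \<open>\<phi>\<^sub>k\<close> held fixed; none of them
  involves \<open>\<phi>\<^sub>0\<close>, because \<open>f\<^sub>0 = 1\<close>.\<close>

definition lam' :: "'n point \<Rightarrow> complex \<Rightarrow> complex" where
  "lam' p z = (\<Sum>k\<le>CARD('n). \<phi> k p * phi_basis' (tau_of p) (c_of p) k z)"

definition lam_w :: "'n point \<Rightarrow> complex \<Rightarrow> complex" where
  "lam_w p z = \<phi> 1 p * ((of_nat CARD('n) + 1) * (deriv (rho (tau_of p)) (c_of p) - deriv (rho (tau_of p)) (z + c_of p)))"

definition lam_tau :: "'n point \<Rightarrow> complex \<Rightarrow> complex" where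
  "lam_tau p z = (\<Sum>k\<le>CARD('n). \<phi> k p * phi_basis_tau (tau_of p) (c_of p) k z)"

lemma CARD_ge_1: "1 \<le> CARD('n)"
  by (simp add: Suc_leI)

text \<open>Each derivative of the superpotential is computed twice, from the expansion in the
  \<open>\<phi>\<^sub>k\<close> and from the theta quotient, and uniqueness of derivatives equates
  the results. The gradients of the \<open>\<phi>\<^sub>k\<close> thus become known in the
  combinations weighted by the basis functions.\<close>

lemma superpotential_gradient:
  fixes u w \<tau> z :: complex and v :: "complex ^ 'n"
  assumes p: "p \<in> U" and z: "generic_arg p z"
  assumes puvw: "p = (u, v, w, \<tau>)"
  defines "rn \<equiv> rho \<tau> (z + (\<Sum>a\<in>UNIV. v $ a) + w)" and "r \<equiv> (\<lambda>a. rho \<tau> (z - v $ a + w))"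
  defines "l \<equiv> (\<lambda>x. (deriv (rho \<tau>) x + (rho \<tau> x)\<^sup>2) / (4 * of_real pi * \<i>))"
  shows "(\<Sum>k\<le>CARD('n). basis_at p k z * d_u (\<phi> k) p) = superpotential p z * (- 2 * of_real pi * \<i>)"
    and "(\<Sum>k\<le>CARD('n). basis_at p k z * d_v a (\<phi> k) p) = superpotential p z * (rn - r a)"
    and "(\<Sum>k\<le>CARD('n). basis_at p k z * d_w (\<phi> k) p) + lam_w p z =
           superpotential p z * ((\<Sum>a\<in>UNIV. r a) + rn - (of_nat CARD('n) + 1) * rho \<tau> (z + c_of p))"
    and "(\<Sum>k\<le>CARD('n). basis_at p k z * d_tau (\<phi> k) p) + lam_tau p z / (2 * of_real pi * \<i>) =
           superpotential p z * ((\<Sum>a\<in>UNIV. l (z - v $ a + w)) + l (z + (\<Sum>a\<in>UNIV. v $ a) + w) - of_nat CARD('n) * l z - l (z + c_of p))"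
    and "lam' p z = superpotential p z * ((\<Sum>a\<in>UNIV. r a) + rn - of_nat CARD('n) * rho \<tau> z - rho \<tau> (z + c_of p))"
proof -
  have tw: "tau_of p = \<tau>" "w_of p = w" by (simp_all add: puvw tau_of_def w_of_def)
  have t: "Im \<tau> > 0" and c: "(of_nat CARD('n) + 1) * w \<notin> period_lattice \<tau>"
    using p U(1) by (auto simp: Omega_reg_def tw[symmetric])
  have g: "z \<notin> period_lattice \<tau>" "z + (of_nat CARD('n) + 1) * w \<notin> period_lattice \<tau>" "\<And>a. z - v $ a + w \<notin> period_lattice \<tau>"
    "z + (\<Sum>a\<in>UNIV. v $ a) + w \<notin> period_lattice \<tau>"
    using z by (auto simp: generic_arg_def puvw)
  have zg: "z \<notin> period_lattice (tau_of p)" "z + c_of p \<notin> period_lattice (tau_of p)" using g by (simp_all add: tw)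
  note S = superpotential_deriv[OF t g(3,4,1,2), where hz = 0 and u = u, folded puvw, simplified]
  have ffs: "basis_at (p + cscale s (hu, hv, hw, ht)) k z = phi_basis (\<tau> + s * ht) ((of_nat CARD('n) + 1) * (w + s * hw)) k z" for s hu hv hw ht k
    by (simp add: puvw tau_of_def w_of_def cscale_def)
  have D0: "((\<lambda>s. basis_at (p + cscale s (hu, hv, 0, 0)) k z) has_field_derivative 0) (at 0)" for hu hv k
    unfolding ffs by simp
  show "(\<Sum>k\<le>CARD('n). basis_at p k z * d_u (\<phi> k) p) = superpotential p z * (- 2 * of_real pi * \<i>)"
    using DERIV_unique[OF superpotential_line_derivative[OF p zg D0] S] by simp
  have ax: "(\<Sum>x\<in>UNIV. axis a (1::complex) $ x) = 1" "(\<Sum>x\<in>UNIV. f x * axis a (1::complex) $ x) = f a" for f :: "'n \<Rightarrow> complex"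
    by (simp_all add: axis_def if_distrib cong: if_cong)
  show "(\<Sum>k\<le>CARD('n). basis_at p k z * d_v a (\<phi> k) p) = superpotential p z * (rn - r a)"
    using DERIV_unique[OF superpotential_line_derivative[OF p zg D0] S]
    by (simp add: ax sum_negf rn_def r_def)
  have Dw: "((\<lambda>s. basis_at (p + cscale s (0, 0, 1, 0)) k z) has_field_derivative
      (if k = 1 then (of_nat CARD('n) + 1) * (deriv (rho \<tau>) ((of_nat CARD('n) + 1) * w) - deriv (rho \<tau>) (z + (of_nat CARD('n) + 1) * w)) else 0)) (at 0)" for k
  proof -
    have "((\<lambda>s. phi_basis \<tau> ((of_nat CARD('n) + 1) * (s + w)) k z) has_field_derivative
      (if k = 1 then (of_nat CARD('n) + 1) * (deriv (rho \<tau>) ((of_nat CARD('n) + 1) * w) - deriv (rho \<tau>) (z + (of_nat CARD('n) + 1) * w)) else 0)) (at 0)"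
      using phi_basis_w_deriv[OF t g(2) c, of k] DERIV_shift[of "\<lambda>w. phi_basis \<tau> ((of_nat CARD('n) + 1) * w) k z" _ 0 w] by simp
    then show ?thesis unfolding ffs by (simp add: add.commute)
  qed
  have "(\<Sum>k\<le>CARD('n). \<phi> k p * (if k = 1 then (of_nat CARD('n) + 1) * (deriv (rho \<tau>) ((of_nat CARD('n) + 1) * w) - deriv (rho \<tau>) (z + (of_nat CARD('n) + 1) * w)) else 0))
      = lam_w p z"
    using CARD_ge_1 by (simp add: lam_w_def tw if_distrib cong: if_cong)
  with DERIV_unique[OF superpotential_line_derivative[OF p zg Dw] S]
  show "(\<Sum>k\<le>CARD('n). basis_at p k z * d_w (\<phi> k) p) + lam_w p z =
           superpotential p z * ((\<Sum>a\<in>UNIV. r a) + rn - (of_nat CARD('n) + 1) * rho \<tau> (z + c_of p))"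
    by (simp add: rn_def r_def tw mult.commute)
  have Dt: "((\<lambda>s. basis_at (p + cscale s (0, 0, 0, 1)) k z) has_field_derivative
      phi_basis_tau \<tau> ((of_nat CARD('n) + 1) * w) k z / (2 * of_real pi * \<i>)) (at 0)" for k
  proof -
    have "((\<lambda>s. phi_basis (s + \<tau>) ((of_nat CARD('n) + 1) * w) k z) has_field_derivative
      phi_basis_tau \<tau> ((of_nat CARD('n) + 1) * w) k z / (2 * of_real pi * \<i>)) (at 0)"
      using phi_basis_tau_deriv[OF t g(1,2) c, of k] DERIV_shift[of "\<lambda>\<tau>. phi_basis \<tau> ((of_nat CARD('n) + 1) * w) k z" _ 0 \<tau>] by simp
    then show ?thesis unfolding ffs by (simp add: add.commute)
  qed
  have "(\<Sum>k\<le>CARD('n). \<phi> k p * (phi_basis_tau \<tau> ((of_nat CARD('n) + 1) * w) k z / (2 * of_real pi * \<i>))) = lam_tau p z / (2 * of_real pi * \<i>)"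
    by (simp add: lam_tau_def tw sum_divide_distrib)
  with DERIV_unique[OF superpotential_line_derivative[OF p zg Dt]
      superpotential_deriv_tau[OF t g(3,4,1,2), where u = u, folded puvw l_def]]
  show "(\<Sum>k\<le>CARD('n). basis_at p k z * d_tau (\<phi> k) p) + lam_tau p z / (2 * of_real pi * \<i>) =
           superpotential p z * ((\<Sum>a\<in>UNIV. l (z - v $ a + w)) + l (z + (\<Sum>a\<in>UNIV. v $ a) + w) - of_nat CARD('n) * l z - l (z + c_of p))"
    by (simp add: tw l_def)
  have cz: "cscale s (0, 0, 0, 0) = (0 :: 'n point)" for s by (simp add: cscale_def zero_prod_def)
  have "((\<lambda>s. superpotential p (z + s)) has_field_derivative
      superpotential p z * ((\<Sum>a\<in>UNIV. r a) + rn - of_nat CARD('n) * rho \<tau> z - rho \<tau> (z + c_of p))) (at 0)"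
    using superpotential_deriv[OF t g(3,4,1,2), where hz = 1 and u = u and hu = 0 and hv = 0 and hw = 0, folded puvw]
    by (simp add: tw r_def rn_def cz)
  moreover have "((\<lambda>s. superpotential p (z + s)) has_field_derivative lam' p z) (at 0)"
  proof -
    have d: "((\<lambda>x. \<Sum>k\<le>CARD('n). \<phi> k p * basis_at p k x) has_field_derivative lam' p z) (at z)"
      unfolding lam'_def tw using g by (intro DERIV_sum DERIV_cmult phi_basis_deriv t) auto
    have ev: "\<forall>\<^sub>F x in nhds z. (\<Sum>k\<le>CARD('n). \<phi> k p * basis_at p k x) = superpotential p x"
    proof -
      have "open (- period_lattice \<tau> \<inter> (\<lambda>x. x + (of_nat CARD('n) + 1) * w) -` (- period_lattice \<tau>))"
        by (intro open_Int open_vimage open_compl_period_lattice t continuous_intros)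
      then have "\<forall>\<^sub>F x in nhds z. x \<in> - period_lattice \<tau> \<inter> (\<lambda>x. x + (of_nat CARD('n) + 1) * w) -` (- period_lattice \<tau>)"
        by (rule eventually_nhds_in_open) (use g in simp)
      then show ?thesis
      proof eventually_elim
        case (elim x)
        have "superpotential p x = (\<Sum>k\<le>CARD('n). \<phi> k p * basis_at p k x)"
          by (rule superpotential_expansion[OF phi]) (use p U(1) elim in \<open>auto simp: tw\<close>)
        then show ?case ..
      qed
    qed
    have "(superpotential p has_field_derivative lam' p z) (at z)"
      by (rule DERIV_cong_ev[OF refl ev refl, THEN iffD1, OF d])
    then have "((\<lambda>s. superpotential p (s + z)) has_field_derivative lam' p z) (at 0)"
      using DERIV_shift[of "superpotential p" _ 0 z] by simp
    then show ?thesis by (simp add: add.commute)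
  qed
  ultimately show "lam' p z = superpotential p z * ((\<Sum>a\<in>UNIV. r a) + rn - of_nat CARD('n) * rho \<tau> z - rho \<tau> (z + c_of p))"
    by (rule DERIV_unique[symmetric])
qed

section \<open>The intersection form evaluated on the superpotential\<close>

definition g_coeff :: "'n point \<Rightarrow> nat \<Rightarrow> nat \<Rightarrow> complex" where
  "g_coeff p i j = intersection_form (\<phi> i) (\<phi> j) p"

text \<open>The values \<open>lz, ly\<close> of \<open>\<lambda>\<close> are arguments of their own because they carry all the
  dependence on \<open>\<phi>\<^sub>0\<close>.\<close>

definition superpotential_form :: "'n point \<Rightarrow> complex \<Rightarrow> complex \<Rightarrow> complex \<Rightarrow> complex \<Rightarrow> complex" where
  "superpotential_form p z y lz ly = (let \<tau> = tau_of p; c = c_of p; \<kappa> = rho \<tau> (z - y); N = of_nat CARD('n) in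
     - (1 / N) * lam' p z * lam' p y - lam' p z * ly * (rho \<tau> y + \<kappa>) - lz * lam' p y * (rho \<tau> z - \<kappa>)
     + 1 / (N * (N + 1)) * (lam_w p y * (lam' p z + N * lz * (rho \<tau> z - rho \<tau> (z + c)))
         + lam_w p z * (lam' p y + N * ly * (rho \<tau> y - rho \<tau> (y + c))) - lam_w p z * lam_w p y)
     + (lam_tau p y * lz + lam_tau p z * ly))"

text \<open>The double sum is the form on \<open>d\<lambda>(z)\<close> and
  \<open>d\<lambda>(y)\<close> without the parts that come from the basis functions.
  \<open>gform_sum\<close> separates these parts, and \<open>log_superpotential_form\<close>
  collapses the full form. Each product \<open>\<lambda>(z) \<lambda>(y)\<close> is absorbed into a
  z-derivative, because \<open>\<lambda>' = \<lambda> L\<close> with the logarithmic derivative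
  \<open>L\<close>.\<close>

lemma intersection_form_superpotential:
  assumes p: "p \<in> U" and z: "generic_arg p z" and y: "generic_arg p y" and zy: "z - y \<notin> period_lattice (tau_of p)"
  shows "(\<Sum>i\<le>CARD('n). \<Sum>j\<le>CARD('n). g_coeff p i j * (basis_at p i z * basis_at p j y))
    = superpotential_form p z y (superpotential p z) (superpotential p y)"
proof -
  obtain u v w \<tau> where puvw: "p = (u, v, w, \<tau>)" by (metis prod.exhaust)
  have tw: "tau_of p = \<tau>" "w_of p = w" by (simp_all add: puvw tau_of_def w_of_def)
  have t: "Im \<tau> > 0" using p U(1) by (auto simp: Omega_reg_def tw[symmetric])
  define N where "N = (of_nat CARD('n) :: complex)"
  have N0: "N \<noteq> 0" "N + 1 \<noteq> 0"
  proof -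
    show "N \<noteq> 0" unfolding N_def by simp
    have "N + 1 = of_nat (Suc CARD('n))" unfolding N_def by simp
    then show "N + 1 \<noteq> 0" by (simp only: of_nat_eq_0_iff; simp)
  qed
  define c where "c = c_of p"
  have cN: "c = (N + 1) * w" by (simp add: c_def N_def tw)
  define lz ly where "lz = superpotential p z" and "ly = superpotential p y"
  define r s where "r = (\<lambda>a. rho \<tau> (z - v $ a + w))" and "s = (\<lambda>a. rho \<tau> (y - v $ a + w))"
  define rn sn where "rn = rho \<tau> (z + (\<Sum>a\<in>UNIV. v $ a) + w)" and "sn = rho \<tau> (y + (\<Sum>a\<in>UNIV. v $ a) + w)"
  define r' s' where "r' = (\<lambda>a. deriv (rho \<tau>) (z - v $ a + w))" and "s' = (\<lambda>a. deriv (rho \<tau>) (y - v $ a + w))"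
  define rn' sn' where "rn' = deriv (rho \<tau>) (z + (\<Sum>a\<in>UNIV. v $ a) + w)" and "sn' = deriv (rho \<tau>) (y + (\<Sum>a\<in>UNIV. v $ a) + w)"
  define A B P Q where "A = rho \<tau> z" and "B = rho \<tau> y" and "P = rho \<tau> (z + c)" and "Q = rho \<tau> (y + c)"
  define A' B' P' Q' where "A' = deriv (rho \<tau>) z" and "B' = deriv (rho \<tau>) y"
    and "P' = deriv (rho \<tau>) (z + c)" and "Q' = deriv (rho \<tau>) (y + c)"
  define K where "K = rho \<tau> (z - y)"
  obtain \<kappa> where \<kappa>: "\<And>p q. p \<notin> period_lattice \<tau> \<Longrightarrow> q \<notin> period_lattice \<tau> \<Longrightarrow> p - q \<notin> period_lattice \<tau>
      \<Longrightarrow> (rho \<tau> p - rho \<tau> q)\<^sup>2 + deriv (rho \<tau>) p + deriv (rho \<tau>) q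
        = 2 * (rho \<tau> p - rho \<tau> q) * rho \<tau> (p - q) - (rho \<tau> (p - q))\<^sup>2 - deriv (rho \<tau>) (p - q) + \<kappa>"
    using rho_add_eq[OF t] by metis
  \<comment> \<open>Depends on \<open>z - y\<close> only, hence is common to all pairs of theta
    arguments.\<close>
  define k where "k = K\<^sup>2 + deriv (rho \<tau>) (z - y) - \<kappa>"
  have add: "(rho \<tau> a - rho \<tau> b)\<^sup>2 + deriv (rho \<tau>) a + deriv (rho \<tau>) b = 2 * (rho \<tau> a - rho \<tau> b) * K - k"
    if "a \<notin> period_lattice \<tau>" "b \<notin> period_lattice \<tau>" "a - b = z - y" for a b
    using \<kappa>[OF that(1,2)] that(3) zy by (simp add: K_def k_def tw)
  have gz: "z \<notin> period_lattice \<tau>" "z + c \<notin> period_lattice \<tau>" "\<And>a. z - v $ a + w \<notin> period_lattice \<tau>"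
    "z + (\<Sum>a\<in>UNIV. v $ a) + w \<notin> period_lattice \<tau>"
    using z by (auto simp: generic_arg_def puvw cN N_def)
  have gy: "y \<notin> period_lattice \<tau>" "y + c \<notin> period_lattice \<tau>" "\<And>a. y - v $ a + w \<notin> period_lattice \<tau>"
    "y + (\<Sum>a\<in>UNIV. v $ a) + w \<notin> period_lattice \<tau>"
    using y by (auto simp: generic_arg_def puvw cN N_def)
  note Gz = superpotential_gradient[OF p z puvw, folded N_def c_def lz_def r_def rn_def]
  note Gy = superpotential_gradient[OF p y puvw, folded N_def c_def ly_def s_def sn_def]
  define R S where "R = (\<Sum>a\<in>UNIV. r a) + rn" and "S = (\<Sum>a\<in>UNIV. s a) + sn"
  define Lz Ly where "Lz = R - N * A - P" and "Ly = S - N * B - Q"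
  have ld: "lam' p z = lz * Lz" "lam' p y = ly * Ly"
    using Gz(5) Gy(5) by (simp_all add: Lz_def Ly_def R_def S_def A_def B_def P_def Q_def)
  define Tz where "Tz = (\<Sum>a\<in>UNIV. r' a + (r a)\<^sup>2) + (rn' + rn\<^sup>2) - N * (A' + A\<^sup>2) - (P' + P\<^sup>2)"
  define Ty where "Ty = (\<Sum>a\<in>UNIV. s' a + (s a)\<^sup>2) + (sn' + sn\<^sup>2) - N * (B' + B\<^sup>2) - (Q' + Q\<^sup>2)"
  \<comment> \<open>The u-derivative contributes \<open>- ii / 2\<close> and the heat equation a
    division by \<open>ii\<close>; together they give the \<open>- 1 / 2\<close> of
    \<open>log_superpotential_form\<close>.\<close>
  define ii where "ii = 4 * complex_of_real pi * \<i>"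
  have ii0: "ii \<noteq> 0" by (simp add: ii_def)
  have uz: "(\<Sum>k\<le>CARD('n). basis_at p k z * d_u (\<phi> k) p) = lz * (- (ii / 2))"
    "(\<Sum>k\<le>CARD('n). basis_at p k y * d_u (\<phi> k) p) = ly * (- (ii / 2))"
    using Gz(1) Gy(1) unfolding c_def[symmetric] by (simp_all add: ii_def mult_ac)
  have tz: "(\<Sum>k\<le>CARD('n). basis_at p k z * d_tau (\<phi> k) p) + lam_tau p z / (ii / 2) = lz * (Tz / ii)"
    "(\<Sum>k\<le>CARD('n). basis_at p k y * d_tau (\<phi> k) p) + lam_tau p y / (ii / 2) = ly * (Ty / ii)"
  proof -
    have 1: "(a + b - N * x - y) / ii = a / ii + b / ii - N * (x / ii) - y / ii" for a b x y
      by (simp add: add_divide_distrib diff_divide_distrib)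
    have 2: "ii / 2 = 2 * of_real pi * \<i>" by (simp add: ii_def)
    show "(\<Sum>k\<le>CARD('n). basis_at p k z * d_tau (\<phi> k) p) + lam_tau p z / (ii / 2) = lz * (Tz / ii)"
      using Gz(4) unfolding c_def[symmetric] Tz_def 1 2 sum_divide_distrib
      unfolding r_def rn_def r'_def rn'_def A_def P_def A'_def P'_def ii_def by simp
    show "(\<Sum>k\<le>CARD('n). basis_at p k y * d_tau (\<phi> k) p) + lam_tau p y / (ii / 2) = ly * (Ty / ii)"
      using Gy(4) unfolding c_def[symmetric] Ty_def 1 2 sum_divide_distrib
      unfolding s_def sn_def s'_def sn'_def B_def Q_def B'_def Q'_def ii_def by simp
  qed
  have wz: "(\<Sum>k\<le>CARD('n). basis_at p k z * d_w (\<phi> k) p) + lam_w p z = lz * (R - (N + 1) * P)"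
    "(\<Sum>k\<le>CARD('n). basis_at p k y * d_w (\<phi> k) p) + lam_w p y = ly * (S - (N + 1) * Q)"
    using Gz(3) Gy(3) unfolding c_def[symmetric] by (simp_all add: R_def S_def P_def Q_def)
  have "gform (\<lambda>a. lz * (rn - r a)) (lz * (R - (N + 1) * P)) (lz * (- (ii / 2))) (lz * (Tz / ii))
          (\<lambda>a. ly * (sn - s a)) (ly * (S - (N + 1) * Q)) (ly * (- (ii / 2))) (ly * (Ty / ii))
     = (\<Sum>i\<le>CARD('n). \<Sum>j\<le>CARD('n). g_coeff p i j * (basis_at p i z * basis_at p j y))
      - 1 / (N * (N + 1)) * (lam_w p y * (\<Sum>k\<le>CARD('n). basis_at p k z * d_w (\<phi> k) p)
          + lam_w p z * (\<Sum>k\<le>CARD('n). basis_at p k y * d_w (\<phi> k) p) + lam_w p z * lam_w p y)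
      + (lam_tau p y / (ii / 2) * (lz * (- (ii / 2))) + lam_tau p z / (ii / 2) * (ly * (- (ii / 2))))"
    using gform_sum[of "{..CARD('n)}" "\<lambda>k. basis_at p k z" "\<lambda>k a. d_v a (\<phi> k) p" "\<lambda>k. d_w (\<phi> k) p" "lam_w p z"
        "\<lambda>k. d_u (\<phi> k) p" "\<lambda>k. d_tau (\<phi> k) p" "lam_tau p z / (ii / 2)"
        "\<lambda>k. basis_at p k y" "lam_w p y" "lam_tau p y / (ii / 2)"]
    unfolding c_def[symmetric]
    unfolding Gz(2) Gy(2) uz[folded c_def] tz[folded c_def] wz[folded c_def] intersection_form_gform[symmetric] g_coeff_def[symmetric]
    unfolding N_def[symmetric] using ii0 by (simp add: r_def s_def)
  moreover have "(\<Sum>k\<le>CARD('n). basis_at p k z * d_w (\<phi> k) p) = lz * (R - (N + 1) * P) - lam_w p z"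
    "(\<Sum>k\<le>CARD('n). basis_at p k y * d_w (\<phi> k) p) = ly * (S - (N + 1) * Q) - lam_w p y"
    unfolding eq_diff_eq by (rule wz)+
  moreover have "gform (\<lambda>a. lz * (rn - r a)) (lz * (R - (N + 1) * P)) (lz * (- (ii / 2))) (lz * (Tz / ii))
          (\<lambda>a. ly * (sn - s a)) (ly * (S - (N + 1) * Q)) (ly * (- (ii / 2))) (ly * (Ty / ii))
     = lz * ly * (- (1 / N) * Lz * Ly - Lz * (B + K) - Ly * (A - K))"
  proof -
    have "ii \<noteq> 0" by (simp add: ii_def)
    then have "gform (\<lambda>a. lz * (rn - r a)) (lz * (R - (N + 1) * P)) (lz * (- (ii / 2))) (lz * (Tz / ii))
          (\<lambda>a. ly * (sn - s a)) (ly * (S - (N + 1) * Q)) (ly * (- (ii / 2))) (ly * (Ty / ii))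
      = lz * ly * ((\<Sum>a\<in>UNIV. (rn - r a) * (sn - s a)) - 1 / (N + 1) * (\<Sum>a\<in>UNIV. rn - r a) * (\<Sum>a\<in>UNIV. sn - s a)
     - 1 / (N * (N + 1)) * (R - (N + 1) * P) * (S - (N + 1) * Q) - 1 / 2 * Ty - 1 / 2 * Tz)"
    proof -
      have 1: "(\<Sum>a\<in>UNIV. lz * (rn - r a) * (ly * (sn - s a))) = lz * ly * (\<Sum>a\<in>UNIV. (rn - r a) * (sn - s a))"
        unfolding sum_distrib_left by (intro sum.cong refl) (simp only: mult_ac)
      have 2: "lz * (- (ii / 2)) * (ly * (Ty / ii)) = lz * ly * (- (1 / 2 * Ty))"
        "lz * (Tz / ii) * (ly * (- (ii / 2))) = lz * ly * (- (1 / 2 * Tz))"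
        using \<open>ii \<noteq> 0\<close> by simp_all
      have 3: "q * (lz * x) * (ly * y) = lz * ly * (q * x * y)" for q x y by (simp only: mult_ac)
      show ?thesis
        unfolding gform_def N_def[symmetric] 1 2 sum_distrib_left[symmetric] 3
        by (simp only: diff_conv_add_uminus mult_minus_right distrib_left add_ac)
    qed
    also have "(\<Sum>a\<in>UNIV. (rn - r a) * (sn - s a)) - 1 / (N + 1) * (\<Sum>a\<in>UNIV. rn - r a) * (\<Sum>a\<in>UNIV. sn - s a)
     - 1 / (N * (N + 1)) * (R - (N + 1) * P) * (S - (N + 1) * Q) - 1 / 2 * Ty - 1 / 2 * Tz
      = - (1 / N) * Lz * Ly - Lz * (B + K) - Ly * (A - K)"
      unfolding Ty_def Tz_def Lz_def Ly_def R_def S_def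
      by (rule log_superpotential_form[OF N_def, where k = k])
         (unfold r_def s_def r'_def s'_def rn_def sn_def rn'_def sn'_def A_def B_def A'_def B'_def P_def Q_def P'_def Q'_def,
          (rule add; (use gz gy in simp))+)
    finally show ?thesis .
  qed
  ultimately have "(\<Sum>i\<le>CARD('n). \<Sum>j\<le>CARD('n). g_coeff p i j * (basis_at p i z * basis_at p j y))
     = lz * ly * (- (1 / N) * Lz * Ly - Lz * (B + K) - Ly * (A - K))
      + 1 / (N * (N + 1)) * (lam_w p y * (lz * (R - (N + 1) * P) - lam_w p z)
          + lam_w p z * (ly * (S - (N + 1) * Q) - lam_w p y) + lam_w p z * lam_w p y)
      - (lam_tau p y / (ii / 2) * (lz * (- (ii / 2))) + lam_tau p z / (ii / 2) * (ly * (- (ii / 2))))"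
    by (simp only: diff_add_eq eq_diff_eq add_diff_eq diff_eq_eq)
  also have "lam_tau p y / (ii / 2) * (lz * (- (ii / 2))) + lam_tau p z / (ii / 2) * (ly * (- (ii / 2)))
      = - (lam_tau p y * lz + lam_tau p z * ly)"
    by (simp add: ii_def)
  also have "lz * (R - (N + 1) * P) = lam' p z + N * lz * (A - P)"
    unfolding ld Lz_def by (simp add: algebra_simps)
  also have "ly * (S - (N + 1) * Q) = lam' p y + N * ly * (B - Q)"
    unfolding ld Ly_def by (simp add: algebra_simps)
  also have "lz * ly * (- (1 / N) * Lz * Ly - Lz * (B + K) - Ly * (A - K))
     = - (1 / N) * lam' p z * lam' p y - lam' p z * ly * (B + K) - lz * lam' p y * (A - K)"
    unfolding ld by (simp add: algebra_simps)
  finally show ?thesis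
    unfolding superpotential_form_def Let_def lz_def[symmetric] ly_def[symmetric] tw N_def[symmetric]
      cN[symmetric] A_def[symmetric] B_def[symmetric] P_def[symmetric] Q_def[symmetric] K_def[symmetric]
    by (simp add: algebra_simps)
qed

section \<open>The slope of the intersection form in \<open>\<phi>\<^sub>0\<close>\<close>

text \<open>The values of \<open>eta_star\<close> before the correction. In the mixed case one index
  is 0, so \<open>i + j\<close> is the other one. The entry (0, 0) collects what
  \<open>phi_defect_1\<close> and \<open>phi_defect_ge_2\<close> leave free of \<open>z\<close> and
  \<open>y\<close>.\<close>

definition eta_value :: "'n point \<Rightarrow> nat \<Rightarrow> nat \<Rightarrow> complex" where
  "eta_value p i j = (let \<tau> = tau_of p; c = c_of p in
     if i = 0 \<and> j = 0 then \<phi> 1 p * (2 * rho_tau \<tau> c - 2 * deriv (rho \<tau>) c * rho \<tau> c)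
         + \<phi> 2 p * (4 * of_real pi * \<i> * deriv \<gamma>\<^sub>1 \<tau> - 2 * (\<gamma>\<^sub>1 \<tau>)\<^sup>2)
     else if i = 0 \<or> j = 0 then
       (if i + j = 1 then deriv (rho \<tau>) c * \<phi> 1 p else of_nat (i + j) * \<gamma>\<^sub>1 \<tau> * \<phi> (i + j) p)
     else if i = 1 \<or> j = 1 then 0
     else - (of_nat (i + j - 2) * \<phi> (i + j - 2) p))"

lemma sum_atMost_CARD: "(\<Sum>k\<le>CARD('n). F k) = F 0 + F 1 + (\<Sum>k=2..CARD('n). F k)" for F :: "nat \<Rightarrow> complex"
proof -
  have "{..CARD('n)} = {0,1} \<union> {2..CARD('n)}" using CARD_ge_1 by auto
  then show ?thesis by (simp add: sum.union_disjoint)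
qed

text \<open>The right-hand side is the coefficient of \<delta> when both superpotential values in
  \<open>superpotential_form\<close> grow by \<delta>. Summing the expansions of
  \<open>phi_defect\<close> with weights \<open>\<phi>\<^sub>k\<close> and sorting by products of
  basis functions yields the entries; pole orders \<open>i\<close> and \<open>j\<close> with sum
  \<open>k + 2\<close> give the index \<open>k = i + j - 2\<close>.\<close>

lemma eta_value_sum:
  assumes conv: "\<And>m. m > CARD('n) \<Longrightarrow> \<phi> m p = 0"
    and p: "p \<in> U" and z: "generic_arg p z" and y: "generic_arg p y" and zy: "z - y \<notin> period_lattice (tau_of p)"
  shows "(\<Sum>i\<le>CARD('n). \<Sum>j\<le>CARD('n). eta_value p i j * (basis_at p i z * basis_at p j y))
    = - lam' p z * (rho (tau_of p) y + rho (tau_of p) (z - y)) - lam' p y * (rho (tau_of p) z - rho (tau_of p) (z - y))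
      + 1 / (of_nat CARD('n) + 1) * (lam_w p y * (rho (tau_of p) z - rho (tau_of p) (z + c_of p))
           + lam_w p z * (rho (tau_of p) y - rho (tau_of p) (y + c_of p)))
      + (lam_tau p y + lam_tau p z)"
proof -
  define n where "n = CARD('n)"
  define \<tau> c where "\<tau> = tau_of p" and "c = c_of p"
  have t: "Im \<tau> > 0" using p U(1) by (auto simp: Omega_reg_def \<tau>_def)
  have gz: "z \<notin> period_lattice \<tau>" "z + c \<notin> period_lattice \<tau>" and gy: "y \<notin> period_lattice \<tau>" "y + c \<notin> period_lattice \<tau>"
    using z y by (auto simp: generic_arg_def \<tau>_def c_def tau_of_def w_of_def)
  note zy = zy[folded \<tau>_def]
  define f g where "f = (\<lambda>k. phi_basis \<tau> c k z)" and "g = (\<lambda>k. phi_basis \<tau> c k y)"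
  define D where "D = (\<lambda>k. phi_defect \<tau> c k z y)"
  define \<gamma> where "\<gamma> = \<gamma>\<^sub>1 \<tau>"
  define C1 where "C1 = 2 * rho_tau \<tau> c - 2 * deriv (rho \<tau>) c * rho \<tau> c"
  define C2 where "C2 = 4 * of_real pi * \<i> * deriv \<gamma>\<^sub>1 \<tau> - 2 * \<gamma>\<^sup>2"
  define d where "d = deriv (rho \<tau>) c"
  have fg0: "f 0 = 1" "g 0 = 1" by (simp_all add: f_def g_def phi_basis_def)
  define X where "X = (rho \<tau> z - rho \<tau> (z + c)) * (deriv (rho \<tau>) c - deriv (rho \<tau>) (y + c))
     + (rho \<tau> y - rho \<tau> (y + c)) * (deriv (rho \<tau>) c - deriv (rho \<tau>) (z + c))"
  have D0: "D 0 = 0" by (simp add: D_def phi_defect_0)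
  have D1: "D 1 + X = d * (f 1 + g 1) + C1"
    using phi_defect_1[OF t gz gy zy] by (simp add: D_def X_def f_def g_def C1_def d_def add.assoc)
  have Dk: "D k = - (of_nat k * (\<Sum>i=2..k. f i * g (k + 2 - i))) + of_nat k * \<gamma> * (f k + g k) + (if k = 2 then C2 else 0)"
    if "k \<ge> 2" for k
    using phi_defect_ge_2[OF t gz(1) gy(1) zy that, of c] by (simp add: D_def f_def g_def C2_def \<gamma>_def)
  have "(\<Sum>k\<le>n. \<phi> k p * D k) = - lam' p z * (rho \<tau> y + rho \<tau> (z - y)) - lam' p y * (rho \<tau> z - rho \<tau> (z - y))
      + (lam_tau p y + lam_tau p z)"
    unfolding D_def phi_defect_def lam'_def lam_tau_def n_def \<tau>_def[symmetric] c_def[symmetric]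
    by (simp add: sum_distrib_left sum_negf sum_subtractf sum.distrib algebra_simps)
  moreover have "1 / (of_nat CARD('n) + 1) * (lam_w p y * (rho \<tau> z - rho \<tau> (z + c)) + lam_w p z * (rho \<tau> y - rho \<tau> (y + c)))
      = \<phi> 1 p * X"
  proof -
    define M where "M = (of_nat CARD('n) + 1 :: complex)"
    have "M = of_nat (Suc CARD('n))" unfolding M_def by simp
    then have M: "M \<noteq> 0" by (simp only: of_nat_eq_0_iff; simp)
    have lw: "lam_w p z = M * (\<phi> 1 p * (deriv (rho \<tau>) c - deriv (rho \<tau>) (z + c)))" for z
      by (simp add: lam_w_def M_def \<tau>_def c_def)
    show ?thesis unfolding M_def[symmetric] X_def lw using M by (simp add: field_simps)
  qed
  ultimately have rhs: "- lam' p z * (rho \<tau> y + rho \<tau> (z - y)) - lam' p y * (rho \<tau> z - rho \<tau> (z - y))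
      + 1 / (of_nat CARD('n) + 1) * (lam_w p y * (rho \<tau> z - rho \<tau> (z + c)) + lam_w p z * (rho \<tau> y - rho \<tau> (y + c)))
      + (lam_tau p y + lam_tau p z) = (\<Sum>k\<le>n. \<phi> k p * D k) + \<phi> 1 p * X" by simp
  have "(\<Sum>k\<le>n. \<phi> k p * D k) + \<phi> 1 p * X = \<phi> 1 p * (d * (f 1 + g 1) + C1) + (\<Sum>k=2..n. \<phi> k p * D k)"
    unfolding D1[symmetric] n_def sum_atMost_CARD D0 by (simp add: algebra_simps)
  also have "(\<Sum>k=2..n. \<phi> k p * D k) = - (\<Sum>k=2..n. of_nat k * \<phi> k p * (\<Sum>i=2..k. f i * g (k + 2 - i)))
      + (\<Sum>k=2..n. of_nat k * \<gamma> * \<phi> k p * (f k + g k)) + \<phi> 2 p * C2"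
  proof -
    have "(\<Sum>k=2..n. \<phi> k p * D k) = (\<Sum>k=2..n. - (of_nat k * \<phi> k p * (\<Sum>i=2..k. f i * g (k + 2 - i)))
      + of_nat k * \<gamma> * \<phi> k p * (f k + g k) + (if k = 2 then \<phi> 2 p * C2 else 0))"
      by (intro sum.cong refl) (auto simp: Dk algebra_simps)
    also have "\<dots> = - (\<Sum>k=2..n. of_nat k * \<phi> k p * (\<Sum>i=2..k. f i * g (k + 2 - i)))
      + (\<Sum>k=2..n. of_nat k * \<gamma> * \<phi> k p * (f k + g k)) + (\<Sum>k=2..n. if k = 2 then \<phi> 2 p * C2 else 0)"
      by (simp only: sum.distrib sum_negf)
    \<comment> \<open>For \<open>n = 1\<close> the sum is empty, and \<open>\<phi>\<^sub>2\<close>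
      is 0 by convention.\<close>
    also have "(\<Sum>k=2..n. if k = 2 then \<phi> 2 p * C2 else 0) = \<phi> 2 p * C2"
      using conv[of 2] by (cases "2 \<le> n") (auto simp: n_def)
    finally show ?thesis .
  qed
  also have "(\<Sum>k=2..n. of_nat k * \<phi> k p * (\<Sum>i=2..k. f i * g (k + 2 - i)))
      = (\<Sum>i=2..n. \<Sum>j=2..n. of_nat (i + j - 2) * \<phi> (i + j - 2) p * (f i * g j))"
  proof -
    have conv': "k \<le> CARD('n)" if "\<phi> k p \<noteq> 0" for k using conv[of k] that by (cases "k \<le> CARD('n)") auto
    define F where "F = (\<lambda>i k. of_nat k * \<phi> k p * (f i * g (k + 2 - i)))"
    have "(\<Sum>k=2..n. of_nat k * \<phi> k p * (\<Sum>i=2..k. f i * g (k + 2 - i))) = (\<Sum>k=2..n. \<Sum>i\<in>{i. i \<in> {2..n} \<and> i \<le> k}. F i k)"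
      unfolding sum_distrib_left F_def by (intro sum.cong refl) auto
    also have "\<dots> = (\<Sum>i=2..n. \<Sum>k\<in>{k. k \<in> {2..n} \<and> i \<le> k}. F i k)"
      by (rule sum.swap_restrict) auto
    also have "\<dots> = (\<Sum>i=2..n. \<Sum>j=2..n. of_nat (i + j - 2) * \<phi> (i + j - 2) p * (f i * g j))"
    proof (rule sum.cong[OF refl])
      fix i assume i: "i \<in> {2..n}"
      \<comment> \<open>The range is enlarged past \<open>n\<close>, where
        \<open>\<phi>\<^sub>k = 0\<close>, so that \<open>j = k + 2 - i\<close> runs through all of
        \<open>{2..n}\<close>.\<close>
      have "(\<Sum>k\<in>{k. k \<in> {2..n} \<and> i \<le> k}. F i k) = (\<Sum>k=i..n+i-2. F i k)"
        by (rule sum.mono_neutral_left) (use i in \<open>auto simp: F_def n_def dest: conv'\<close>)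
      also have "\<dots> = (\<Sum>j=2..n. F i (i + j - 2))"
        by (rule sum.reindex_bij_witness[of _ "\<lambda>j. i + j - 2" "\<lambda>k. k + 2 - i"]) (use i in auto)
      also have "\<dots> = (\<Sum>j=2..n. of_nat (i + j - 2) * \<phi> (i + j - 2) p * (f i * g j))"
      proof (intro sum.cong refl)
        fix j assume "j \<in> {2..n}"
        then have "i + j - 2 + 2 - i = j" using i by auto
        then show "F i (i + j - 2) = of_nat (i + j - 2) * \<phi> (i + j - 2) p * (f i * g j)" by (simp only: F_def)
      qed
      finally show "(\<Sum>k\<in>{k. k \<in> {2..n} \<and> i \<le> k}. F i k)
          = (\<Sum>j=2..n. of_nat (i + j - 2) * \<phi> (i + j - 2) p * (f i * g j))" .
    qed
    finally show ?thesis .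
  qed
  finally have rhs': "(\<Sum>k\<le>n. \<phi> k p * D k) + \<phi> 1 p * X = \<phi> 1 p * (d * (f 1 + g 1) + C1)
      + (- (\<Sum>i=2..n. \<Sum>j=2..n. of_nat (i + j - 2) * \<phi> (i + j - 2) p * (f i * g j))
         + (\<Sum>k=2..n. of_nat k * \<gamma> * \<phi> k p * (f k + g k)) + \<phi> 2 p * C2)" .
  define E where "E = eta_value p"
  have E: "E 0 0 = \<phi> 1 p * C1 + \<phi> 2 p * C2" "E 0 1 = d * \<phi> 1 p" "E 1 0 = d * \<phi> 1 p" "E 1 1 = 0"
    "\<And>j. j \<in> {2..n} \<Longrightarrow> E 0 j = of_nat j * \<gamma> * \<phi> j p" "\<And>j. j \<in> {2..n} \<Longrightarrow> E j 0 = of_nat j * \<gamma> * \<phi> j p"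
    "\<And>j. j \<in> {2..n} \<Longrightarrow> E 1 j = 0" "\<And>j. j \<in> {2..n} \<Longrightarrow> E j 1 = 0"
    "\<And>i j. i \<in> {2..n} \<Longrightarrow> j \<in> {2..n} \<Longrightarrow> E i j = - (of_nat (i + j - 2) * \<phi> (i + j - 2) p)"
    by (auto simp: E_def eta_value_def Let_def C1_def C2_def d_def \<gamma>_def \<tau>_def c_def)
  have "(\<Sum>i\<le>n. \<Sum>j\<le>n. E i j * (f i * g j))
      = E 0 0 + E 0 1 * g 1 + (\<Sum>j=2..n. E 0 j * g j) + (E 1 0 * f 1 + E 1 1 * (f 1 * g 1) + (\<Sum>j=2..n. E 1 j * (f 1 * g j)))
       + (\<Sum>i=2..n. E i 0 * f i + E i 1 * (f i * g 1) + (\<Sum>j=2..n. E i j * (f i * g j)))"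
    unfolding n_def sum_atMost_CARD fg0 by simp
  also have "(\<Sum>j=2..n. E 0 j * g j) = (\<Sum>j=2..n. of_nat j * \<gamma> * \<phi> j p * g j)"
    by (intro sum.cong refl) (simp only: E)
  also have "(\<Sum>j=2..n. E 1 j * (f 1 * g j)) = 0" by (intro sum.neutral ballI) (simp only: E mult_zero_left)
  also have "(\<Sum>i=2..n. E i 0 * f i + E i 1 * (f i * g 1) + (\<Sum>j=2..n. E i j * (f i * g j)))
     = (\<Sum>i=2..n. of_nat i * \<gamma> * \<phi> i p * f i) - (\<Sum>i=2..n. \<Sum>j=2..n. of_nat (i + j - 2) * \<phi> (i + j - 2) p * (f i * g j))"
    unfolding sum_subtractf[symmetric]
    by (intro sum.cong refl) (simp add: E(6,8,9)[unfolded One_nat_def] sum_negf[symmetric])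
  finally have "(\<Sum>i\<le>n. \<Sum>j\<le>n. E i j * (f i * g j)) = (\<Sum>k\<le>n. \<phi> k p * D k) + \<phi> 1 p * X"
    unfolding rhs' E(1-4) distrib_left sum.distrib by (simp add: algebra_simps)
  from this[unfolded E_def f_def g_def n_def] show ?thesis
    unfolding \<tau>_def[symmetric] c_def[symmetric] rhs n_def by simp
qed

text \<open>One-variable independence, applied in \<open>y\<close> at fixed \<open>z\<close> and
  then in \<open>z\<close>. The filters are nested because \<open>y\<close> has to avoid
  \<open>z\<close> modulo the lattice, which no neighbourhood of (0, 0) ensures.\<close>

lemma phi_basis_product_independent:
  assumes t: "Im \<tau> > 0" and c: "c \<notin> period_lattice \<tau>"
    and zero: "\<forall>\<^sub>F z in at 0. \<forall>\<^sub>F y in at 0. (\<Sum>i\<le>n. \<Sum>j\<le>n. D i j * (phi_basis \<tau> c i z * phi_basis \<tau> c j y)) = 0"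
    and ij: "i \<le> n" "j \<le> n"
  shows "D i j = 0"
proof (rule phi_basis_independent[OF t c _ ij(1), where a = "\<lambda>i. D i j"])
  show "\<forall>\<^sub>F z in at 0. (\<Sum>i\<le>n. D i j * phi_basis \<tau> c i z) = 0"
    using zero
  proof eventually_elim
    case (elim z)
    show ?case
    proof (rule phi_basis_independent[OF t c _ ij(2), where a = "\<lambda>j. \<Sum>i\<le>n. D i j * phi_basis \<tau> c i z"])
      show "\<forall>\<^sub>F y in at 0. (\<Sum>j\<le>n. (\<Sum>i\<le>n. D i j * phi_basis \<tau> c i z) * phi_basis \<tau> c j y) = 0"
        using elim
      proof eventually_elim
        case (elim y)
        have "(\<Sum>j\<le>n. (\<Sum>i\<le>n. D i j * phi_basis \<tau> c i z) * phi_basis \<tau> c j y)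
           = (\<Sum>j\<le>n. \<Sum>i\<le>n. D i j * (phi_basis \<tau> c i z * phi_basis \<tau> c j y))"
          unfolding sum_distrib_right by (simp only: mult.assoc)
        also have "\<dots> = (\<Sum>i\<le>n. \<Sum>j\<le>n. D i j * (phi_basis \<tau> c i z * phi_basis \<tau> c j y))" by (rule sum.swap)
        finally show ?case using elim by simp
      qed
    qed
  qed
qed

text \<open>Only \<open>\<phi>\<^sub>0\<close> differs at \<open>p\<close> and \<open>p'\<close>, so the two superpotentials differ by the constant
  \<open>\<phi>\<^sub>0(p') - \<phi>\<^sub>0(p)\<close>, and \<open>g\<^sup>*\<close> turns out to be affine in \<open>\<phi>\<^sub>0\<close>.\<close>

lemma intersection_form_affine:
  assumes conv: "\<And>m. m > CARD('n) \<Longrightarrow> \<phi> m p = 0"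
    and p: "p \<in> U" "p' \<in> U"
    and same: "tau_of p' = tau_of p" "w_of p' = w_of p" "\<And>k. k \<in> {1..CARD('n)} \<Longrightarrow> \<phi> k p' = \<phi> k p"
    and ij: "i \<le> CARD('n)" "j \<le> CARD('n)"
  shows "g_coeff p' i j = g_coeff p i j + (\<phi> 0 p' - \<phi> 0 p) * eta_value p i j"
proof -
  define \<delta> where "\<delta> = \<phi> 0 p' - \<phi> 0 p"
  have t: "Im (tau_of p) > 0" and c: "c_of p \<notin> period_lattice (tau_of p)"
    using p U(1) by (auto simp: Omega_reg_def)
  have lam: "lam' p' = lam' p" "lam_w p' = lam_w p" "lam_tau p' = lam_tau p"
  proof -
    show "lam' p' = lam' p"
      by (intro ext) (simp add: lam'_def same phi_basis'_def sum_atMost_CARD CARD_ge_1[unfolded One_nat_def])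
    show "lam_w p' = lam_w p" using CARD_ge_1 by (intro ext) (simp add: lam_w_def same)
    show "lam_tau p' = lam_tau p"
      by (intro ext) (simp add: lam_tau_def same phi_basis_tau_def sum_atMost_CARD CARD_ge_1[unfolded One_nat_def])
  qed
  have sup: "superpotential p' z = superpotential p z + \<delta>" if "generic_arg p z" for z
  proof -
    have g: "z \<notin> period_lattice (tau_of p)" "z + c_of p \<notin> period_lattice (tau_of p)"
      using that by (auto simp: generic_arg_def tau_of_def w_of_def)
    have "superpotential p z = (\<Sum>k\<le>CARD('n). \<phi> k p * basis_at p k z)"
      by (rule superpotential_expansion[OF phi]) (use p U(1) g in auto)
    moreover have "superpotential p' z = (\<Sum>k\<le>CARD('n). \<phi> k p' * basis_at p' k z)"
      by (rule superpotential_expansion[OF phi]) (use p U(1) g in \<open>auto simp: same\<close>)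
    moreover have "basis_at p 0 z = 1" by (simp add: phi_basis_def)
    ultimately show ?thesis
      using CARD_ge_1 by (simp add: sum_atMost_CARD same \<delta>_def algebra_simps)
  qed
  define D where "D = (\<lambda>i j. g_coeff p' i j - g_coeff p i j - \<delta> * eta_value p i j)"
  have "D i j = 0"
  proof (rule phi_basis_product_independent[OF t c _ ij])
    have gen: "\<forall>\<^sub>F z in at 0. generic_arg p z \<and> generic_arg p' z"
      by (intro eventually_conj eventually_generic_arg) (use t same in simp_all)
    show "\<forall>\<^sub>F z in at 0. \<forall>\<^sub>F y in at 0.
        (\<Sum>i\<le>CARD('n). \<Sum>j\<le>CARD('n). D i j * (basis_at p i z * basis_at p j y)) = 0"
      using gen
    proof eventually_elim
      case z: (elim z)
      show ?case
        using gen eventually_not_period_lattice[OF t, of z 0]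
      proof eventually_elim
        case y: (elim y)
        then have zy: "z - y \<notin> period_lattice (tau_of p)" using period_lattice_diff_commute by blast
        \<comment> \<open>The w-part is affine in the superpotential values. The factor
          \<open>N\<close> cancels against \<open>1 / (N (N + 1))\<close>, which leaves the slope
          with \<open>1 / (N + 1)\<close>.\<close>
        have M: "1 / (N * (N + 1)) * (a * (b + N * (l + \<delta>) * x) + a' * (b' + N * (l' + \<delta>) * x') - q)
           = 1 / (N * (N + 1)) * (a * (b + N * l * x) + a' * (b' + N * l' * x') - q) + \<delta> * (1 / (N + 1) * (a * x + a' * x'))"
          if "N \<noteq> 0" "N + 1 \<noteq> 0" for N a b l x a' b' l' x' q :: complex
        proof -
          have e1: "a * (b + N * (l + \<delta>) * x) + a' * (b' + N * (l' + \<delta>) * x') - q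
            = (a * (b + N * l * x) + a' * (b' + N * l' * x') - q) + N * (\<delta> * (a * x + a' * x'))"
            by (simp add: algebra_simps)
          have e2: "1 / (N * (N + 1)) * (X + N * (\<delta> * Y)) = 1 / (N * (N + 1)) * X + \<delta> * (1 / (N + 1) * Y)" for X Y
            using that by (subst distrib_left) simp
          show ?thesis unfolding e1 e2 ..
        qed
        have N: "(of_nat CARD('n) :: complex) \<noteq> 0" "of_nat CARD('n) + 1 \<noteq> (0 :: complex)"
        proof -
          show "(of_nat CARD('n) :: complex) \<noteq> 0" by simp
          have "(of_nat CARD('n) + 1 :: complex) = of_nat (Suc CARD('n))" by simp
          then show "of_nat CARD('n) + 1 \<noteq> (0 :: complex)" by (simp only: of_nat_eq_0_iff; simp)
        qed
        have "(\<Sum>i\<le>CARD('n). \<Sum>j\<le>CARD('n). D i j * (basis_at p i z * basis_at p j y))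
          = (\<Sum>i\<le>CARD('n). \<Sum>j\<le>CARD('n). g_coeff p' i j * (basis_at p' i z * basis_at p' j y))
           - (\<Sum>i\<le>CARD('n). \<Sum>j\<le>CARD('n). g_coeff p i j * (basis_at p i z * basis_at p j y))
           - \<delta> * (\<Sum>i\<le>CARD('n). \<Sum>j\<le>CARD('n). eta_value p i j * (basis_at p i z * basis_at p j y))"
          unfolding D_def same sum_distrib_left sum_subtractf[symmetric]
          by (intro sum.cong refl) (simp add: algebra_simps)
        also have "(\<Sum>i\<le>CARD('n). \<Sum>j\<le>CARD('n). g_coeff p' i j * (basis_at p' i z * basis_at p' j y))
            = superpotential_form p' z y (superpotential p z + \<delta>) (superpotential p y + \<delta>)"
          using intersection_form_superpotential[of p' z y] z y zy p by (simp add: same sup)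
        also have "(\<Sum>i\<le>CARD('n). \<Sum>j\<le>CARD('n). g_coeff p i j * (basis_at p i z * basis_at p j y))
            = superpotential_form p z y (superpotential p z) (superpotential p y)"
          using intersection_form_superpotential[of p z y] z y zy p by simp
        also have "(\<Sum>i\<le>CARD('n). \<Sum>j\<le>CARD('n). eta_value p i j * (basis_at p i z * basis_at p j y)) =
           - lam' p z * (rho (tau_of p) y + rho (tau_of p) (z - y)) - lam' p y * (rho (tau_of p) z - rho (tau_of p) (z - y))
           + 1 / (of_nat CARD('n) + 1) * (lam_w p y * (rho (tau_of p) z - rho (tau_of p) (z + c_of p))
           + lam_w p z * (rho (tau_of p) y - rho (tau_of p) (y + c_of p))) + (lam_tau p y + lam_tau p z)"
          by (rule eta_value_sum[OF conv p(1)]) (use z y zy in auto)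
        also have "superpotential_form p' z y (superpotential p z + \<delta>) (superpotential p y + \<delta>)
              - superpotential_form p z y (superpotential p z) (superpotential p y)
              - \<delta> * (- lam' p z * (rho (tau_of p) y + rho (tau_of p) (z - y)) - lam' p y * (rho (tau_of p) z - rho (tau_of p) (z - y))
           + 1 / (of_nat CARD('n) + 1) * (lam_w p y * (rho (tau_of p) z - rho (tau_of p) (z + c_of p))
           + lam_w p z * (rho (tau_of p) y - rho (tau_of p) (y + c_of p))) + (lam_tau p y + lam_tau p z)) = 0"
          unfolding superpotential_form_def Let_def lam same M[OF N] by (simp add: algebra_simps)
        finally show ?case .
      qed
    qed
  qed
  then show ?thesis by (simp add: D_def \<delta>_def diff_eq_eq add.commute)
qed

text \<open>\<open>q x\<close> is the point of the chart whose first coordinate is \<open>x\<close>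
  and whose others are those of \<open>p\<close>. It exists for \<open>x\<close> near
  \<open>\<phi>\<^sub>0(p)\<close> because the image of the chart is open, and along it
  \<open>g_coeff\<close> is affine, so the derivative is the slope.\<close>

lemma eta_star_eq:
  assumes conv: "\<And>m. m > CARD('n) \<Longrightarrow> \<phi> m p = 0" and p: "p \<in> U"
    and ij: "i \<le> CARD('n)" "j \<le> CARD('n)"
  shows "eta_star \<phi> e U i j p = eta_value p i j"
proof -
  let ?\<Phi> = "phi_coords \<phi> e"
  define q where "q = (\<lambda>x. inv_into U ?\<Phi> (x, snd (?\<Phi> p)))"
  have "open (?\<Phi> ` U)" using U(2) by (simp add: local_coordinates_on_def)
  then have "open ((\<lambda>x. (x, snd (?\<Phi> p))) -` (?\<Phi> ` U))"
    by (rule open_vimage) (intro continuous_intros)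
  then have "\<forall>\<^sub>F x in nhds (fst (?\<Phi> p)). x \<in> (\<lambda>x. (x, snd (?\<Phi> p))) -` (?\<Phi> ` U)"
    by (rule eventually_nhds_in_open) (use p in simp)
  then have ev: "\<forall>\<^sub>F x in nhds (\<phi> 0 p). g_coeff (q x) i j = g_coeff p i j + (x - \<phi> 0 p) * eta_value p i j"
    unfolding phi_coords_def[of \<phi> e p] fst_conv
  proof eventually_elim
    case (elim x)
    then have mem: "(x, snd (?\<Phi> p)) \<in> ?\<Phi> ` U" by (simp add: phi_coords_def)
    have qU: "q x \<in> U" unfolding q_def by (rule inv_into_into[OF mem])
    have "?\<Phi> (q x) = (x, snd (?\<Phi> p))" unfolding q_def by (rule f_inv_into_f[OF mem])
    then have eq: "\<phi> 0 (q x) = x" "\<And>a. \<phi> (e a) (q x) = \<phi> (e a) p" "w_of (q x) = w_of p" "tau_of (q x) = tau_of p"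
      by (simp_all add: phi_coords_def vec_eq_iff)
    have "\<phi> k (q x) = \<phi> k p" if "k \<in> {1..CARD('n)}" for k
    proof -
      have "k \<in> e ` UNIV" using that e by (simp add: bij_betw_def)
      then show ?thesis using eq(2) by auto
    qed
    from intersection_form_affine[OF conv p qU eq(4,3) this ij] show ?case by (simp add: eq(1))
  qed
  have d: "((\<lambda>x. g_coeff p i j + (x - \<phi> 0 p) * eta_value p i j) has_field_derivative eta_value p i j) (at (\<phi> 0 p))"
    by (auto intro!: derivative_eq_intros)
  have "((\<lambda>x. g_coeff (q x) i j) has_field_derivative eta_value p i j) (at (\<phi> 0 p))"
    by (rule DERIV_cong_ev[OF refl ev refl, THEN iffD2, OF d])
  then have "deriv (\<lambda>x. g_coeff (q x) i j) (\<phi> 0 p) = eta_value p i j" by (rule DERIV_imp_deriv)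
  then show ?thesis
    unfolding eta_star_def partial_first_def g_coeff_def q_def by (simp add: phi_coords_def)
qed

end

theorem theorem1p3:
  fixes \<phi> :: "nat \<Rightarrow> ('n::finite) point \<Rightarrow> complex"
    and e :: "'n \<Rightarrow> nat" and U :: "'n point set" and p :: "'n point"
  assumes phi: "defines_phi \<phi>"
    and phi_conv: "\<And>m q. m > CARD('n) \<Longrightarrow> \<phi> m q = 0"
    and e: "bij_betw e UNIV {1..CARD('n)}"
    and U: "U \<subseteq> Omega_reg" "local_coordinates_on (phi_coords \<phi> e) U"
    and p: "p \<in> U"
  shows "(\<forall>i\<in>{2..CARD('n)}. \<forall>j\<in>{2..CARD('n)}.
            eta_tilde \<phi> e U i j p = - (of_nat (i + j - 2) * \<phi> (i + j - 2) p)) \<and>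
         (\<forall>i\<in>{0..CARD('n)}. i \<noteq> 0 \<and> i \<noteq> 1 \<longrightarrow> eta_tilde \<phi> e U i 0 p = 0) \<and>
         (\<forall>j\<in>{0..CARD('n)}. j \<noteq> 0 \<longrightarrow> eta_tilde \<phi> e U 1 j p = 0) \<and>
         eta_tilde \<phi> e U 1 0 p =
           - (weierstrass_p ((of_nat CARD('n) + 1) * w_of p) (tau_of p) * \<phi> 1 p)"
proof -
  interpret phi_chart \<phi> e U by unfold_locales (rule phi e U)+
  note star = eta_star_eq[OF phi_conv p]
  have n1: "1 \<le> CARD('n)" by (rule CARD_ge_1)
  have t: "Im (tau_of p) > 0" "c_of p \<notin> period_lattice (tau_of p)" using p U(1) by (auto simp: Omega_reg_def)
  have "eta_tilde \<phi> e U i j p = - (of_nat (i + j - 2) * \<phi> (i + j - 2) p)"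
    if "i \<in> {2..CARD('n)}" "j \<in> {2..CARD('n)}" for i j
    using that star[of i j] by (simp add: eta_tilde_def eta_value_def)
  \<comment> \<open>Here \<open>eta_star\<close> equals
    \<open>i \<gamma>\<^sub>1 \<phi>\<^sub>i\<close>, which the correction with
    \<open>k\<^sub>i = - i\<close> removes exactly.\<close>
  moreover have "eta_tilde \<phi> e U i 0 p = 0" if "i \<in> {0..CARD('n)}" "i \<noteq> 0" "i \<noteq> 1" for i
    using that star[of 0 i] by (simp add: eta_tilde_def eta_value_def Let_def)
  moreover have "eta_tilde \<phi> e U 1 j p = 0" if "j \<in> {0..CARD('n)}" "j \<noteq> 0" for j
    using that star[of 1 j] n1 by (simp add: eta_tilde_def eta_value_def)
  \<comment> \<open>\<open>\<rho>'(c) - \<gamma>\<^sub>1 = - \<wp>(c)\<close>: the correction with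
    \<open>k\<^sub>1 = - 1\<close> completes the derivative of \<open>rho\<close> to the Weierstrass
    function.\<close>
  moreover have "eta_tilde \<phi> e U 1 0 p = - (weierstrass_p (c_of p) (tau_of p) * \<phi> 1 p)"
    using star[of 0 1] n1 unfolding weierstrass_p_rho[OF t]
    by (simp add: eta_tilde_def eta_value_def Let_def algebra_simps)
  ultimately show ?thesis by blast
qed

end
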